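(* Let $n\ge 1$, let $p\ge0$ be an integer, let $L,L',h_0\in\mathbb R$ satisfy $0<L+\frac32h_0\sqrt n<L'$ and $0<h_0\le1$, and let $\boldsymbol\alpha\in\mathbb R^n$ with $|\boldsymbol\alpha|_\infty\le 1/2$. Let $v\in C_c^\infty(B_L)$, $\ell_0\in C^\infty(\mathbb S^{n-1})$, $\gamma>-n$, and $$f_0(\mathbf x)=s_0(\mathbf x-h\boldsymbol\alpha)\,v(\mathbf x),\qquad s_0(\mathbf x)=|\mathbf x|^\gamma\ell_0\!\left(\frac{\mathbf x}{|\mathbf x|}\right),$$ with $0<h<h_0$, so that the singular point is $\mathbf x_0=h\boldsymbol\alpha$. Let $\mathcal D=\{\mathbf c_i\}_{i=1}^{\pi(p)}\subset\mathbb Z^n$ be a set of correction nodes for which the matrix $K$ (defined in the context) is invertible. Then the $p$-th order corrected trapezoidal rule $\mathcal S_h^p$ (defined in the context) converges with order $\gamma+n+p+1$: $$\mathcal I[f_0]-\mathcal S_h^p[f_0]=\mathcal O(h^{\gamma+n+p+1}).$$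
   Context: $|\cdot|$ is the Euclidean norm on $\mathbb R^n$, $|\mathbf x|_\infty=\max_i|x_i|$, $B_r=\{\mathbf x\in\mathbb R^n:|\mathbf x|<r\}$, $\mathbb S^{n-1}$ is the unit sphere. $\mathcal I[f]:=\int_{\mathbb R^n}f\,d\mathbf x$ and the punctured trapezoidal rule is $T_h^0[f]:=h^n\sum_{\mathbf y\in h\mathbb Z^n\setminus\{\mathbf 0\}}f(\mathbf y)$. $v$ and $f_0$ are extended by zero outside $B_L$. $\mathcal O(\cdot)$ refers to $h\to0^+$ with all data other than $h$ (in particular $\boldsymbol\alpha,\gamma,\ell_0,v,p,\mathcal D$) fixed. $\psi\in C_c^\infty(\mathbb R^n)$ is a fixed function with $\psi(\mathbf x)=1$ for $|\mathbf x|_\infty\le\frac34$ and $\psi(\mathbf x)=0$ for $|\mathbf x|_\infty\ge1$. $\pi(p)=\sum_{q=0}^p\binom{q+n-1}{n-1}$ is the number of multi-indices $\nu\in\mathbb N_0^n$ with $|\nu|\le p$; enumerate them as $\nu_1,\dots,\nu_{\pi(p)}$. Corrected trapezoidal rule. Let $\Lambda>0$ be a constant with $\Lambda\ge\frac43h_0\max_i|\mathbf c_i|$. For a multi-index $\beta$ put $$P_\beta(\mathbf x):=\mathbf x^\beta\psi(\mathbf x/\Lambda),\qquad R_\beta(h):=\frac{(\mathcal I-T_h^0)\big[s_0(\cdot-h\boldsymbol\alpha)P_\beta(\cdot-h\boldsymbol\alpha)\big]}{h^{\gamma+n+|\beta|}}.$$ Let $K$ be the $\pi(p)\times\pi(p)$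 matrix with entries $K_{ji}=(\mathbf c_i-\boldsymbol\alpha)^{\nu_j}$, and let $V(h)=(R_{\nu_1}(h),\dots,R_{\nu_{\pi(p)}}(h))^T$. Let $\omega(h)=(\omega_1(h),\dots,\omega_{\pi(p)}(h))^T$ be the solution of $K\omega(h)=V(h)$, and define the correction weights as $\omega_i:=\lim_{h\to0^+}\omega_i(h)$. The $p$-th order corrected trapezoidal rule is $$\mathcal S_h^p[f_0]:=T_h^0[f_0]+h^{\gamma+n}\sum_{i=1}^{\pi(p)}\omega_i\,v(h\mathbf c_i).$$ *)

theory Defs
  imports "HOL-Analysis.Analysis" "HOL-Library.Landau_Symbols"
begin


primrec Ck_on :: "nat \<Rightarrow> 'a::real_normed_vector set \<Rightarrow> ('a \<Rightarrow> 'b::real_normed_vector) \<Rightarrow> bool"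
where
  "Ck_on 0 S f \<longleftrightarrow> continuous_on S f"
| "Ck_on (Suc k) S f \<longleftrightarrow>
     (\<forall>x\<in>S. f differentiable (at x)) \<and>
     (\<forall>u. Ck_on k S (\<lambda>x. frechet_derivative f (at x) u))"

text \<open>\<open>C\<^sup>\<infinity>\<close> on an open set \<open>S\<close> of a finite-dimensional space: all iterated directional
  derivatives exist and are differentiable. Only meant for open \<open>S\<close>.\<close>
definition smooth_on :: "'a::real_normed_vector set \<Rightarrow> ('a \<Rightarrow> 'b::real_normed_vector) \<Rightarrow> bool"
  where "smooth_on S f \<longleftrightarrow> (\<forall>k. Ck_on k S f)"

text \<open>\<open>C\<^sup>\<infinity>\<close> on a submanifold \<open>M\<close>, as local extendability to smooth functions on open sets of the
  ambient space; the values of \<open>f\<close> off \<open>M\<close> are irrelevant.\<close>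
definition smooth_on_submanifold ::
    "'a::real_normed_vector set \<Rightarrow> ('a \<Rightarrow> 'b::real_normed_vector) \<Rightarrow> bool"
  where "smooth_on_submanifold M f \<longleftrightarrow>
    (\<forall>x\<in>M. \<exists>U g. open U \<and> x \<in> U \<and> smooth_on U g \<and> (\<forall>y\<in>U \<inter> M. g y = f y))"

text \<open>\<open>C\<^sub>c\<^sup>\<infinity>(U)\<close> for open \<open>U\<close>. Its members are total functions, so the extension by zero outside \<open>U\<close>
  is built in: the support, taken in the whole space, is a compact subset of \<open>U\<close>.\<close>
definition Cc_infinity :: "'a::real_normed_vector set \<Rightarrow> ('a \<Rightarrow> 'b::real_normed_vector) set"
  where "Cc_infinity U =
    {f. smooth_on U f \<and> compact (closure {x. f x \<noteq> 0}) \<and> closure {x. f x \<noteq> 0} \<subseteq> U}"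

definition lattice_pt :: "int^'n \<Rightarrow> real^'n"
  where "lattice_pt z = (\<chi> k. real_of_int (z $ k))"

definition mi_order :: "nat^'n \<Rightarrow> nat"
  where "mi_order \<beta> = (\<Sum>k\<in>UNIV. \<beta> $ k)"

definition monomial :: "nat^'n \<Rightarrow> real^'n \<Rightarrow> real"
  where "monomial \<beta> x = (\<Prod>k\<in>UNIV. (x $ k) ^ (\<beta> $ k))"

definition num_multi_indices :: "nat \<Rightarrow> nat \<Rightarrow> nat"
  where "num_multi_indices n p = (\<Sum>q=0..p. (q + n - 1) choose (n - 1))"

definition enumerates_multi_indices :: "('m \<Rightarrow> nat^'n) \<Rightarrow> nat \<Rightarrow> bool"
  where "enumerates_multi_indices \<nu> p \<longleftrightarrow> bij_betw \<nu> UNIV {\<beta>. mi_order \<beta> \<le> p}"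

lemma card_multi_indices_eq:
  "finite {\<beta>::nat^'n. mi_order \<beta> = q} \<and>
   card {\<beta>::nat^'n. mi_order \<beta> = q} = (q + CARD('n) - 1) choose (CARD('n) - 1)"
proof -
  let ?n = "CARD('n)"
  let ?A = "{\<beta>::nat^'n. mi_order \<beta> = q}"
  let ?B = "{l::nat list. length l = ?n \<and> sum_list l = q}"
  obtain e :: "nat \<Rightarrow> 'n" where e: "bij_betw e {0..<?n} UNIV"
    using ex_bij_betw_nat_finite[of "UNIV :: 'n set"] by auto
  define \<phi> where "\<phi> = (\<lambda>\<beta>::nat^'n. map (\<lambda>i. \<beta> $ e i) [0..<?n])"
  have sum_\<phi>: "sum_list (\<phi> \<beta>) = mi_order \<beta>" for \<beta>
    using sum.reindex_bij_betw[OF e, of "\<lambda>k. \<beta> $ k"]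
    by (simp add: \<phi>_def mi_order_def interv_sum_list_conv_sum_set_nat)
  have inj: "inj_on \<phi> ?A"
  proof (rule inj_onI)
    fix x y :: "nat^'n"
    assume "\<phi> x = \<phi> y"
    then have eq: "x $ e i = y $ e i" if "i < ?n" for i
      using that by (simp add: \<phi>_def)
    have "x $ k = y $ k" for k
    proof -
      have "k \<in> e ` {0..<?n}"
        using e by (simp add: bij_betw_def)
      then show ?thesis using eq by auto
    qed
    then show "x = y" by (simp add: vec_eq_iff)
  qed
  have img: "\<phi> ` ?A = ?B"
  proof
    show "\<phi> ` ?A \<subseteq> ?B" using sum_\<phi> by (auto simp: \<phi>_def)
    show "?B \<subseteq> \<phi> ` ?A"
    proof
      fix l assume l: "l \<in> ?B"
      define \<beta> :: "nat^'n" where "\<beta> = (\<chi> k. l ! inv_into {0..<?n} e k)"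
      have "\<phi> \<beta> = l"
        using l bij_betw_inv_into_left[OF e]
        by (intro nth_equalityI) (auto simp: \<phi>_def \<beta>_def)
      moreover have "mi_order \<beta> = q"
        using sum_\<phi>[of \<beta>] l \<open>\<phi> \<beta> = l\<close> by simp
      ultimately show "l \<in> \<phi> ` ?A" by blast
    qed
  qed
  have card_B: "card ?B = (q + ?n - 1) choose q"
    by (rule card_length_sum_list)
  have "(q + ?n - 1) choose q = (q + ?n - 1) choose (?n - 1)"
  proof -
    have "?n \<ge> 1" by (simp add: Suc_leI)
    then have "q \<le> q + ?n - 1" and "q + ?n - 1 - q = ?n - 1" by linarith+
    then show ?thesis using binomial_symmetric[of q "q + ?n - 1"] by simp
  qed
  moreover have "card ?A = card ?B"
    using card_image[OF inj] img by simp
  moreover have "finite ?A"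
  proof -
    have "?B \<subseteq> {l. set l \<subseteq> {..q} \<and> length l = ?n}"
      by (auto simp: member_le_sum_list)
    then have "finite ?B"
      using finite_lists_length_eq[of "{..q}" ?n] finite_subset by blast
    then show ?thesis using img inj finite_image_iff by metis
  qed
  ultimately show ?thesis using card_B by simp
qed

lemma card_multi_indices_le:
  "card {\<beta>::nat^'n. mi_order \<beta> \<le> p} = num_multi_indices CARD('n) p"
proof -
  have "{\<beta>::nat^'n. mi_order \<beta> \<le> p} = (\<Union>q\<in>{0..p}. {\<beta>. mi_order \<beta> = q})"
    by auto
  also have "card \<dots> = (\<Sum>q=0..p. card {\<beta>::nat^'n. mi_order \<beta> = q})"
    by (rule card_UN_disjoint) (auto simp: card_multi_indices_eq)
  finally show ?thesis
    by (simp add: card_multi_indices_eq num_multi_indices_def)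
qed

text \<open>The index type \<open>'m\<close> of the nodes and of the matrix rows thus plays the role of
  \<open>{1, \<dots>, \<pi>(p)}\<close>.\<close>
lemma enumerates_multi_indices_card:
  fixes \<nu> :: "'m::finite \<Rightarrow> nat^'n"
  assumes "enumerates_multi_indices \<nu> p"
  shows "CARD('m) = num_multi_indices CARD('n) p"
  using assms bij_betw_same_card card_multi_indices_le
  by (metis enumerates_multi_indices_def)

definition punctured_trapezoid :: "real \<Rightarrow> (real^'n \<Rightarrow> real) \<Rightarrow> real"
  where "punctured_trapezoid h f =
    h ^ CARD('n) * (\<Sum>\<^sub>\<infinity>y\<in>{h *\<^sub>R lattice_pt z |z. z \<noteq> 0}. f y)"

text \<open>At \<open>x = 0\<close> the library conventions give the value \<open>0\<close>. It is irrelevant below: for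
  \<open>|\<alpha>|\<^sub>\<infinity> \<le> 1/2\<close> the point \<open>h \<alpha>\<close> is never a node of the punctured grid.\<close>
definition sing_fun :: "real \<Rightarrow> (real^'n \<Rightarrow> real) \<Rightarrow> real^'n \<Rightarrow> real"
  where "sing_fun \<gamma> l\<^sub>0 x = norm x powr \<gamma> * l\<^sub>0 (x /\<^sub>R norm x)"

definition cutoff_monomial :: "(real^'n \<Rightarrow> real) \<Rightarrow> real \<Rightarrow> nat^'n \<Rightarrow> real^'n \<Rightarrow> real"
  where "cutoff_monomial \<psi> \<Lambda> \<beta> x = monomial \<beta> x * \<psi> (x /\<^sub>R \<Lambda>)"

definition scaled_error ::
    "real \<Rightarrow> (real^'n \<Rightarrow> real) \<Rightarrow> real^'n \<Rightarrow> (real^'n \<Rightarrow> real) \<Rightarrow> real \<Rightarrow> nat^'n \<Rightarrow> real \<Rightarrow> real"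
  where "scaled_error \<gamma> l\<^sub>0 \<alpha> \<psi> \<Lambda> \<beta> h =
    (let g = (\<lambda>x. sing_fun \<gamma> l\<^sub>0 (x - h *\<^sub>R \<alpha>) * cutoff_monomial \<psi> \<Lambda> \<beta> (x - h *\<^sub>R \<alpha>))
     in (integral\<^sup>L lborel g - punctured_trapezoid h g)
        / h powr (\<gamma> + real CARD('n) + real (mi_order \<beta>)))"

text \<open>The matrix entry \<open>K\<^sub>j\<^sub>i\<close> has row index \<open>j\<close> (multi-index) and column index \<open>i\<close> (node).\<close>
definition node_matrix ::
    "real^'n \<Rightarrow> ('m::finite \<Rightarrow> nat^'n) \<Rightarrow> ('m \<Rightarrow> int^'n) \<Rightarrow> real^'m^'m"
  where "node_matrix \<alpha> \<nu> c = (\<chi> j i. monomial (\<nu> j) (lattice_pt (c i) - \<alpha>))"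

definition weights_at ::
    "real \<Rightarrow> (real^'n \<Rightarrow> real) \<Rightarrow> real^'n \<Rightarrow> (real^'n \<Rightarrow> real) \<Rightarrow> real
      \<Rightarrow> ('m::finite \<Rightarrow> nat^'n) \<Rightarrow> ('m \<Rightarrow> int^'n) \<Rightarrow> real \<Rightarrow> real^'m"
  where "weights_at \<gamma> l\<^sub>0 \<alpha> \<psi> \<Lambda> \<nu> c h =
    (THE w. node_matrix \<alpha> \<nu> c *v w = (\<chi> j. scaled_error \<gamma> l\<^sub>0 \<alpha> \<psi> \<Lambda> (\<nu> j) h))"

definition correction_weight ::
    "real \<Rightarrow> (real^'n \<Rightarrow> real) \<Rightarrow> real^'n \<Rightarrow> (real^'n \<Rightarrow> real) \<Rightarrow> real
      \<Rightarrow> ('m::finite \<Rightarrow> nat^'n) \<Rightarrow> ('m \<Rightarrow> int^'n) \<Rightarrow> 'm \<Rightarrow> real"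
  where "correction_weight \<gamma> l\<^sub>0 \<alpha> \<psi> \<Lambda> \<nu> c i =
    Lim (at_right 0) (\<lambda>h. weights_at \<gamma> l\<^sub>0 \<alpha> \<psi> \<Lambda> \<nu> c h $ i)"

definition singular_integrand ::
    "real \<Rightarrow> (real^'n \<Rightarrow> real) \<Rightarrow> real^'n \<Rightarrow> (real^'n \<Rightarrow> real) \<Rightarrow> real \<Rightarrow> real^'n \<Rightarrow> real"
  where "singular_integrand \<gamma> l\<^sub>0 \<alpha> v h x = sing_fun \<gamma> l\<^sub>0 (x - h *\<^sub>R \<alpha>) * v x"

definition corrected_trapezoid ::
    "real \<Rightarrow> (real^'n \<Rightarrow> real) \<Rightarrow> real^'n \<Rightarrow> (real^'n \<Rightarrow> real) \<Rightarrow> real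
      \<Rightarrow> ('m::finite \<Rightarrow> nat^'n) \<Rightarrow> ('m \<Rightarrow> int^'n) \<Rightarrow> (real^'n \<Rightarrow> real) \<Rightarrow> real \<Rightarrow> real"
  where "corrected_trapezoid \<gamma> l\<^sub>0 \<alpha> \<psi> \<Lambda> \<nu> c v h =
    punctured_trapezoid h (singular_integrand \<gamma> l\<^sub>0 \<alpha> v h)
    + h powr (\<gamma> + real CARD('n))
      * (\<Sum>i\<in>UNIV. correction_weight \<gamma> l\<^sub>0 \<alpha> \<psi> \<Lambda> \<nu> c i * v (h *\<^sub>R lattice_pt (c i)))"

end

theory Submission
  imports Defs
begin

text \<open>
  The proof uses neither Fourier analysis nor the Euler-Maclaurin formula. Its engine is the
  estimate \<open>symbol_quadrature_error\<close>: if the derivatives of \<open>f\<close> satisfy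
  \<open>\<bar>\<partial>\<^sup>j f x\<bar> \<le> C * norm x powr (m - j)\<close> off the origin up to a sufficiently high order, with
  \<open>m > - n\<close>, and \<open>f\<close> has bounded support, then the punctured lattice sum of mesh size \<open>1\<close> differs
  from the integral by at most \<open>K * C\<close>, where \<open>K\<close> does not depend on \<open>f\<close>. Near the origin, integral
  and sum are bounded separately. Away from it \<open>f\<close> is smooth, its lattice periodisation has the
  integral as its mean over a cell, and the oscillation of the periodisation is bounded by the
  supremum of its derivatives of any order, since by Rolle's theorem a derivative of a periodic
  function along a period has a zero on every line in that direction. For derivatives of high order
  the lattice sum of the bounds converges.

  Two applications of this estimate give the theorem.

  First, the scaled error of a homogeneous function times a monomial depends on \<open>h\<close> only through the
  width of the cutoff (\<open>scaled_error_eq\<close>). Widening the cutoff changes the integrand only at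
  distance at least a multiple of \<open>1 / h\<close> from the origin, where it counts as a symbol of arbitrarily
  high order with a small constant. Therefore the scaled errors, and with them the weights, converge
  faster than any power of \<open>h\<close> (\<open>dilated_cutoff_error_converges\<close>), and the limit weights solve the
  limit system (\<open>correction_weight_system\<close>).

  Second, \<open>v\<close> is expanded at the moving singular point \<open>h *\<^sub>R \<alpha>\<close> (\<open>cutoff_taylor\<close>). The remainder
  vanishes to order \<open>p + 1\<close> there, so that after scaling by \<open>h\<close> the estimate bounds its error by a
  multiple of \<open>h powr (\<gamma> + n + p + 1)\<close>. The error of each monomial of degree at most \<open>p\<close> is, up to an
  error of the same size, what the correction term contributes: this is what the linear system for
  the weights says (\<open>corrected_trapezoid_error_bound\<close>).
\<close>

section \<open>Calculus of \<open>C\<^sup>k\<close> functions\<close>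

abbreviation dir_deriv :: "'a::real_normed_vector \<Rightarrow> ('a \<Rightarrow> 'b::real_normed_vector) \<Rightarrow> 'a \<Rightarrow> 'b"
  where "dir_deriv u f \<equiv> (\<lambda>x. frechet_derivative f (at x) u)"

lemma dir_deriv_eq:
  assumes "(f has_derivative f') (at x)"
  shows "dir_deriv u f x = f' u"
  using frechet_derivative_at[OF assms] by simp

lemma dir_deriv_add:
  assumes "f differentiable (at x)" "g differentiable (at x)"
  shows "dir_deriv u (\<lambda>x. f x + g x) x = dir_deriv u f x + dir_deriv u g x"
  using assms by (intro dir_deriv_eq) (auto intro!: derivative_eq_intros simp: frechet_derivative_works[symmetric])

lemma dir_deriv_mult:
  fixes f g :: "'a::real_normed_vector \<Rightarrow> real"
  assumes "f differentiable (at x)" "g differentiable (at x)"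
  shows "dir_deriv u (\<lambda>x. f x * g x) x = dir_deriv u f x * g x + f x * dir_deriv u g x"
  using assms by (subst dir_deriv_eq[of _ "\<lambda>u. f x * dir_deriv u g x + dir_deriv u f x * g x"])
    (auto intro!: derivative_eq_intros simp: frechet_derivative_works[symmetric])

lemma dir_deriv_cong_open:
  assumes "open S" "x \<in> S" "\<And>y. y \<in> S \<Longrightarrow> f y = g y"
  shows "f differentiable (at x) \<longleftrightarrow> g differentiable (at x)"
    and "dir_deriv u f x = dir_deriv u g x"
proof -
  have "(f has_derivative D) (at x) \<longleftrightarrow> (g has_derivative D) (at x)" for D
    using has_derivative_transform_within_open[OF _ assms(1,2)] assms(3) by metis
  then show "f differentiable (at x) \<longleftrightarrow> g differentiable (at x)"
    and "dir_deriv u f x = dir_deriv u g x"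
    by (auto simp: differentiable_def frechet_derivative_def)
qed

lemma Ck_on_cong:
  assumes "open S" "\<And>x. x \<in> S \<Longrightarrow> f x = g x"
  shows "Ck_on k S f \<longleftrightarrow> Ck_on k S g"
  using assms(2)
proof (induction k arbitrary: f g)
  case 0
  then show ?case by (simp cong: continuous_on_cong)
next
  case (Suc k)
  note eq = dir_deriv_cong_open[OF assms(1) _ Suc.prems]
  have "Ck_on k S (dir_deriv u f) \<longleftrightarrow> Ck_on k S (dir_deriv u g)" for u
    by (rule Suc.IH) (rule eq(2))
  then show ?case by (simp add: eq(1) cong: ball_cong)
qed

lemma Ck_on_subset: "Ck_on k S f \<Longrightarrow> T \<subseteq> S \<Longrightarrow> Ck_on k T f"
  by (induction k arbitrary: f) (auto intro: continuous_on_subset)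

lemma Ck_on_Suc_imp: "Ck_on (Suc k) S f \<Longrightarrow> Ck_on k S f"
proof (induction k arbitrary: f)
  case 0
  then show ?case
    by (auto intro!: continuous_at_imp_continuous_on differentiable_imp_continuous_within)
qed auto

lemma Ck_on_local:
  assumes "\<And>x. x \<in> S \<Longrightarrow> \<exists>U. open U \<and> x \<in> U \<and> Ck_on k U f"
  shows "Ck_on k S f"
  using assms
proof (induction k arbitrary: f)
  case 0
  then have "isCont f x" if "x \<in> S" for x
    using that continuous_on_eq_continuous_at by (metis Ck_on.simps(1))
  then show ?case by (auto intro: continuous_at_imp_continuous_on)
next
  case (Suc k)
  have "f differentiable (at x)" if "x \<in> S" for x
    using Suc.prems[OF that] by auto
  moreover have "Ck_on k S (dir_deriv u f)" for u
    by (rule Suc.IH) (use Suc.prems in fastforce)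
  ultimately show ?case by simp
qed

lemma Ck_on_const: "Ck_on k S (\<lambda>x. c)"
  by (induction k arbitrary: c) auto

lemma Ck_on_bounded_linear:
  assumes "bounded_linear f"
  shows "Ck_on k S f"
proof (cases k)
  case 0
  then show ?thesis using assms by (simp add: linear_continuous_on)
next
  case (Suc m)
  have "dir_deriv u f = (\<lambda>x. f u)" for u
    using assms by (intro ext dir_deriv_eq bounded_linear_imp_has_derivative)
  moreover have "f differentiable (at x)" for x
    using assms bounded_linear_imp_differentiable by blast
  ultimately show ?thesis using Suc by (simp add: Ck_on_const)
qed

lemma Ck_on_add:
  assumes "open S" "Ck_on k S f" "Ck_on k S g"
  shows "Ck_on k S (\<lambda>x. f x + g x)"
  using assms(2,3)
proof (induction k arbitrary: f g)
  case 0
  then show ?case by (auto intro: continuous_intros)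
next
  case (Suc k)
  have "Ck_on k S (dir_deriv u (\<lambda>x. f x + g x))" for u
    using Suc.IH[of "dir_deriv u f" "dir_deriv u g"] Suc.prems
    by (subst Ck_on_cong[OF assms(1) dir_deriv_add]) auto
  then show ?case using Suc.prems by auto
qed

lemma Ck_on_mult:
  fixes f g :: "'a::real_normed_vector \<Rightarrow> real"
  assumes "open S" "Ck_on k S f" "Ck_on k S g"
  shows "Ck_on k S (\<lambda>x. f x * g x)"
  using assms(2,3)
proof (induction k arbitrary: f g)
  case 0
  then show ?case by (auto intro: continuous_intros)
next
  case (Suc k)
  have "Ck_on k S f" "Ck_on k S g"
    using Suc.prems Ck_on_Suc_imp by blast+
  then have "Ck_on k S (dir_deriv u (\<lambda>x. f x * g x))" for u
    using Suc.IH[of "dir_deriv u f" g] Suc.IH[of f "dir_deriv u g"] Suc.prems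
    by (subst Ck_on_cong[OF assms(1) dir_deriv_mult]) (auto intro!: Ck_on_add[OF assms(1)])
  then show ?case using Suc.prems by auto
qed

lemma Ck_on_sum:
  assumes "open S" "finite I" "\<And>i. i \<in> I \<Longrightarrow> Ck_on k S (f i)"
  shows "Ck_on k S (\<lambda>x. \<Sum>i\<in>I. f i x)"
  using assms(2,3)
  by (induction I rule: finite_induct) (auto simp: Ck_on_const intro!: Ck_on_add[OF assms(1)])

lemma Ck_on_prod:
  fixes f :: "'i \<Rightarrow> 'a::real_normed_vector \<Rightarrow> real"
  assumes "open S" "finite I" "\<And>i. i \<in> I \<Longrightarrow> Ck_on k S (f i)"
  shows "Ck_on k S (\<lambda>x. \<Prod>i\<in>I. f i x)"
  using assms(2,3)
  by (induction I rule: finite_induct) (auto simp: Ck_on_const intro!: Ck_on_mult[OF assms(1)])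

lemma frechet_derivative_Basis_sum:
  fixes g :: "'b::euclidean_space \<Rightarrow> real"
  assumes "g differentiable (at y)"
  shows "frechet_derivative g (at y) w = (\<Sum>b\<in>Basis. (w \<bullet> b) * frechet_derivative g (at y) b)"
proof -
  interpret bounded_linear "frechet_derivative g (at y)"
    using assms frechet_derivative_works has_derivative_bounded_linear by blast
  have "frechet_derivative g (at y) w = frechet_derivative g (at y) (\<Sum>b\<in>Basis. (w \<bullet> b) *\<^sub>R b)"
    by (simp add: euclidean_representation)
  then show ?thesis by (simp add: sum scaleR)
qed

text \<open>The chain rule in coordinates expresses a derivative of \<open>g \<circ> f\<close> through products of
  derivatives of \<open>g\<close>, composed with \<open>f\<close>, and derivatives of the components of \<open>f\<close>, which is what
  drives the induction.\<close>
lemma Ck_on_compose: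
  fixes f :: "'a::real_normed_vector \<Rightarrow> 'b::euclidean_space" and g :: "'b \<Rightarrow> real"
  assumes "open S" "Ck_on k T g" "\<And>b. b \<in> Basis \<Longrightarrow> Ck_on k S (\<lambda>x. f x \<bullet> b)"
    and "f ` S \<subseteq> T"
  shows "Ck_on k S (\<lambda>x. g (f x))"
  using assms(2,3)
proof (induction k arbitrary: g)
  case 0
  then have "continuous_on S f"
    by (intro continuous_on_componentwise[THEN iffD2]) auto
  then show ?case using 0 assms(4) by (auto intro: continuous_on_compose2)
next
  case (Suc k)
  have df: "f differentiable (at x)" if "x \<in> S" for x
    using Suc.prems(2) that differentiable_componentwise_within[of f x UNIV] by auto
  have dg: "g differentiable (at (f x))" if "x \<in> S" for x
    using Suc.prems(1) that assms(4) by auto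
  have comp: "((\<lambda>x. g (f x)) has_derivative
      (\<lambda>u. frechet_derivative g (at (f x)) (frechet_derivative f (at x) u))) (at x)" if "x \<in> S" for x
    using diff_chain_at[of f _ x g] df[OF that] dg[OF that]
    by (simp add: o_def frechet_derivative_works)
  have fb: "dir_deriv u (\<lambda>x. f x \<bullet> b) x = dir_deriv u f x \<bullet> b" if "x \<in> S" for x u b
    using df[OF that] by (intro dir_deriv_eq)
      (auto intro!: derivative_eq_intros simp: frechet_derivative_works)
  have eq: "dir_deriv u (\<lambda>x. g (f x)) x =
      (\<Sum>b\<in>Basis. dir_deriv u (\<lambda>x. f x \<bullet> b) x * dir_deriv b g (f x))" if "x \<in> S" for x u
    unfolding fb[OF that] dir_deriv_eq[OF comp[OF that]]
    by (rule frechet_derivative_Basis_sum[OF dg[OF that]])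
  have "Ck_on k S (dir_deriv u (\<lambda>x. g (f x)))" for u
    apply (subst Ck_on_cong[OF assms(1) eq], assumption)
    using Suc.prems Suc.IH[of "dir_deriv b g" for b] Ck_on_Suc_imp[OF Suc.prems(2)]
    by (intro Ck_on_sum Ck_on_mult assms(1)) auto
  then show ?case using comp by (auto simp: differentiable_def)
qed

lemma Ck_on_norm_powr:
  "Ck_on k (- {0 :: 'a::euclidean_space}) (\<lambda>x. norm x powr a)"
proof (induction k arbitrary: a)
  case 0
  then show ?case by (auto intro!: continuous_intros)
next
  case (Suc k)
  have d: "((\<lambda>x. norm x powr a) has_derivative (\<lambda>u. a * norm x powr (a - 2) * (x \<bullet> u))) (at x)"
    if "x \<noteq> 0" for x :: 'a
  proof -
    have "norm x powr a * (a * ((x \<bullet> u) / norm x) / norm x) = a * norm x powr (a - 2) * (x \<bullet> u)" for u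
      using that by (simp add: powr_diff power2_eq_square powr_numeral field_simps)
    moreover have "((\<lambda>x. norm x powr a) has_derivative
        (\<lambda>u. norm x powr a * (a * ((x \<bullet> u) / norm x) / norm x))) (at x)"
      by (rule has_derivative_eq_rhs,
          rule has_derivative_powr[OF has_derivative_norm[OF that] has_derivative_const])
        (use that in \<open>auto simp: inner_commute sgn_div_norm field_simps\<close>)
    ultimately show ?thesis by simp
  qed
  have "Ck_on k (- {0}) (dir_deriv u (\<lambda>x. norm x powr a))" for u :: 'a
  proof (subst Ck_on_cong)
    show "open (- {0 :: 'a})" by auto
    show "dir_deriv u (\<lambda>x. norm x powr a) x = a * norm x powr (a - 2) * (x \<bullet> u)"
      if "x \<in> - {0}" for x using dir_deriv_eq[OF d[of x]] that by auto
    show "Ck_on k (- {0}) (\<lambda>x. a * norm x powr (a - 2) * (x \<bullet> u))"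
      by (intro Ck_on_mult Ck_on_const Suc.IH Ck_on_bounded_linear bounded_linear_inner_left) auto
  qed
  then show ?case using d by (auto simp: differentiable_def)
qed

lemma Ck_on_sing_fun:
  fixes l :: "real^'n \<Rightarrow> real"
  assumes "smooth_on_submanifold (sphere 0 1) l"
  shows "Ck_on k (- {0}) (sing_fun \<gamma> l)"
proof -
  have "Ck_on k (- {0}) (\<lambda>x. l (x /\<^sub>R norm x))"
  proof (rule Ck_on_local)
    fix x :: "real^'n"
    assume x: "x \<in> - {0}"
    define \<phi> where "\<phi> = (\<lambda>y :: real^'n. y /\<^sub>R norm y)"
    have "\<phi> x \<in> sphere 0 1" using x by (simp add: \<phi>_def)
    with assms obtain U g where U: "open U" "\<phi> x \<in> U" "smooth_on U g"
      and g: "\<forall>y\<in>U \<inter> sphere 0 1. g y = l y"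
      unfolding smooth_on_submanifold_def by metis
    have cont: "continuous_on (- {0}) \<phi>" unfolding \<phi>_def by (auto intro!: continuous_intros)
    define V where "V = (- {0}) \<inter> \<phi> -` U"
    have V: "open V" unfolding V_def
      using continuous_open_preimage[OF cont _ U(1)] by (simp add: open_Compl)
    have "Ck_on k V (\<lambda>y. g (\<phi> y))"
    proof (rule Ck_on_compose[OF V, where T = U])
      show "Ck_on k U g" using U by (simp add: smooth_on_def)
      show "\<phi> ` V \<subseteq> U" by (auto simp: V_def)
      fix b :: "real^'n"
      have "Ck_on k (- {0}) (\<lambda>x :: real^'n. norm x powr (-1) * (x \<bullet> b))"
        by (intro Ck_on_mult Ck_on_norm_powr Ck_on_bounded_linear bounded_linear_inner_left) auto
      then have "Ck_on k V (\<lambda>x :: real^'n. norm x powr (-1) * (x \<bullet> b))"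
        by (rule Ck_on_subset) (auto simp: V_def)
      then show "Ck_on k V (\<lambda>x. \<phi> x \<bullet> b)"
        by (subst Ck_on_cong[OF V, where g = "\<lambda>x. norm x powr (-1) * (x \<bullet> b)"])
          (auto simp: \<phi>_def V_def powr_minus)
    qed
    moreover have "g (\<phi> y) = l (\<phi> y)" if "y \<in> V" for y
    proof -
      have "\<phi> y \<in> U \<inter> sphere 0 1" using that by (simp add: V_def \<phi>_def)
      then show ?thesis using g by blast
    qed
    ultimately have "Ck_on k V (\<lambda>y. l (\<phi> y))" 
      using Ck_on_cong[OF V, of "\<lambda>y. g (\<phi> y)" "\<lambda>y. l (\<phi> y)" k] by simp
    then show "\<exists>U. open U \<and> x \<in> U \<and> Ck_on k U (\<lambda>x. l (x /\<^sub>R norm x))"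
      using V x U(2) by (auto simp: V_def \<phi>_def)
  qed
  moreover have "sing_fun \<gamma> l = (\<lambda>x. norm x powr \<gamma> * l (x /\<^sub>R norm x))"
    by (auto simp: sing_fun_def)
  ultimately show ?thesis by (auto intro!: Ck_on_mult Ck_on_norm_powr)
qed

section \<open>Symbol estimates\<close>

text \<open>The estimates \<open>\<bar>\<partial>\<^sup>j f x\<bar> \<le> C * norm x powr (m - j)\<close> off the origin for the iterated partial
  derivatives of order \<open>j \<le> k\<close>, which are those of a function homogeneous of degree \<open>m\<close>. The
  constant is explicit because everything below rests on estimates that are uniform in the mesh size
  and in the width of the cutoff.\<close>
primrec symbol :: "nat \<Rightarrow> real \<Rightarrow> real \<Rightarrow> ('a::euclidean_space \<Rightarrow> real) \<Rightarrow> bool"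
where
  "symbol 0 m C f \<longleftrightarrow> (\<forall>x. x \<noteq> 0 \<longrightarrow> \<bar>f x\<bar> \<le> C * norm x powr m)"
| "symbol (Suc k) m C f \<longleftrightarrow>
     (\<forall>x. x \<noteq> 0 \<longrightarrow> \<bar>f x\<bar> \<le> C * norm x powr m \<and> f differentiable (at x)) \<and>
     (\<forall>b\<in>Basis. symbol k (m - 1) C (dir_deriv b f))"

lemma symbol_bound: "symbol k m C f \<Longrightarrow> x \<noteq> 0 \<Longrightarrow> \<bar>f x\<bar> \<le> C * norm x powr m"
  by (cases k) auto

lemma symbol_cong:
  assumes "\<And>x. x \<noteq> 0 \<Longrightarrow> f x = g x"
  shows "symbol k m C f \<longleftrightarrow> symbol k m C g"
  using assms
proof (induction k arbitrary: m f g)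
  case (Suc k)
  have eq: "f differentiable (at x) \<longleftrightarrow> g differentiable (at x)" "dir_deriv u f x = dir_deriv u g x"
    if "x \<noteq> 0" for x u
    using dir_deriv_cong_open[of "- {0}" x f g] Suc.prems that by auto
  have "symbol k (m - 1) C (dir_deriv b f) \<longleftrightarrow> symbol k (m - 1) C (dir_deriv b g)" for b
    by (rule Suc.IH) (rule eq(2))
  then show ?case using Suc.prems eq(1) by auto
qed auto

lemma symbol_mono:
  assumes "symbol k m C f" "C \<le> C'" "j \<le> k"
  shows "symbol j m C' f"
  using assms(1,3)
proof (induction j arbitrary: m k f)
  case 0
  then show ?case using symbol_bound[OF 0(1)] assms(2)
    by (force intro: order_trans[OF _ mult_right_mono])
next
  case (Suc j)
  then obtain i where i: "k = Suc i" "j \<le> i" by (cases k) auto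
  have "\<bar>f x\<bar> \<le> C' * norm x powr m" if "x \<noteq> 0" for x
    using symbol_bound[OF Suc.prems(1) that] assms(2)
    by (force intro: order_trans[OF _ mult_right_mono])
  then show ?case using Suc i by auto
qed

lemma symbol_Suc_imp: "symbol (Suc k) m C f \<Longrightarrow> symbol k m C f"
  using symbol_mono[of "Suc k" m C f C k] by simp

lemma symbol_nonneg:
  fixes f :: "'a::euclidean_space \<Rightarrow> real"
  assumes "symbol k m C f"
  shows "C \<ge> 0"
proof -
  obtain b :: 'a where "b \<in> Basis" using nonempty_Basis by blast
  then have "\<bar>f b\<bar> \<le> C" using symbol_bound[OF assms, of b] nonzero_Basis by auto
  then show ?thesis by linarith
qed

lemma symbol_add:
  assumes "symbol k m C f" "symbol k m D g"
  shows "symbol k m (C + D) (\<lambda>x. f x + g x)"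
  using assms
proof (induction k arbitrary: m f g)
  case 0
  then show ?case by (fastforce simp: algebra_simps)
next
  case (Suc k)
  have "symbol k (m - 1) (C + D) (dir_deriv b (\<lambda>x. f x + g x))" if "b \<in> Basis" for b
  proof (subst symbol_cong[OF dir_deriv_add])
    show "symbol k (m - 1) (C + D) (\<lambda>x. dir_deriv b f x + dir_deriv b g x)"
      using Suc.prems that by (intro Suc.IH) auto
  qed (use Suc.prems in auto)
  moreover have "\<bar>f x + g x\<bar> \<le> (C + D) * norm x powr m" if "x \<noteq> 0" for x
    using symbol_bound[OF Suc.prems(1) that] symbol_bound[OF Suc.prems(2) that]
    by (simp add: algebra_simps)
  ultimately show ?case using Suc.prems by auto
qed

text \<open>Leibniz' rule; the factor \<open>2 ^ k\<close> counts the terms it produces.\<close>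
lemma symbol_mult:
  assumes "symbol k m C f" "symbol k m' D g"
  shows "symbol k (m + m') (2 ^ k * C * D) (\<lambda>x. f x * g x)"
proof -
  have bound: "\<bar>f x * g x\<bar> \<le> 2 ^ k * C * D * norm x powr (m + m')"
    if fg: "symbol k m C f" "symbol k m' D g" and x: "x \<noteq> 0" for f g k m m' and x :: 'a
  proof -
    have nn: "C \<ge> 0" "D \<ge> 0" using fg symbol_nonneg by blast+
    have "\<bar>f x * g x\<bar> \<le> (C * norm x powr m) * (D * norm x powr m')"
      unfolding abs_mult using symbol_bound[OF fg(1) x] symbol_bound[OF fg(2) x] nn
      by (intro mult_mono) auto
    also have "\<dots> = 1 * (C * D * norm x powr (m + m'))" by (simp add: powr_add)
    also have "\<dots> \<le> 2 ^ k * (C * D * norm x powr (m + m'))"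
      using nn by (intro mult_right_mono) auto
    finally show ?thesis by (simp add: mult.assoc)
  qed
  show ?thesis
    using assms
  proof (induction k arbitrary: m m' f g)
    case 0
    then show ?case using bound[OF 0] by simp
  next
    case (Suc k)
    have "symbol k (m + m' - 1) (2 ^ Suc k * C * D) (dir_deriv b (\<lambda>x. f x * g x))"
      if "b \<in> Basis" for b
    proof (subst symbol_cong[OF dir_deriv_mult])
      have "symbol k ((m - 1) + m') (2 ^ k * C * D) (\<lambda>x. dir_deriv b f x * g x)"
        using Suc.prems that by (intro Suc.IH symbol_Suc_imp[OF Suc.prems(2)]) auto
      moreover have "symbol k (m + (m' - 1)) (2 ^ k * C * D) (\<lambda>x. f x * dir_deriv b g x)"
        using Suc.prems that by (intro Suc.IH symbol_Suc_imp[OF Suc.prems(1)]) auto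
      moreover have "m + (m' - 1) = m + m' - 1" "m - 1 + m' = m + m' - 1" by simp_all
      ultimately have "symbol k (m + m' - 1) (2 ^ k * C * D + 2 ^ k * C * D)
          (\<lambda>x. dir_deriv b f x * g x + f x * dir_deriv b g x)"
        by (intro symbol_add) simp_all
      then show "symbol k (m + m' - 1) (2 ^ Suc k * C * D)
          (\<lambda>x. dir_deriv b f x * g x + f x * dir_deriv b g x)"
        by (simp add: algebra_simps)
    qed (use Suc.prems in auto)
    then show ?case using bound[OF Suc.prems] Suc.prems by auto
  qed
qed

lemma symbol_zero: "C \<ge> 0 \<Longrightarrow> symbol k m C (\<lambda>x. 0)"
  by (induction k arbitrary: m) auto

lemma symbol_const: "symbol k 0 \<bar>c\<bar> (\<lambda>x. c)"
  by (cases k) (auto simp: symbol_zero)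

lemma symbol_cmult:
  assumes "symbol k m C f" "\<bar>c\<bar> * C \<le> D"
  shows "symbol k m D (\<lambda>x. c * f x)"
  using assms(1)
proof (induction k arbitrary: m f)
  case 0
  have "\<bar>c * f x\<bar> \<le> D * norm x powr m" if "x \<noteq> 0" for x
  proof -
    have "\<bar>c * f x\<bar> \<le> (\<bar>c\<bar> * C) * norm x powr m"
      using symbol_bound[OF 0 that] by (simp add: abs_mult mult.assoc mult_left_mono)
    also have "\<dots> \<le> D * norm x powr m" using assms(2) by (intro mult_right_mono) auto
    finally show ?thesis .
  qed
  then show ?case by simp
next
  case (Suc k)
  have "\<bar>c * f x\<bar> \<le> D * norm x powr m" if "x \<noteq> 0" for x
  proof -
    have "\<bar>c * f x\<bar> \<le> (\<bar>c\<bar> * C) * norm x powr m"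
      using symbol_bound[OF Suc.prems that] by (simp add: abs_mult mult.assoc mult_left_mono)
    also have "\<dots> \<le> D * norm x powr m" using assms(2) by (intro mult_right_mono) auto
    finally show ?thesis .
  qed
  moreover have "symbol k (m - 1) D (dir_deriv b (\<lambda>x. c * f x))" if "b \<in> Basis" for b
  proof (subst symbol_cong)
    show "dir_deriv b (\<lambda>x. c * f x) x = c * dir_deriv b f x" if "x \<noteq> 0" for x
      using Suc.prems that dir_deriv_mult[of "\<lambda>x. c" x f b] by simp
    show "symbol k (m - 1) D (\<lambda>x. c * dir_deriv b f x)"
      using Suc.prems that by (intro Suc.IH) auto
  qed
  ultimately show ?case using Suc.prems by auto
qed

lemma symbol_sum:
  assumes "finite I" "\<And>i. i \<in> I \<Longrightarrow> symbol k m (C i) (f i)"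
  shows "symbol k m (\<Sum>i\<in>I. C i) (\<lambda>x. \<Sum>i\<in>I. f i x)"
  using assms
  by (induction I rule: finite_induct) (auto intro: symbol_add symbol_zero)

lemma dir_deriv_dilation:
  fixes f :: "'a::euclidean_space \<Rightarrow> real"
  assumes "f differentiable (at (t *\<^sub>R x))"
  shows "(\<lambda>x. f (t *\<^sub>R x)) differentiable (at x)"
    and "dir_deriv u (\<lambda>x. f (t *\<^sub>R x)) x = t * dir_deriv u f (t *\<^sub>R x)"
proof -
  have "((\<lambda>x. f (t *\<^sub>R x)) has_derivative (\<lambda>u. frechet_derivative f (at (t *\<^sub>R x)) (t *\<^sub>R u))) (at x)"
    using diff_chain_at[of "\<lambda>x. t *\<^sub>R x" "\<lambda>u. t *\<^sub>R u" x f]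
      assms[unfolded frechet_derivative_works]
    by (simp add: o_def has_derivative_scaleR_right[OF has_derivative_ident])
  moreover have "frechet_derivative f (at (t *\<^sub>R x)) (t *\<^sub>R u) = t * dir_deriv u f (t *\<^sub>R x)" for u
    using assms linear_frechet_derivative[OF assms] by (simp add: linear_cmul)
  ultimately show "(\<lambda>x. f (t *\<^sub>R x)) differentiable (at x)"
    and "dir_deriv u (\<lambda>x. f (t *\<^sub>R x)) x = t * dir_deriv u f (t *\<^sub>R x)"
    by (auto simp: differentiable_def dir_deriv_eq)
qed

text \<open>The factor \<open>t\<close> that each differentiation produces is absorbed by the drop of the order, so the
  constant scales like the function itself. For \<open>m = 0\<close> it does not depend on \<open>t\<close>.\<close>
lemma symbol_dilation:
  fixes f :: "'a::euclidean_space \<Rightarrow> real"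
  assumes "symbol k m C f" "t > 0"
  shows "symbol k m (C * t powr m) (\<lambda>x. f (t *\<^sub>R x))"
  using assms(1)
proof (induction k arbitrary: m f)
  case 0
  have "\<bar>f (t *\<^sub>R x)\<bar> \<le> C * t powr m * norm x powr m" if "x \<noteq> 0" for x
    using symbol_bound[OF 0, of "t *\<^sub>R x"] that assms(2) by (simp add: powr_mult mult.assoc)
  then show ?case by simp
next
  case (Suc k)
  have "\<bar>f (t *\<^sub>R x)\<bar> \<le> C * t powr m * norm x powr m" if "x \<noteq> 0" for x
    using symbol_bound[OF Suc.prems, of "t *\<^sub>R x"] that assms(2) by (simp add: powr_mult mult.assoc)
  moreover have d: "f differentiable (at (t *\<^sub>R x))" if "x \<noteq> 0" for x
    using that assms(2) Suc.prems by simp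
  moreover have "symbol k (m - 1) (C * t powr m) (dir_deriv b (\<lambda>x. f (t *\<^sub>R x)))"
    if "b \<in> Basis" for b
  proof (subst symbol_cong[OF dir_deriv_dilation(2)[OF d]])
    have "\<bar>t\<bar> * (C * t powr (m - 1)) \<le> C * t powr m"
      using assms(2) by (simp add: powr_diff)
    then show "symbol k (m - 1) (C * t powr m) (\<lambda>x. t * dir_deriv b f (t *\<^sub>R x))"
      using Suc.prems that by (intro symbol_cmult[OF Suc.IH]) auto
  qed
  ultimately show ?case using dir_deriv_dilation(1)[OF d] by auto
qed

text \<open>A function supported away from the origin may be regarded as a symbol of higher order, the
  gain being paid for in powers of the distance of the support to the origin.\<close>
lemma symbol_raise_order:
  fixes f :: "'a::euclidean_space \<Rightarrow> real"
  assumes "symbol k m C f" "\<And>x. norm x < R \<Longrightarrow> f x = 0" "R > 0" "N \<ge> 0"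
  shows "symbol k (m + N) (C * R powr (- N)) f"
proof -
  have bound: "\<bar>g x\<bar> \<le> C * R powr (- N) * norm x powr (m + N)"
    if g: "symbol k m C g" "\<And>x. norm x < R \<Longrightarrow> g x = 0" and x: "x \<noteq> 0" for g k m and x :: 'a
  proof (cases "norm x < R")
    case True
    then show ?thesis using g symbol_nonneg[OF g(1)] by simp
  next
    case False
    have "\<bar>g x\<bar> \<le> C * norm x powr m" using symbol_bound[OF g(1) x] .
    also have "norm x powr m = norm x powr (- N) * norm x powr (m + N)"
      using x by (simp add: powr_add[symmetric])
    also have "C * \<dots> \<le> C * (R powr (- N) * norm x powr (m + N))"
      using False assms(3,4) symbol_nonneg[OF g(1)]
      by (intro mult_left_mono mult_right_mono powr_mono2') auto
    finally show ?thesis by (simp add: mult.assoc)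
  qed
  show ?thesis
    using assms(1,2)
  proof (induction k arbitrary: m f)
    case 0
    show ?case using bound[OF 0] by simp
  next
    case (Suc k)
    have "symbol k (m - 1 + N) (C * R powr (- N)) (dir_deriv b f)" if b: "b \<in> Basis" for b
    proof (rule Suc.IH)
      show "symbol k (m - 1) C (dir_deriv b f)" using Suc.prems b by simp
      show "dir_deriv b f x = 0" if "norm x < R" for x
        using dir_deriv_cong_open(2)[of "ball 0 R" x f "\<lambda>x. 0" b] that Suc.prems(2) by simp
    qed
    moreover have "m - 1 + N = m + N - 1" by simp
    ultimately show ?case using bound[OF Suc.prems] Suc.prems by auto
  qed
qed

lemma symbol_SucI:
  fixes f :: "'a::euclidean_space \<Rightarrow> real"
  assumes "\<And>x. x \<noteq> 0 \<Longrightarrow> \<bar>f x\<bar> \<le> C * norm x powr m" "\<And>x. x \<noteq> 0 \<Longrightarrow> f differentiable (at x)"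
    and "\<And>b. b \<in> Basis \<Longrightarrow> symbol k (m - 1) (D b) (dir_deriv b f)"
  shows "symbol (Suc k) m (\<bar>C\<bar> + (\<Sum>b\<in>Basis. D b)) f"
proof -
  have nn: "D b \<ge> 0" if "b \<in> Basis" for b using symbol_nonneg[OF assms(3)] that by blast
  have "\<bar>f x\<bar> \<le> (\<bar>C\<bar> + (\<Sum>b\<in>Basis. D b)) * norm x powr m" if "x \<noteq> 0" for x
  proof (rule order_trans[OF assms(1)[OF that] mult_right_mono])
    have "0 \<le> (\<Sum>b\<in>Basis. D b)" using nn by (rule sum_nonneg)
    then show "C \<le> \<bar>C\<bar> + (\<Sum>b\<in>Basis. D b)" by linarith
  qed simp
  moreover have "symbol k (m - 1) (\<bar>C\<bar> + (\<Sum>b\<in>Basis. D b)) (dir_deriv b f)" if "b \<in> Basis" for b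
  proof (rule symbol_mono[OF assms(3)[OF that]])
    have "D b \<le> (\<Sum>b\<in>Basis. D b)" using that nn by (intro member_le_sum) auto
    then show "D b \<le> \<bar>C\<bar> + (\<Sum>b\<in>Basis. D b)" by simp
  qed simp
  ultimately show ?thesis using assms(2) by simp
qed

text \<open>Derivatives of a homogeneous function are homogeneous, and a continuous homogeneous function
  is bounded by its maximum on the unit sphere.\<close>
lemma symbol_homogeneous:
  fixes f :: "'a::euclidean_space \<Rightarrow> real"
  assumes "Ck_on k (- {0}) f" "\<And>t x. t > 0 \<Longrightarrow> x \<noteq> 0 \<Longrightarrow> f (t *\<^sub>R x) = t powr m * f x"
  shows "\<exists>C. symbol k m C f"
proof -
  have bound: "\<exists>C. \<forall>x. x \<noteq> 0 \<longrightarrow> \<bar>g x\<bar> \<le> C * norm x powr m"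
    if g: "continuous_on (- {0}) g" "\<And>t x. t > 0 \<Longrightarrow> x \<noteq> 0 \<Longrightarrow> g (t *\<^sub>R x) = t powr m * g x"
    for g :: "'a \<Rightarrow> real" and m
  proof -
    have "continuous_on (sphere 0 1) g" by (rule continuous_on_subset[OF g(1)]) auto
    then have "bounded (g ` sphere 0 1)"
      by (intro compact_imp_bounded compact_continuous_image) auto
    then obtain C where "\<forall>y\<in>g ` sphere 0 1. norm y \<le> C" unfolding bounded_iff by blast
    then have C: "\<bar>g x\<bar> \<le> C" if "norm x = 1" for x using that by simp
    have "\<bar>g x\<bar> \<le> C * norm x powr m" if "x \<noteq> 0" for x
    proof -
      have "g x = g (norm x *\<^sub>R (x /\<^sub>R norm x))" using that by simp
      also have "\<dots> = norm x powr m * g (x /\<^sub>R norm x)" using that by (intro g(2)) auto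
      finally show ?thesis using C[of "x /\<^sub>R norm x"] that
        by (simp add: abs_mult mult.commute mult_right_mono)
    qed
    then show ?thesis by blast
  qed
  show ?thesis
    using assms
  proof (induction k arbitrary: m f)
    case 0
    then show ?case using bound[of f m] by simp
  next
    case (Suc k)
    have d: "f differentiable (at x)" if "x \<noteq> 0" for x using Suc.prems that by simp
    have "\<exists>C. symbol k (m - 1) C (dir_deriv b f)" for b
    proof (rule Suc.IH)
      show "Ck_on k (- {0}) (dir_deriv b f)" using Suc.prems by simp
      fix t :: real and x :: 'a
      assume tx: "t > 0" "x \<noteq> 0"
      have "t * dir_deriv b f (t *\<^sub>R x) = dir_deriv b (\<lambda>x. f (t *\<^sub>R x)) x"
        using dir_deriv_dilation(2)[OF d] tx by simp
      also have "\<dots> = dir_deriv b (\<lambda>x. t powr m * f x) x"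
        by (rule dir_deriv_cong_open(2)[of "- {0}"]) (use tx Suc.prems(2) in auto)
      also have "\<dots> = t powr m * dir_deriv b f x"
        using dir_deriv_mult[of "\<lambda>x. t powr m" x f b] d[OF tx(2)] by simp
      finally show "dir_deriv b f (t *\<^sub>R x) = t powr (m - 1) * dir_deriv b f x"
        using tx by (simp add: powr_diff field_simps)
    qed
    then obtain D where D: "\<And>b. symbol k (m - 1) (D b) (dir_deriv b f)" by metis
    have "continuous_on (- {0}) f"
      using d by (auto intro!: continuous_at_imp_continuous_on differentiable_imp_continuous_within)
    then obtain C where "\<And>x. x \<noteq> 0 \<Longrightarrow> \<bar>f x\<bar> \<le> C * norm x powr m"
      using bound[OF _ Suc.prems(2)] by blast
    from symbol_SucI[OF this d D] show ?case by blast
  qed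
qed

text \<open>Bounds without any decay, for the smooth factor \<open>v\<close> and the coefficient functions in its Taylor
  expansion. Continuity is demanded explicitly at the last order, where differentiability is not
  available to imply it, so that the top derivatives may be integrated.\<close>
primrec bounded_derivs :: "nat \<Rightarrow> real \<Rightarrow> ('a::euclidean_space \<Rightarrow> real) \<Rightarrow> bool"
where
  "bounded_derivs 0 C f \<longleftrightarrow> continuous_on UNIV f \<and> (\<forall>x. \<bar>f x\<bar> \<le> C)"
| "bounded_derivs (Suc k) C f \<longleftrightarrow>
     (\<forall>x. \<bar>f x\<bar> \<le> C \<and> f differentiable (at x)) \<and> (\<forall>b\<in>Basis. bounded_derivs k C (dir_deriv b f))"

lemma bounded_derivs_bound: "bounded_derivs k C f \<Longrightarrow> \<bar>f x\<bar> \<le> C"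
  by (cases k) auto

lemma bounded_derivs_continuous: "bounded_derivs k C f \<Longrightarrow> continuous_on UNIV f"
  by (cases k) (auto intro!: continuous_at_imp_continuous_on differentiable_imp_continuous_within)

lemma bounded_derivs_mono:
  assumes "bounded_derivs k C f" "C \<le> C'" "j \<le> k"
  shows "bounded_derivs j C' f"
  using assms(1,3)
proof (induction j arbitrary: k f)
  case 0
  then show ?case using bounded_derivs_bound[OF 0(1)] assms(2) bounded_derivs_continuous[OF 0(1)]
    by (auto intro: order_trans)
next
  case (Suc j)
  then obtain i where i: "k = Suc i" "j \<le> i" by (cases k) auto
  then show ?case using Suc assms(2) by (auto intro: order_trans)
qed

lemma Cc_infinity_bounded:
  fixes \<eta> :: "'a::euclidean_space \<Rightarrow> real"
  assumes "\<eta> \<in> Cc_infinity UNIV"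
  shows "\<exists>A. \<forall>x. \<bar>\<eta> x\<bar> \<le> A" and "\<exists>R>0. \<forall>x. norm x \<ge> R \<longrightarrow> \<eta> x = 0"
proof -
  let ?K = "closure {x. \<eta> x \<noteq> 0}"
  have K: "compact ?K" and sm: "smooth_on UNIV \<eta>" using assms by (auto simp: Cc_infinity_def)
  obtain R where R: "R > 0" "\<And>x. x \<in> ?K \<Longrightarrow> norm x < R"
    using bounded_pos_less[of ?K] compact_imp_bounded[OF K] by metis
  then show "\<exists>R>0. \<forall>x. norm x \<ge> R \<longrightarrow> \<eta> x = 0"
    using closure_subset[of "{x. \<eta> x \<noteq> 0}"] by (intro exI[of _ R]) force
  have "continuous_on UNIV \<eta>" using sm unfolding smooth_on_def by (metis Ck_on.simps(1))
  then have "bounded (\<eta> ` ?K)"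
    using K continuous_on_subset by (intro compact_imp_bounded compact_continuous_image) blast+
  then obtain A where A: "\<And>x. x \<in> ?K \<Longrightarrow> \<bar>\<eta> x\<bar> \<le> A" unfolding bounded_iff by auto
  have "\<bar>\<eta> x\<bar> \<le> \<bar>A\<bar>" for x
  proof (cases "\<eta> x = 0")
    case False
    then have "x \<in> ?K" using closure_subset[of "{x. \<eta> x \<noteq> 0}"] by auto
    then show ?thesis using A by fastforce
  qed auto
  then show "\<exists>A. \<forall>x. \<bar>\<eta> x\<bar> \<le> A" by blast
qed

lemma Cc_infinityI:
  fixes f :: "'a::euclidean_space \<Rightarrow> real"
  assumes "\<And>k. Ck_on k UNIV f" "\<And>x. norm x > R \<Longrightarrow> f x = 0"
  shows "f \<in> Cc_infinity UNIV"
proof -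
  have "{x. f x \<noteq> 0} \<subseteq> cball 0 R" using assms(2) by force
  then have "bounded {x. f x \<noteq> 0}" using bounded_cball bounded_subset by blast
  then show ?thesis using assms(1) by (simp add: Cc_infinity_def smooth_on_def)
qed

lemma Cc_infinity_Ck_on: "f \<in> Cc_infinity UNIV \<Longrightarrow> Ck_on k UNIV f"
  by (simp add: Cc_infinity_def smooth_on_def)

lemma Cc_infinity_differentiable: "f \<in> Cc_infinity UNIV \<Longrightarrow> f differentiable (at x)"
  using Cc_infinity_Ck_on[of f "Suc 0"] by auto

lemma Cc_infinity_dir_deriv:
  fixes \<eta> :: "'a::euclidean_space \<Rightarrow> real"
  assumes "\<eta> \<in> Cc_infinity UNIV"
  shows "dir_deriv b \<eta> \<in> Cc_infinity UNIV"
proof -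
  obtain R where R: "\<And>x. norm x \<ge> R \<Longrightarrow> \<eta> x = 0" using Cc_infinity_bounded(2)[OF assms] by blast
  show ?thesis
  proof (rule Cc_infinityI)
    show "Ck_on k UNIV (dir_deriv b \<eta>)" for k
      using Cc_infinity_Ck_on[OF assms, of "Suc k"] by simp
    show "dir_deriv b \<eta> x = 0" if "norm x > R" for x
      using dir_deriv_cong_open(2)[of "- cball 0 R" x \<eta> "\<lambda>x. 0" b] R that by auto
  qed
qed

lemma Cc_infinity_bounded_derivs:
  fixes \<eta> :: "'a::euclidean_space \<Rightarrow> real"
  assumes "\<eta> \<in> Cc_infinity UNIV"
  shows "\<exists>C. bounded_derivs k C \<eta>"
  using assms
proof (induction k arbitrary: \<eta>)
  case 0
  then show ?case using Cc_infinity_bounded(1)[OF 0] Cc_infinity_Ck_on[OF 0, of 0] by auto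
next
  case (Suc k)
  have "\<forall>b. \<exists>C. bounded_derivs k C (dir_deriv b \<eta>)"
    using Suc.IH Cc_infinity_dir_deriv[OF Suc.prems] by blast
  then obtain D where D: "\<And>b. bounded_derivs k (D b) (dir_deriv b \<eta>)" by metis
  obtain A where A: "\<And>x. \<bar>\<eta> x\<bar> \<le> A" using Cc_infinity_bounded(1)[OF Suc.prems] by blast
  have nn: "D b \<ge> 0" for b using bounded_derivs_bound[OF D] abs_ge_zero order_trans by blast
  have "A \<ge> 0" using A abs_ge_zero order_trans by blast
  have "bounded_derivs k (A + (\<Sum>b\<in>Basis. D b)) (dir_deriv b \<eta>)" if "b \<in> Basis" for b
  proof (rule bounded_derivs_mono[OF D])
    have "D b \<le> (\<Sum>b\<in>Basis. D b)" using that nn by (intro member_le_sum) auto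
    then show "D b \<le> A + (\<Sum>b\<in>Basis. D b)" using \<open>A \<ge> 0\<close> by simp
  qed simp
  moreover have "\<bar>\<eta> x\<bar> \<le> A + (\<Sum>b\<in>Basis. D b)" for x
    using A[of x] sum_nonneg[of Basis D] nn by force
  ultimately show ?case using Cc_infinity_differentiable[OF Suc.prems] by (metis bounded_derivs.simps(2))
qed

text \<open>A cutoff turns bounds on derivatives into symbol bounds: on the support of the cutoff, \<open>norm x\<close>
  is bounded from above, and also from below if the cutoff vanishes near the origin.\<close>
lemma symbol_cutoff_mult:
  fixes \<eta> :: "'a::euclidean_space \<Rightarrow> real"
  assumes "\<eta> \<in> Cc_infinity UNIV" "m \<le> 0 \<or> (\<exists>\<delta>>0. \<forall>x. norm x < \<delta> \<longrightarrow> \<eta> x = 0)"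
  shows "\<exists>C. \<forall>f. bounded_derivs k B f \<longrightarrow> symbol k m C (\<lambda>x. \<eta> x * f x)"
proof -
  have bound: "\<exists>A. \<forall>x. x \<noteq> 0 \<longrightarrow> \<bar>\<eta> x\<bar> \<le> A * norm x powr m"
    if \<eta>: "\<eta> \<in> Cc_infinity UNIV" and m: "m \<le> 0 \<or> (\<exists>\<delta>>0. \<forall>x. norm x < \<delta> \<longrightarrow> \<eta> x = 0)"
    for \<eta> :: "'a \<Rightarrow> real" and m
  proof -
    obtain A where A: "\<And>x. \<bar>\<eta> x\<bar> \<le> A" using Cc_infinity_bounded(1)[OF \<eta>] by blast
    obtain R where R: "R > 0" "\<And>x. norm x \<ge> R \<Longrightarrow> \<eta> x = 0" using Cc_infinity_bounded(2)[OF \<eta>] by blast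
    have "\<exists>r>0. \<forall>x. x \<noteq> 0 \<longrightarrow> \<eta> x \<noteq> 0 \<longrightarrow> r powr m \<le> norm x powr m"
    proof (cases "m \<le> 0")
      case True
      have "norm x \<le> R" if "\<eta> x \<noteq> 0" for x using R(2)[of x] that by linarith
      then show ?thesis using R(1) True by (intro exI[of _ R]) (auto intro!: powr_mono2')
    next
      case False
      with m obtain \<delta> where \<delta>: "\<delta> > 0" "\<forall>x. norm x < \<delta> \<longrightarrow> \<eta> x = 0" by blast
      then show ?thesis using False by (intro exI[of _ \<delta>]) (force intro!: powr_mono2)
    qed
    then obtain r where r: "r > 0" "\<And>x. x \<noteq> 0 \<Longrightarrow> \<eta> x \<noteq> 0 \<Longrightarrow> r powr m \<le> norm x powr m" by blast
    have "A \<ge> 0" using A abs_ge_zero order_trans by blast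
    have "\<bar>\<eta> x\<bar> \<le> A * r powr (- m) * norm x powr m" if "x \<noteq> 0" for x
    proof (cases "\<eta> x = 0")
      case False
      have "\<bar>\<eta> x\<bar> \<le> A * (r powr (- m) * r powr m)" using A r(1) by (simp add: powr_add[symmetric])
      also have "\<dots> \<le> A * (r powr (- m) * norm x powr m)"
        using r(2)[OF that False] \<open>A \<ge> 0\<close> by (intro mult_left_mono) auto
      finally show ?thesis by (simp add: mult.assoc)
    qed (use \<open>A \<ge> 0\<close> in simp)
    then show ?thesis by blast
  qed
  have bound': "\<exists>A. \<forall>f x. x \<noteq> 0 \<longrightarrow> (\<forall>x. \<bar>f x\<bar> \<le> B) \<longrightarrow> \<bar>\<eta> x * f x\<bar> \<le> A * norm x powr m"
    if \<eta>: "\<eta> \<in> Cc_infinity UNIV" and m: "m \<le> 0 \<or> (\<exists>\<delta>>0. \<forall>x. norm x < \<delta> \<longrightarrow> \<eta> x = 0)"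
    for \<eta> :: "'a \<Rightarrow> real" and m
  proof -
    obtain A where A: "\<And>x. x \<noteq> 0 \<Longrightarrow> \<bar>\<eta> x\<bar> \<le> A * norm x powr m" using bound[OF \<eta> m] by blast
    have "\<bar>\<eta> x * f x\<bar> \<le> A * \<bar>B\<bar> * norm x powr m" if x: "x \<noteq> 0" and f: "\<forall>x. \<bar>f x\<bar> \<le> B" for f x
    proof -
      have "\<bar>f x\<bar> \<le> \<bar>B\<bar>" using f abs_ge_self order_trans by blast
      then have "\<bar>\<eta> x * f x\<bar> \<le> (A * norm x powr m) * \<bar>B\<bar>"
        unfolding abs_mult using A[OF x] order_trans[OF abs_ge_zero A[OF x]]
        by (intro mult_mono) auto
      then show ?thesis by (simp add: ac_simps)
    qed
    then show ?thesis by blast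
  qed
  show ?thesis
    using assms
  proof (induction k arbitrary: m \<eta>)
    case 0
    then show ?case using bound'[OF 0] by auto
  next
    case (Suc k)
    have "\<exists>C. \<forall>f. bounded_derivs k B f \<longrightarrow> symbol k (m - 1) C (\<lambda>x. \<eta> x * f x)"
      using Suc.IH[of \<eta> "m - 1"] Suc.prems by auto
    then obtain C where C: "\<And>f. bounded_derivs k B f \<Longrightarrow> symbol k (m - 1) C (\<lambda>x. \<eta> x * f x)"
      by blast
    have vanish: "dir_deriv b \<eta> x = 0" if "\<forall>x. norm x < \<delta> \<longrightarrow> \<eta> x = 0" "norm x < \<delta>" for \<delta> x b
      using dir_deriv_cong_open(2)[of "ball 0 \<delta>" x \<eta> "\<lambda>x. 0" b] that by simp
    have "\<exists>C. \<forall>f. bounded_derivs k B f \<longrightarrow> symbol k (m - 1) C (\<lambda>x. dir_deriv b \<eta> x * f x)" for b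
    proof (rule Suc.IH)
      show "dir_deriv b \<eta> \<in> Cc_infinity UNIV" using Suc.prems(1) by (rule Cc_infinity_dir_deriv)
      show "m - 1 \<le> 0 \<or> (\<exists>\<delta>>0. \<forall>x. norm x < \<delta> \<longrightarrow> dir_deriv b \<eta> x = 0)"
        using Suc.prems(2)
      proof
        assume "\<exists>\<delta>>0. \<forall>x. norm x < \<delta> \<longrightarrow> \<eta> x = 0"
        then show ?thesis using vanish by blast
      qed auto
    qed
    then obtain D where D: "\<And>b f. bounded_derivs k B f \<Longrightarrow> symbol k (m - 1) (D b) (\<lambda>x. dir_deriv b \<eta> x * f x)"
      by metis
    obtain A where A: "\<And>f x. x \<noteq> 0 \<Longrightarrow> (\<forall>x. \<bar>f x\<bar> \<le> B) \<Longrightarrow> \<bar>\<eta> x * f x\<bar> \<le> A * norm x powr m"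
      using bound'[OF Suc.prems] by blast
    have "symbol (Suc k) m (\<bar>A\<bar> + (\<Sum>b\<in>Basis. D b + C)) (\<lambda>x. \<eta> x * f x)"
      if f: "bounded_derivs (Suc k) B f" for f
    proof (rule symbol_SucI)
      have fb: "\<forall>x. \<bar>f x\<bar> \<le> B" using bounded_derivs_bound[OF f] by blast
      have f': "bounded_derivs k B f" using bounded_derivs_mono[OF f] by simp
      have d: "f differentiable (at x)" "\<eta> differentiable (at x)" for x
        using f Cc_infinity_differentiable[OF Suc.prems(1)] by auto
      show "\<bar>\<eta> x * f x\<bar> \<le> A * norm x powr m" if "x \<noteq> 0" for x using A[OF that fb] .
      show "(\<lambda>x. \<eta> x * f x) differentiable (at x)" for x using d by simp
      show "symbol k (m - 1) (D b + C) (dir_deriv b (\<lambda>x. \<eta> x * f x))" if b: "b \<in> Basis" for b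
        unfolding dir_deriv_mult[OF d(2,1)]
        using f b by (intro symbol_add D C f') auto
    qed
    then show ?case by blast
  qed
qed

lemma symbol_Cc_infinity:
  fixes \<eta> :: "'a::euclidean_space \<Rightarrow> real"
  assumes "\<eta> \<in> Cc_infinity UNIV" "m \<le> 0 \<or> (\<exists>\<delta>>0. \<forall>x. norm x < \<delta> \<longrightarrow> \<eta> x = 0)"
  shows "\<exists>C. symbol k m C \<eta>"
proof -
  have "bounded_derivs k 1 (\<lambda>x :: 'a. 1)"
  proof (cases k)
    case (Suc j)
    have "bounded_derivs j 1 (\<lambda>x :: 'a. 0)" by (induction j) auto
    then show ?thesis using Suc by simp
  qed simp
  then show ?thesis using symbol_cutoff_mult[OF assms, of k 1] by fastforce
qed

section \<open>Periodisation over the integer lattice\<close>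

lemma lattice_pt_add: "lattice_pt (z + w) = lattice_pt z + lattice_pt w"
  by (simp add: lattice_pt_def vec_eq_iff)

lemma lattice_pt_0 [simp]: "lattice_pt 0 = 0"
  by (simp add: lattice_pt_def vec_eq_iff)

lemma lattice_pt_axis: "lattice_pt (axis i 1) = axis i 1"
  by (simp add: lattice_pt_def vec_eq_iff axis_def)

lemma lattice_pt_nth [simp]: "lattice_pt z $ i = real_of_int (z $ i)"
  by (simp add: lattice_pt_def)

lemma inj_lattice_pt: "inj lattice_pt"
  by (auto simp: inj_def vec_eq_iff)

lemma finite_lattice_norm_less:
  fixes x :: "real^'n"
  shows "finite {z. norm (x + lattice_pt z) < R}"
proof -
  define N where "N = \<lceil>R + norm x\<rceil>"
  have "{z :: int^'n. norm (x + lattice_pt z) < R} \<subseteq> vec_lambda ` (PiE UNIV (\<lambda>_. {- N..N}))"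
  proof
    fix z :: "int^'n"
    assume "z \<in> {z. norm (x + lattice_pt z) < R}"
    then have z: "norm (x + lattice_pt z) < R" by simp
    have "z $ i \<in> {- N..N}" for i
    proof -
      have "\<bar>(x + lattice_pt z) $ i\<bar> \<le> norm (x + lattice_pt z)" "\<bar>x $ i\<bar> \<le> norm x"
        by (rule component_le_norm_cart)+
      then have "\<bar>real_of_int (z $ i)\<bar> \<le> R + norm x" using z by simp
      then show ?thesis unfolding N_def by (simp add: abs_le_iff) linarith
    qed
    then have "z = vec_lambda (vec_nth z)" "vec_nth z \<in> PiE UNIV (\<lambda>_. {- N..N})" by auto
    then show "z \<in> vec_lambda ` (PiE UNIV (\<lambda>_. {- N..N}))" by blast
  qed
  then show ?thesis by (rule finite_subset) (auto intro!: finite_imageI finite_PiE)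
qed

text \<open>After a shift by \<open>\<lfloor>t\<rfloor>\<close> the \<open>k\<close>-th term is at most the corresponding term of \<open>\<Sum> 1 / i\<^sup>2\<close>, on either side
  of the origin.\<close>
lemma integer_weight_sum:
  "\<exists>W. \<forall>(t::real) F::int set. finite F \<longrightarrow> (\<Sum>k\<in>F. 1 / (1 + \<bar>t + real_of_int k\<bar>)\<^sup>2) \<le> W"
proof -
  define w :: "nat \<Rightarrow> real" where "w i = inverse (real (Suc i) ^ 2)" for i
  have summ: "summable w"
    unfolding w_def using inverse_power_summable[of 2, where ?'a = real]
    by (subst summable_Suc_iff) simp
  have w0: "w i \<ge> 0" for i by (simp add: w_def)
  have "(\<Sum>k\<in>F. 1 / (1 + \<bar>t + real_of_int k\<bar>)\<^sup>2) \<le> 2 * suminf w" if F: "finite F" for t :: real and F :: "int set"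
  proof -
    define c where "c = \<lfloor>t\<rfloor>"
    define A where "A = {k\<in>F. k + c \<ge> 0}"
    define B where "B = {k\<in>F. k + c < 0}"
    have fin: "finite A" "finite B" using F by (auto simp: A_def B_def)
    have "(\<Sum>k\<in>A. 1 / (1 + \<bar>t + real_of_int k\<bar>)\<^sup>2) \<le> (\<Sum>k\<in>A. w (nat (k + c)))"
    proof (rule sum_mono)
      fix k assume "k \<in> A"
      then have "k + c \<ge> 0" by (simp add: A_def)
      then have "real (nat (k + c)) = k + c" by simp
      moreover have "real_of_int c \<le> t" by (simp add: c_def)
      ultimately have "real (Suc (nat (k + c))) \<le> 1 + \<bar>t + k\<bar>" by linarith
      then have "inverse ((1 + \<bar>t + k\<bar>)\<^sup>2) \<le> w (nat (k + c))"
        unfolding w_def by (intro le_imp_inverse_le power_mono) auto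
      then show "1 / (1 + \<bar>t + real_of_int k\<bar>)\<^sup>2 \<le> w (nat (k + c))" by (simp add: inverse_eq_divide)
    qed
    also have "\<dots> = sum w ((\<lambda>k. nat (k + c)) ` A)"
      by (subst sum.reindex) (auto simp: inj_on_def A_def)
    also have "\<dots> \<le> suminf w"
      using summ fin w0 by (intro sum_le_suminf) auto
    finally have 1: "(\<Sum>k\<in>A. 1 / (1 + \<bar>t + real_of_int k\<bar>)\<^sup>2) \<le> suminf w" .
    have "(\<Sum>k\<in>B. 1 / (1 + \<bar>t + real_of_int k\<bar>)\<^sup>2) \<le> (\<Sum>k\<in>B. w (nat (- k - c - 1)))"
    proof (rule sum_mono)
      fix k assume "k \<in> B"
      then have "k + c < 0" by (simp add: B_def)
      then have "real (nat (- k - c - 1)) = - k - c - 1" by simp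
      moreover have "t < c + 1" by (simp add: c_def)
      ultimately have "real (Suc (nat (- k - c - 1))) \<le> 1 + \<bar>t + k\<bar>" by linarith
      then have "inverse ((1 + \<bar>t + k\<bar>)\<^sup>2) \<le> w (nat (- k - c - 1))"
        unfolding w_def by (intro le_imp_inverse_le power_mono) auto
      then show "1 / (1 + \<bar>t + real_of_int k\<bar>)\<^sup>2 \<le> w (nat (- k - c - 1))" by (simp add: inverse_eq_divide)
    qed
    also have "\<dots> = sum w ((\<lambda>k. nat (- k - c - 1)) ` B)"
      by (subst sum.reindex) (auto simp: inj_on_def B_def)
    also have "\<dots> \<le> suminf w"
      using summ fin w0 by (intro sum_le_suminf) auto
    finally have 2: "(\<Sum>k\<in>B. 1 / (1 + \<bar>t + real_of_int k\<bar>)\<^sup>2) \<le> suminf w" .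
    have "F = A \<union> B" "A \<inter> B = {}" by (auto simp: A_def B_def)
    then show ?thesis using 1 2 fin by (simp add: sum.union_disjoint)
  qed
  then show ?thesis by blast
qed

text \<open>The product structure of the weight reduces the sum to one dimension.\<close>
lemma lattice_weight_sum:
  "\<exists>W. \<forall>(x::real^'n) F. finite F \<longrightarrow> (\<Sum>z\<in>F. \<Prod>i\<in>UNIV. 1 / (1 + \<bar>(x + lattice_pt z) $ i\<bar>)\<^sup>2) \<le> W"
proof -
  obtain W where W: "\<And>t F. finite F \<Longrightarrow> (\<Sum>k\<in>F. 1 / (1 + \<bar>t + real_of_int k\<bar>)\<^sup>2) \<le> W"
    using integer_weight_sum by blast
  have "(\<Sum>z\<in>F. \<Prod>i\<in>UNIV. 1 / (1 + \<bar>(x + lattice_pt z) $ i\<bar>)\<^sup>2) \<le> W ^ CARD('n)"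
    if F: "finite F" for x :: "real^'n" and F
  proof -
    define B where "B i = (\<lambda>z :: int^'n. z $ i) ` F" for i
    define g where "g = (\<lambda>z :: 'n \<Rightarrow> int. \<Prod>i\<in>UNIV. 1 / (1 + \<bar>x $ i + real_of_int (z i)\<bar>)\<^sup>2)"
    have fB: "finite (B i)" for i using F by (simp add: B_def)
    have "(\<Sum>z\<in>F. \<Prod>i\<in>UNIV. 1 / (1 + \<bar>(x + lattice_pt z) $ i\<bar>)\<^sup>2) = (\<Sum>z\<in>F. g (vec_nth z))"
      by (simp add: g_def)
    also have "\<dots> = sum g (vec_nth ` F)"
      by (subst sum.reindex) (auto simp: inj_on_def vec_nth_inject)
    also have "\<dots> \<le> sum g (PiE UNIV B)"
      by (rule sum_mono2) (auto simp: g_def B_def F intro!: finite_PiE prod_nonneg)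
    also have "\<dots> = (\<Prod>i\<in>UNIV. \<Sum>k\<in>B i. 1 / (1 + \<bar>x $ i + real_of_int k\<bar>)\<^sup>2)"
      unfolding g_def by (rule prod_sum_PiE[symmetric]) (auto simp: fB)
    also have "\<dots> \<le> (\<Prod>i\<in>(UNIV :: 'n set). W)"
      by (rule prod_mono) (auto intro!: sum_nonneg W fB)
    finally show ?thesis by simp
  qed
  then show ?thesis by blast
qed

text \<open>The decay \<open>(1 + norm y) powr (- 2 * n)\<close> is dominated by a product of the one-dimensional weights
  \<open>1 / (1 + \<bar>y $ i\<bar>)\<^sup>2\<close>. The exponent is far from optimal, which is harmless because symbols can be
  differentiated any number of times. Restricting to finite \<open>F\<close> avoids questions of summability.\<close>
lemma lattice_decay_sum:
  assumes "s \<le> - 2 * real CARD('n)" "\<delta> > 0"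
  shows "\<exists>W\<ge>0. \<forall>(x::real^'n) F. finite F \<longrightarrow>
    (\<Sum>z\<in>F. if norm (x + lattice_pt z) < \<delta> then 0 else norm (x + lattice_pt z) powr s) \<le> W"
proof -
  let ?P = "\<lambda>y :: real^'n. \<Prod>i\<in>UNIV. 1 / (1 + \<bar>y $ i\<bar>)\<^sup>2"
  obtain W where W: "\<And>(x::real^'n) F. finite F \<Longrightarrow> (\<Sum>z\<in>F. ?P (x + lattice_pt z)) \<le> W"
    using lattice_weight_sum by blast
  \<comment> \<open>\<open>norm y\<close> and \<open>1 + norm y\<close> are comparable for \<open>norm y \<ge> \<delta>\<close>\<close>
  define c where "c = (\<delta> / (1 + \<delta>)) powr s"
  have le: "norm y powr s \<le> c * ?P y" if y: "norm y \<ge> \<delta>" for y :: "real^'n"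
  proof -
    have "\<delta> / (1 + \<delta>) * (1 + norm y) \<le> norm y"
      using y assms(2) by (simp add: field_simps)
    then have "norm y powr s \<le> (\<delta> / (1 + \<delta>) * (1 + norm y)) powr s"
      using assms(1,2) norm_ge_zero[of y]
      by (intro powr_mono2' mult_pos_pos divide_pos_pos add_pos_nonneg) auto
    also have "\<dots> = c * (1 + norm y) powr s"
      using assms(2) unfolding c_def by (intro powr_mult)
    also have "(1 + norm y) powr s \<le> (1 + norm y) powr (- 2 * real CARD('n))"
      using assms(1) by (intro powr_mono) auto
    also have "\<dots> = (\<Prod>i\<in>(UNIV :: 'n set). 1 / (1 + norm y)\<^sup>2)"
    proof -
      have pos: "1 + norm y > 0" by (simp add: add_pos_nonneg)
      have "(1 + norm y) powr (- 2 * real CARD('n)) = inverse ((1 + norm y) powr real (2 * CARD('n)))"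
        by (simp add: powr_minus)
      also have "(1 + norm y) powr real (2 * CARD('n)) = ((1 + norm y)\<^sup>2) ^ CARD('n)"
        unfolding power_mult[symmetric] by (rule powr_realpow[OF pos])
      finally show ?thesis by (simp add: power_one_over inverse_eq_divide)
    qed
    also have "\<dots> \<le> ?P y"
      by (intro prod_mono conjI divide_left_mono power_mono add_left_mono component_le_norm_cart)
        (auto intro!: mult_pos_pos add_pos_nonneg zero_less_power)
    finally show ?thesis by (simp add: c_def mult_left_mono)
  qed
  have P0: "?P y \<ge> 0" for y by (intro prod_nonneg) auto
  have c0: "c \<ge> 0" by (simp add: c_def)
  have "(\<Sum>z\<in>F. if norm (x + lattice_pt z) < \<delta> then 0 else norm (x + lattice_pt z) powr s) \<le> c * W"
    if F: "finite F" for x :: "real^'n" and F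
  proof -
    have "(\<Sum>z\<in>F. if norm (x + lattice_pt z) < \<delta> then 0 else norm (x + lattice_pt z) powr s)
        \<le> (\<Sum>z\<in>F. c * ?P (x + lattice_pt z))"
    proof (rule sum_mono)
      fix z
      show "(if norm (x + lattice_pt z) < \<delta> then 0 else norm (x + lattice_pt z) powr s) \<le> c * ?P (x + lattice_pt z)"
        using le[of "x + lattice_pt z"] mult_nonneg_nonneg[OF c0 P0, of "x + lattice_pt z"] by simp
    qed
    also have "\<dots> \<le> c * W"
      unfolding sum_distrib_left[symmetric] using c0 W[OF F] by (intro mult_left_mono)
    finally show ?thesis .
  qed
  moreover have "c * W \<ge> 0" using c0 W[of "{}"] by simp
  ultimately show ?thesis by blast
qed

text \<open>An infinite sum is used, although only finitely many terms matter for functions of bounded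
  support, because it makes the periodicity exact.\<close>
definition periodization :: "(real^'n \<Rightarrow> real) \<Rightarrow> real^'n \<Rightarrow> real"
  where "periodization f x = (\<Sum>\<^sub>\<infinity>z. f (x + lattice_pt z))"

lemma periodization_eq_sum:
  assumes "finite F" "\<And>z. z \<notin> F \<Longrightarrow> f (x + lattice_pt z) = 0"
  shows "periodization f x = (\<Sum>z\<in>F. f (x + lattice_pt z))"
proof -
  have "periodization f x = (\<Sum>\<^sub>\<infinity>z\<in>F. f (x + lattice_pt z))"
    unfolding periodization_def using assms(2) by (intro infsum_cong_neutral) auto
  then show ?thesis using assms(1) by simp
qed

lemma periodization_shift: "periodization f (x + lattice_pt w) = periodization f x"
proof -
  have "periodization f (x + lattice_pt w) = (\<Sum>\<^sub>\<infinity>z. f (x + lattice_pt (w + z)))"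
    by (simp add: periodization_def lattice_pt_add add.assoc)
  also have "\<dots> = periodization f x"
    unfolding periodization_def
    by (rule infsum_reindex_bij_betw[where g = "\<lambda>z. w + z"])
      (rule bij_betw_byWitness[where f' = "\<lambda>z. z - w"], auto)
  finally show ?thesis .
qed

lemma periodization_bound:
  fixes f :: "real^'n \<Rightarrow> real"
  assumes W: "\<And>(x::real^'n) F. finite F \<Longrightarrow>
      (\<Sum>z\<in>F. if norm (x + lattice_pt z) < \<delta> then 0 else norm (x + lattice_pt z) powr s) \<le> W"
    and f: "\<And>y. norm y \<ge> \<delta> \<Longrightarrow> \<bar>f y\<bar> \<le> C * norm y powr s"
    and "\<And>y. norm y < \<delta> \<Longrightarrow> f y = 0" "\<And>y. norm y \<ge> R \<Longrightarrow> f y = 0" "C \<ge> 0"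
  shows "\<bar>periodization f x\<bar> \<le> C * W"
proof -
  define F where "F = {z. norm (x + lattice_pt z) < R}"
  have F: "finite F" unfolding F_def by (rule finite_lattice_norm_less)
  have "periodization f x = (\<Sum>z\<in>F. f (x + lattice_pt z))"
    using assms(4) by (intro periodization_eq_sum F) (auto simp: F_def)
  also have "\<bar>\<dots>\<bar> \<le> (\<Sum>z\<in>F. \<bar>f (x + lattice_pt z)\<bar>)" by (rule sum_abs)
  also have "\<dots> \<le> (\<Sum>z\<in>F. C * (if norm (x + lattice_pt z) < \<delta> then 0 else norm (x + lattice_pt z) powr s))"
    using f assms(3) by (intro sum_mono) auto
  also have "\<dots> \<le> C * W"
    unfolding sum_distrib_left[symmetric] using W[OF F] assms(5) by (intro mult_left_mono)
  finally show ?thesis .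
qed

text \<open>Near a given point only one fixed finite set of lattice translates of \<open>f\<close> contributes.\<close>
lemma periodization_deriv:
  fixes f :: "real^'n \<Rightarrow> real"
  assumes f: "\<And>x. f differentiable (at x)" and R: "\<And>y. norm y \<ge> R \<Longrightarrow> f y = 0"
  shows "(periodization f has_derivative (\<lambda>u. periodization (dir_deriv u f) x)) (at x)"
proof -
  define F where "F = {z. norm (x + lattice_pt z) < R + 1}"
  have F: "finite F" unfolding F_def by (rule finite_lattice_norm_less)
  have out: "norm (y + lattice_pt z) > R" if "z \<notin> F" "y \<in> ball x 1" for y z
  proof -
    have "norm (x + lattice_pt z) \<le> norm (y + lattice_pt z) + norm (x - y)"
      using norm_triangle_ineq[of "y + lattice_pt z" "x - y"] by (simp add: add.commute)
    then show ?thesis using that by (simp add: F_def dist_norm)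
  qed
  have eq: "periodization f y = (\<Sum>z\<in>F. f (y + lattice_pt z))" if "y \<in> ball x 1" for y
    using out[OF _ that] R by (intro periodization_eq_sum F) force
  have zero: "dir_deriv u f y = 0" if "norm y > R" for u y
    using dir_deriv_cong_open(2)[of "- cball 0 R" y f "\<lambda>x. 0" u] R that by auto
  have eq': "periodization (dir_deriv u f) x = (\<Sum>z\<in>F. dir_deriv u f (x + lattice_pt z))" for u
    using out[of _ x] by (intro periodization_eq_sum F zero) auto
  have "((\<lambda>y. f (y + lattice_pt z)) has_derivative (\<lambda>u. dir_deriv u f (x + lattice_pt z))) (at x)" for z
  proof -
    have "((\<lambda>y. y + lattice_pt z) has_derivative (\<lambda>u. u)) (at x)" by (auto intro!: derivative_eq_intros)
    from diff_chain_at[OF this] show ?thesis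
      using f[of "x + lattice_pt z"] by (simp add: o_def frechet_derivative_works)
  qed
  then have "((\<lambda>y. \<Sum>z\<in>F. f (y + lattice_pt z)) has_derivative
      (\<lambda>u. \<Sum>z\<in>F. dir_deriv u f (x + lattice_pt z))) (at x)"
    by (intro has_derivative_sum)
  then show ?thesis unfolding eq'
    by (rule has_derivative_transform_within_open[where s = "ball x 1"]) (use eq in auto)
qed

lemma periodization_deriv_line:
  fixes f :: "real^'n \<Rightarrow> real"
  assumes f: "\<And>x. f differentiable (at x)" and R: "\<And>y. norm y \<ge> R \<Longrightarrow> f y = 0"
  shows "((\<lambda>t. periodization f (x + t *\<^sub>R u)) has_real_derivative
      periodization (dir_deriv u f) (x + t *\<^sub>R u)) (at t)"
proof -
  have "((\<lambda>t. x + t *\<^sub>R u) has_derivative (\<lambda>h. h *\<^sub>R u)) (at t)" by (auto intro!: derivative_eq_intros)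
  from diff_chain_at[OF this periodization_deriv[OF f R]]
  have d: "((\<lambda>t. periodization f (x + t *\<^sub>R u)) has_derivative
      (\<lambda>h. periodization (dir_deriv (h *\<^sub>R u) f) (x + t *\<^sub>R u))) (at t)" by (simp add: o_def)
  interpret bounded_linear "\<lambda>u. periodization (dir_deriv u f) (x + t *\<^sub>R u')" for u'
    using periodization_deriv[OF f R] has_derivative_bounded_linear by blast
  have "(\<lambda>h. periodization (dir_deriv (h *\<^sub>R u) f) (x + t *\<^sub>R u)) =
      (\<lambda>h. h * periodization (dir_deriv u f) (x + t *\<^sub>R u))" by (simp add: scaleR)
  then show ?thesis using d by (simp add: has_field_derivative_def mult.commute[of _ "periodization _ _"])
qed

text \<open>A derivative of a periodic function along a period vanishes somewhere on each line in that
  direction by Rolle's theorem, so it is bounded by the next derivative.\<close>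
lemma periodization_dir_deriv_le:
  fixes f :: "real^'n \<Rightarrow> real"
  assumes f: "\<And>x. f differentiable (at x)" "\<And>x. dir_deriv (axis i 1) f differentiable (at x)"
    and R: "\<And>y. norm y \<ge> R \<Longrightarrow> f y = 0"
    and B: "\<And>x. \<bar>periodization (dir_deriv (axis i 1) (dir_deriv (axis i 1) f)) x\<bar> \<le> B"
  shows "\<bar>periodization (dir_deriv (axis i 1) f) x\<bar> \<le> B"
proof -
  define b :: "real^'n" where "b = axis i 1"
  define g where "g = dir_deriv b f"
  have zero: "g y = 0" if "norm y \<ge> R + 1" for y
    using dir_deriv_cong_open(2)[of "- cball 0 R" y f "\<lambda>x. 0" b] R that by (auto simp: g_def)
  define \<phi> where "\<phi> = (\<lambda>t. periodization f (x + t *\<^sub>R b))"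
  have d\<phi>: "(\<phi> has_real_derivative periodization g (x + t *\<^sub>R b)) (at t)" for t
    unfolding \<phi>_def g_def using periodization_deriv_line[OF f(1) R] .
  have d\<phi>': "((\<lambda>t. periodization g (x + t *\<^sub>R b)) has_real_derivative
      periodization (dir_deriv b g) (x + t *\<^sub>R b)) (at t)" for t
    using f(2) zero by (intro periodization_deriv_line) (auto simp: g_def b_def)
  have "\<phi> 1 = \<phi> 0"
    using periodization_shift[of f x "axis i 1"] by (simp add: \<phi>_def b_def lattice_pt_axis)
  then obtain \<xi> where \<xi>: "0 < \<xi>" "\<xi> < 1" "periodization g (x + \<xi> *\<^sub>R b) = 0"
    using MVT2[of 0 1 \<phi> "\<lambda>t. periodization g (x + t *\<^sub>R b)"] d\<phi> by auto
  obtain \<eta> where \<eta>: "periodization g (x + \<xi> *\<^sub>R b) - periodization g (x + 0 *\<^sub>R b)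
      = (\<xi> - 0) * periodization (dir_deriv b g) (x + \<eta> *\<^sub>R b)"
    using MVT2[of 0 \<xi> "\<lambda>t. periodization g (x + t *\<^sub>R b)"
      "\<lambda>t. periodization (dir_deriv b g) (x + t *\<^sub>R b)"] d\<phi>' \<xi> by blast
  have "\<bar>periodization g x\<bar> = \<xi> * \<bar>periodization (dir_deriv b g) (x + \<eta> *\<^sub>R b)\<bar>"
  proof -
    have "periodization g x = - (\<xi> * periodization (dir_deriv b g) (x + \<eta> *\<^sub>R b))"
      using \<eta> \<xi>(3) by simp
    then show ?thesis using \<xi>(1) by (simp add: abs_mult)
  qed
  also have "\<dots> \<le> 1 * B"
    using \<xi> B[of "x + \<eta> *\<^sub>R b"] by (intro mult_mono) (auto simp: g_def b_def)
  finally show ?thesis by (simp add: g_def b_def)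
qed

text \<open>Iterating the previous bound reaches a derivative of such high order that the lattice sum of
  the corresponding symbol bound converges.\<close>
lemma periodization_symbol_dir_deriv_bound:
  fixes f :: "real^'n \<Rightarrow> real"
  assumes W: "\<And>(x::real^'n) F. finite F \<Longrightarrow>
      (\<Sum>z\<in>F. if norm (x + lattice_pt z) < \<delta> then 0 else norm (x + lattice_pt z) powr (m - real (Suc k))) \<le> W"
    and "symbol (Suc k) m C f" "\<delta> > 0" "\<And>y. norm y < \<delta> \<Longrightarrow> f y = 0" "\<And>y. norm y \<ge> R \<Longrightarrow> f y = 0"
  shows "\<bar>periodization (dir_deriv (axis i 1) f) x\<bar> \<le> C * W"
  using assms
proof (induction k arbitrary: m f R x)
  case 0
  let ?b = "axis i 1 :: real^'n"
  have zero: "dir_deriv ?b f y = 0" if "norm y < \<delta>" for y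
    using dir_deriv_cong_open(2)[of "ball 0 \<delta>" y f "\<lambda>x. 0" ?b] 0(4) that by auto
  have zero': "dir_deriv ?b f y = 0" if "norm y \<ge> R + 1" for y
    using dir_deriv_cong_open(2)[of "- cball 0 R" y f "\<lambda>x. 0" ?b] 0(5) that by auto
  have sy: "symbol 0 (m - 1) C (dir_deriv ?b f)" using 0(2) by (simp add: axis_in_Basis_iff)
  have b: "\<bar>dir_deriv ?b f y\<bar> \<le> C * norm y powr (m - real (Suc 0))" if "norm y \<ge> \<delta>" for y
  proof -
    have "y \<noteq> 0" using that \<open>\<delta> > 0\<close> by auto
    with sy show ?thesis by simp
  qed
  show ?case
    by (rule periodization_bound[OF 0(1) b zero zero' symbol_nonneg[OF 0(2)]])
next
  case (Suc k)
  let ?b = "axis i 1 :: real^'n"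
  have zero: "dir_deriv ?b f y = 0" if "norm y < \<delta>" for y
    using dir_deriv_cong_open(2)[of "ball 0 \<delta>" y f "\<lambda>x. 0" ?b] Suc(5) that by auto
  have zero': "dir_deriv ?b f y = 0" if "norm y \<ge> R + 1" for y
    using dir_deriv_cong_open(2)[of "- cball 0 R" y f "\<lambda>x. 0" ?b] Suc(6) that by auto
  have sy: "symbol (Suc k) (m - 1) C (dir_deriv ?b f)" using Suc(3) by (simp add: axis_in_Basis_iff)
  have diff: "g differentiable (at y)"
    if "\<And>y. y \<noteq> 0 \<Longrightarrow> g differentiable (at y)" "\<And>y. norm y < \<delta> \<Longrightarrow> g y = 0" for g :: "real^'n \<Rightarrow> real" and y
  proof (cases "y = 0")
    case True
    then show ?thesis using dir_deriv_cong_open(1)[of "ball 0 \<delta>" y g "\<lambda>x. 0"] that(2) \<open>\<delta> > 0\<close> by auto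
  qed (use that in auto)
  show ?case
  proof (rule periodization_dir_deriv_le[OF _ _ Suc(6)])
    show "f differentiable (at y)" for y
      by (rule diff) (use Suc(3,5) in simp_all)
    show "dir_deriv ?b f differentiable (at y)" for y
      by (rule diff) (use sy zero in simp_all)
    show "\<bar>periodization (dir_deriv ?b (dir_deriv ?b f)) y\<bar> \<le> C * W" for y
    proof (rule Suc.IH[OF _ sy \<open>\<delta> > 0\<close>])
      have e: "m - 1 - real (Suc k) = m - real (Suc (Suc k))" by simp
      show "(\<Sum>z\<in>F. if norm (x + lattice_pt z) < \<delta> then 0
          else norm (x + lattice_pt z) powr (m - 1 - real (Suc k))) \<le> W" if "finite F" for x :: "real^'n" and F
        unfolding e by (rule Suc(2)[OF that])
    qed (use zero zero' in auto)
  qed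
qed

section \<open>Quadrature error on the unit lattice\<close>

lemma lborel_integral_affine:
  fixes f :: "'a::euclidean_space \<Rightarrow> real"
  assumes "f \<in> borel_measurable borel" "c \<noteq> 0"
  shows "(\<integral>x. f x \<partial>lborel) = \<bar>c\<bar> ^ DIM('a) * (\<integral>x. f (t + c *\<^sub>R x) \<partial>lborel)"
proof -
  have m: "(\<lambda>x. t + c *\<^sub>R x) \<in> borel_measurable borel" by measurable
  have "(\<integral>x. f x \<partial>lborel) = (\<integral>x. f x \<partial>density (distr lborel borel (\<lambda>x. t + c *\<^sub>R x)) (\<lambda>_. ennreal (\<bar>c\<bar> ^ DIM('a))))"
    by (subst lborel_affine[OF assms(2), of t]) (simp add: ennreal_power)
  also have "\<dots> = (\<integral>x. \<bar>c\<bar> ^ DIM('a) * f x \<partial>distr lborel borel (\<lambda>x. t + c *\<^sub>R x))"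
    using assms(1) by (subst integral_density) auto
  also have "\<dots> = \<bar>c\<bar> ^ DIM('a) * (\<integral>x. f x \<partial>distr lborel borel (\<lambda>x. t + c *\<^sub>R x))"
    by (rule integral_mult_right_zero)
  also have "(\<integral>x. f x \<partial>distr lborel borel (\<lambda>x. t + c *\<^sub>R x)) = (\<integral>x. f (t + c *\<^sub>R x) \<partial>lborel)"
    using assms(1) m by (subst integral_distr) auto
  finally show ?thesis .
qed

definition unit_cube :: "(real^'n) set"
  where "unit_cube = {x. \<forall>i. 0 \<le> x $ i \<and> x $ i < 1}"

lemma unit_cube_sets [measurable]: "unit_cube \<in> sets borel"
proof -
  have "unit_cube = (\<Inter>i. {x::real^'n. 0 \<le> x $ i} \<inter> {x. x $ i < 1})"
    by (auto simp: unit_cube_def)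
  also have "\<dots> \<in> sets borel"
    by (intro sets.finite_INT sets.Int borel_closed borel_open closed_Collect_le open_Collect_less)
      (auto intro!: continuous_intros)
  finally show ?thesis .
qed

lemma unit_cube_measure: "emeasure lborel (unit_cube :: (real^'n) set) = 1"
proof (rule antisym)
  have one: "emeasure lborel (cbox 0 1 :: (real^'n) set) = 1" "emeasure lborel (box 0 1 :: (real^'n) set) = 1"
    by (simp_all add: emeasure_lborel_cbox_eq emeasure_lborel_box_eq Basis_vec_def inner_axis prod.neutral)
  show "emeasure lborel (unit_cube :: (real^'n) set) \<le> 1"
    unfolding one(1)[symmetric]
    by (intro emeasure_mono) (auto simp: unit_cube_def mem_box_cart less_imp_le)
  show "1 \<le> emeasure lborel (unit_cube :: (real^'n) set)"
    unfolding one(2)[symmetric]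
    by (intro emeasure_mono) (auto simp: unit_cube_def mem_box_cart less_imp_le)
qed

lemma unit_cube_tiling:
  "indicator unit_cube (x - lattice_pt z) = (if z = (\<chi> i. \<lfloor>x $ i\<rfloor>) then 1 else (0::real))"
proof -
  have "0 \<le> x $ i - real_of_int (z $ i) \<and> x $ i - real_of_int (z $ i) < 1 \<longleftrightarrow> z $ i = \<lfloor>x $ i\<rfloor>" for i
    by linarith
  then have "x - lattice_pt z \<in> unit_cube \<longleftrightarrow> z = (\<chi> i. \<lfloor>x $ i\<rfloor>)"
    by (auto simp: unit_cube_def vec_eq_iff)
  then show ?thesis by (simp add: indicator_def)
qed

text \<open>The translates of the half-open unit cube by lattice points tile the space.\<close>
lemma integral_eq_integral_periodization:
  fixes f :: "real^'n \<Rightarrow> real"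
  assumes f: "integrable lborel f" and R: "\<And>y. norm y \<ge> R \<Longrightarrow> f y = 0"
  shows "integrable lborel (\<lambda>x. indicator unit_cube x * periodization f x)"
    and "(\<integral>x. f x \<partial>lborel) = (\<integral>x. indicator unit_cube x * periodization f x \<partial>lborel)"
proof -
  define F where "F = {z :: int^'n. norm (0 + lattice_pt z) < R + real CARD('n)}"
  have F: "finite F" unfolding F_def by (rule finite_lattice_norm_less)
  have [measurable]: "f \<in> borel_measurable borel" using f by auto
  have Q: "norm x \<le> real CARD('n)" if "x \<in> unit_cube" for x :: "real^'n"
  proof -
    have "norm x \<le> (\<Sum>i\<in>UNIV. \<bar>x $ i\<bar>)" by (rule norm_le_l1_cart)
    also have "\<dots> \<le> (\<Sum>i\<in>(UNIV::'n set). 1)" using that by (intro sum_mono) (auto simp: unit_cube_def less_imp_le)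
    finally show ?thesis by simp
  qed
  have outF: "f (x + lattice_pt z) = 0" if "x \<in> unit_cube" "z \<notin> F" for x z
  proof (rule R)
    have "norm (lattice_pt z) \<le> norm (x + lattice_pt z) + norm x"
      using norm_triangle_ineq4[of "x + lattice_pt z" x] by simp
    then show "norm (x + lattice_pt z) \<ge> R" using that Q[OF that(1)] by (simp add: F_def)
  qed
  have eq1: "f x = (\<Sum>z\<in>F. indicator unit_cube (x - lattice_pt z) * f x)" for x
  proof -
    let ?z = "(\<chi> i. \<lfloor>x $ i\<rfloor>) :: int^'n"
    have "f x = 0" if "?z \<notin> F"
    proof -
      have "x - lattice_pt ?z \<in> unit_cube"
        using unit_cube_tiling[of x ?z] by (auto simp: indicator_def split: if_splits)
      from outF[OF this that] show ?thesis by simp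
    qed
    then show ?thesis by (simp add: unit_cube_tiling if_distrib[of "\<lambda>t. t * _"] sum.delta[OF F] cong: if_cong)
  qed
  have eq2: "indicator unit_cube x * periodization f x
      = (\<Sum>z\<in>F. indicator unit_cube x * f (x + lattice_pt z))" for x
    using periodization_eq_sum[OF F, of f x] outF[of x]
    by (cases "x \<in> unit_cube") (auto simp: sum_distrib_left)
  have tr: "integrable lborel (\<lambda>x. f (x + c))" for c
  proof -
    have "integrable (distr lborel borel ((+) c)) f" using f by (simp add: lborel_distr_plus)
    then show ?thesis by (subst (asm) integrable_distr_eq) (auto simp: add.commute)
  qed
  have int1: "integrable lborel (\<lambda>x. indicator unit_cube x * f (x + lattice_pt z))" for z
    using integrable_real_mult_indicator[OF _ tr[of "lattice_pt z"], of unit_cube] by (simp add: mult.commute)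
  show "integrable lborel (\<lambda>x. indicator unit_cube x * periodization f x)"
    unfolding eq2 by (intro Bochner_Integration.integrable_sum int1)
  have m: "(\<lambda>x. indicator unit_cube (x - lattice_pt z) * f x) \<in> borel_measurable borel" for z
  proof -
    have "(\<lambda>x. indicator unit_cube (x - lattice_pt z) :: real) \<in> borel_measurable borel"
      by measurable
    then show ?thesis by simp
  qed
  have int2: "integrable lborel (\<lambda>x. indicator unit_cube (x - lattice_pt z) * f x)" for z
    by (rule Bochner_Integration.integrable_bound[OF f]) (use m in \<open>auto simp: indicator_def\<close>)
  have "(\<integral>x. f x \<partial>lborel) = (\<integral>x. (\<Sum>z\<in>F. indicator unit_cube (x - lattice_pt z) * f x) \<partial>lborel)"
    using eq1 by simp
  also have "\<dots> = (\<Sum>z\<in>F. \<integral>x. indicator unit_cube (x - lattice_pt z) * f x \<partial>lborel)"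
    by (intro Bochner_Integration.integral_sum int2)
  also have "\<dots> = (\<Sum>z\<in>F. \<integral>x. indicator unit_cube x * f (x + lattice_pt z) \<partial>lborel)"
  proof (intro sum.cong refl)
    fix z
    show "(\<integral>x. indicator unit_cube (x - lattice_pt z) * f x \<partial>lborel)
        = (\<integral>x. indicator unit_cube x * f (x + lattice_pt z) \<partial>lborel)"
      by (subst lborel_integral_affine[OF m[of z], of 1 "lattice_pt z"]) (simp_all add: add.commute)
  qed
  also have "\<dots> = (\<integral>x. indicator unit_cube x * periodization f x \<partial>lborel)"
    unfolding eq2 by (intro Bochner_Integration.integral_sum[symmetric] int1)
  finally show "(\<integral>x. f x \<partial>lborel) = (\<integral>x. indicator unit_cube x * periodization f x \<partial>lborel)" .
qed

lemma periodization_oscillation: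
  fixes f :: "real^'n \<Rightarrow> real"
  assumes f: "\<And>x. f differentiable (at x)" and R: "\<And>y. norm y \<ge> R \<Longrightarrow> f y = 0"
    and B: "\<And>i x. \<bar>periodization (dir_deriv (axis i 1) f) x\<bar> \<le> B"
  shows "\<bar>periodization f (x + u) - periodization f x\<bar> \<le> (\<Sum>i\<in>UNIV. \<bar>u $ i\<bar>) * B"
proof -
  let ?D = "\<lambda>y u. periodization (dir_deriv u f) y"
  obtain \<xi> where \<xi>: "periodization f (x + 1 *\<^sub>R u) - periodization f (x + 0 *\<^sub>R u) = (1 - 0) * ?D (x + \<xi> *\<^sub>R u) u"
    using MVT2[of 0 1 "\<lambda>t. periodization f (x + t *\<^sub>R u)" "\<lambda>t. ?D (x + t *\<^sub>R u) u"]
      periodization_deriv_line[OF f R] by (metis zero_less_one)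
  interpret bounded_linear "?D (x + \<xi> *\<^sub>R u)"
    using periodization_deriv[OF f R] has_derivative_bounded_linear by blast
  have "?D (x + \<xi> *\<^sub>R u) u = ?D (x + \<xi> *\<^sub>R u) (\<Sum>i\<in>UNIV. (u $ i) *\<^sub>R axis i 1)"
    using basis_expansion[of u] by (simp add: scalar_mult_eq_scaleR)
  also have "\<dots> = (\<Sum>i\<in>UNIV. u $ i * ?D (x + \<xi> *\<^sub>R u) (axis i 1))"
    by (simp add: sum scaleR)
  also have "\<bar>\<dots>\<bar> \<le> (\<Sum>i\<in>UNIV. \<bar>u $ i * ?D (x + \<xi> *\<^sub>R u) (axis i 1)\<bar>)" by (rule sum_abs)
  also have "\<dots> \<le> (\<Sum>i\<in>UNIV. \<bar>u $ i\<bar> * B)"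
    unfolding abs_mult by (intro sum_mono mult_left_mono B) auto
  finally show ?thesis using \<xi> by (simp add: sum_distrib_right)
qed

text \<open>The integral is the mean of the periodisation over a unit cell, and the lattice sum is one of its
  values, so their difference is at most its oscillation.\<close>
lemma smooth_quadrature_error:
  fixes f :: "real^'n \<Rightarrow> real"
  assumes W: "\<And>(x::real^'n) F. finite F \<Longrightarrow>
      (\<Sum>z\<in>F. if norm (x + lattice_pt z) < \<delta> then 0 else norm (x + lattice_pt z) powr (m - real (Suc k))) \<le> W"
    and f: "symbol (Suc k) m C f" "\<delta> > 0" "\<And>y. norm y < \<delta> \<Longrightarrow> f y = 0" "\<And>y. norm y \<ge> R \<Longrightarrow> f y = 0"
    and int: "integrable lborel f" and a: "\<And>i. \<bar>a $ i\<bar> \<le> 1"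
  shows "\<bar>(\<integral>x. f x \<partial>lborel) - periodization f a\<bar> \<le> 2 * real CARD('n) * (C * W)"
proof -
  let ?P = "periodization f" and ?B = "2 * real CARD('n) * (C * W)"
  have diff: "f differentiable (at y)" for y
  proof (cases "y = 0")
    case True
    then show ?thesis using dir_deriv_cong_open(1)[of "ball 0 \<delta>" y f "\<lambda>x. 0"] f by auto
  qed (use f(1) in auto)
  have B: "\<bar>periodization (dir_deriv (axis i 1) f) x\<bar> \<le> C * W" for i x
    by (rule periodization_symbol_dir_deriv_bound[OF W f])
  have CW: "C * W \<ge> 0" using B order_trans abs_ge_zero by blast
  have osc: "\<bar>?P x - ?P a\<bar> \<le> ?B" if x: "x \<in> unit_cube" for x
  proof -
    have "\<bar>?P (a + (x - a)) - ?P a\<bar> \<le> (\<Sum>i\<in>UNIV. \<bar>(x - a) $ i\<bar>) * (C * W)"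
      by (rule periodization_oscillation[OF diff f(4) B])
    also have "(\<Sum>i\<in>UNIV. \<bar>(x - a) $ i\<bar>) \<le> (\<Sum>i\<in>(UNIV::'n set). 2)"
    proof (rule sum_mono)
      fix i
      have "0 \<le> x $ i" "x $ i < 1" using x by (auto simp: unit_cube_def)
      then show "\<bar>(x - a) $ i\<bar> \<le> 2" using a[of i] by (simp add: abs_le_iff)
    qed
    finally show ?thesis using CW by (simp add: mult_right_mono mult.commute)
  qed
  have P: "integrable lborel (\<lambda>x. indicator unit_cube x * ?P x)"
    "(\<integral>x. f x \<partial>lborel) = (\<integral>x. indicator unit_cube x * ?P x \<partial>lborel)"
    by (rule integral_eq_integral_periodization[OF int f(4)], assumption)+
  have Q: "integrable lborel (indicator unit_cube :: real^'n \<Rightarrow> real)"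
    by (intro integrable_real_indicator) (simp_all add: unit_cube_measure)
  have Q1: "(\<integral>x. indicator unit_cube x \<partial>(lborel :: (real^'n) measure)) = (1::real)"
    using unit_cube_measure by (simp add: measure_def)
  have "(\<integral>x. f x \<partial>lborel) - ?P a = (\<integral>x. indicator unit_cube x * ?P x - indicator unit_cube x * ?P a \<partial>lborel)"
    using P Q Q1 by simp
  also have "norm \<dots> \<le> (\<integral>x. norm (indicator unit_cube x * ?P x - indicator unit_cube x * ?P a) \<partial>lborel)"
    by (rule integral_norm_bound)
  also have "\<dots> \<le> (\<integral>x. indicator unit_cube x * ?B \<partial>(lborel :: (real^'n) measure))"
  proof (rule Bochner_Integration.integral_mono)
    show "integrable lborel (\<lambda>x. norm (indicator unit_cube x * ?P x - indicator unit_cube x * ?P a))"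
      using P(1) Q by simp
    show "integrable lborel (\<lambda>x :: real^'n. indicator unit_cube x * ?B)" using Q by simp
    show "norm (indicator unit_cube x * ?P x - indicator unit_cube x * ?P a) \<le> indicator unit_cube x * ?B"
      for x :: "real^'n"
      using osc[of x] by (simp add: indicator_def)
  qed
  also have "\<dots> = ?B" using Q1 by simp
  finally show ?thesis by simp
qed

text \<open>The ball is covered by dyadic annuli, and even after each is enlarged to a ball, their contributions
  add up to a geometric series.\<close>
lemma nn_integral_norm_powr_ball:
  assumes "a > - real DIM('a)" "R > 0"
  shows "(\<integral>\<^sup>+x. ennreal (indicator (ball 0 R) x * norm x powr a) \<partial>(lborel :: 'a::euclidean_space measure)) < \<infinity>"
proof (cases "a \<ge> 0")
  case True
  have "(\<integral>\<^sup>+x. ennreal (indicator (ball 0 R) x * norm x powr a) \<partial>(lborel :: 'a measure))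
      \<le> (\<integral>\<^sup>+x. ennreal (R powr a) * indicator (ball 0 R) x \<partial>(lborel :: 'a measure))"
    using True by (intro nn_integral_mono) (auto simp: indicator_def intro!: ennreal_leI powr_mono2)
  also have "\<dots> = ennreal (R powr a) * emeasure lborel (ball (0::'a) R)"
    by (subst nn_integral_cmult_indicator) auto
  also have "\<dots> < \<infinity>" by (simp add: ennreal_mult_less_top emeasure_bounded_finite[simplified])
  finally show ?thesis .
next
  case False
  define r where "r j = R * (1 / 2) ^ j" for j :: nat
  define q where "q = (1 / 2 :: real) powr (a + real DIM('a))"
  define V where "V = unit_ball_vol (real DIM('a))"
  have r0: "r j > 0" for j using assms(2) by (simp add: r_def)
  have q: "0 < q" "q < 1"
    using assms(1) powr_less_mono2[of "a + real DIM('a)" "1/2" 1] by (auto simp: q_def)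
  have V0: "V \<ge> 0" by (simp add: V_def)
  have pt: "ennreal (indicator (ball 0 R) x * norm x powr a)
      \<le> (\<Sum>j. ennreal (r (Suc j) powr a) * indicator (cball 0 (r j)) x)" for x :: 'a
  proof (cases "x \<noteq> 0 \<and> norm x < R")
    case True
    define t where "t = log 2 (R / norm x)"
    define j where "j = nat \<lfloor>t\<rfloor>"
    have "R / norm x > 1" using True assms(2) by simp
    then have "t > 0" by (simp add: t_def)
    then have j: "real j \<le> t" "t < real (Suc j)" unfolding j_def by linarith+
    have "2 powr t = R / norm x" using True assms(2) by (simp add: t_def)
    moreover have "2 powr t < 2 powr real (Suc j)" using j by simp
    moreover have "2 powr t \<ge> 2 powr real j" using j by simp
    ultimately have "R / norm x < 2 ^ Suc j" "R / norm x \<ge> 2 ^ j"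
      using powr_realpow[of 2 j] powr_realpow[of 2 "Suc j"] by (simp_all del: power_Suc)
    then have b: "r (Suc j) \<le> norm x" "norm x \<le> r j"
      using True by (simp_all add: r_def field_simps)
    have "norm x powr a \<le> r (Suc j) powr a"
      using b(1) r0[of "Suc j"] False by (intro powr_mono2') auto
    then have "ennreal (indicator (ball 0 R) x * norm x powr a)
        \<le> ennreal (r (Suc j) powr a) * indicator (cball 0 (r j)) x"
      using b(2) True by (simp add: indicator_def ennreal_leI)
    also have "\<dots> \<le> (\<Sum>j. ennreal (r (Suc j) powr a) * indicator (cball 0 (r j)) x)"
    proof -
      have "sum g {j} \<le> suminf g" for g :: "nat \<Rightarrow> ennreal" by (rule sum_le_suminf) auto
      then show ?thesis by simp
    qed
    finally show ?thesis .
  qed (auto simp: indicator_def)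
  have summand: "ennreal (r (Suc j) powr a) * emeasure lborel (cball (0::'a) (r j))
      = ennreal ((R / 2) powr a * V * R ^ DIM('a) * q ^ j)" for j
  proof -
    define h where "h = (1 / 2 :: real) ^ j"
    have h: "h > 0" by (simp add: h_def)
    have "q ^ j = h powr (a + real DIM('a))"
      unfolding q_def h_def using q(1)
      by (simp add: powr_realpow[symmetric] powr_powr mult.commute)
    also have "\<dots> = h powr a * h ^ DIM('a)" using h by (simp add: powr_add powr_realpow)
    finally have qj: "q ^ j = h powr a * h ^ DIM('a)" .
    have rS: "r (Suc j) = R / 2 * h" and rj: "r j = R * h" by (simp_all add: r_def h_def)
    have "(R / 2 * h) powr a = (R / 2) powr a * h powr a" by (rule powr_mult)
    then have eq: "(R / 2 * h) powr a * (V * (R * h) ^ DIM('a)) = (R / 2) powr a * V * R ^ DIM('a) * q ^ j"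
      unfolding qj power_mult_distrib by (simp only: ac_simps)
    have "emeasure lborel (cball (0::'a) (R * h)) = ennreal (V * (R * h) ^ DIM('a))"
      unfolding V_def using assms(2) h by (intro emeasure_cball) auto
    then show ?thesis
      unfolding rS rj eq[symmetric] by (simp only: ennreal_mult' powr_ge_zero)
  qed
  have "(\<integral>\<^sup>+x. ennreal (indicator (ball 0 R) x * norm x powr a) \<partial>(lborel :: 'a measure))
      \<le> (\<integral>\<^sup>+x. (\<Sum>j. ennreal (r (Suc j) powr a) * indicator (cball 0 (r j)) x) \<partial>(lborel :: 'a measure))"
    by (intro nn_integral_mono pt)
  also have "\<dots> = (\<Sum>j. \<integral>\<^sup>+x. ennreal (r (Suc j) powr a) * indicator (cball 0 (r j)) x \<partial>(lborel :: 'a measure))"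
    by (rule nn_integral_suminf, rule borel_measurable_times_ennreal, rule borel_measurable_const,
        rule borel_measurable_indicator) (simp add: borel_closed)
  also have "\<dots> = (\<Sum>j. ennreal ((R / 2) powr a * V * R ^ DIM('a) * q ^ j))"
  proof (rule arg_cong[where f = suminf], rule ext)
    fix j
    have "(\<integral>\<^sup>+x. ennreal (r (Suc j) powr a) * indicator (cball 0 (r j)) x \<partial>(lborel :: 'a measure))
        = ennreal (r (Suc j) powr a) * emeasure lborel (cball (0::'a) (r j))"
      by (rule nn_integral_cmult_indicator) simp
    then show "(\<integral>\<^sup>+x. ennreal (r (Suc j) powr a) * indicator (cball 0 (r j)) x \<partial>(lborel :: 'a measure))
        = ennreal ((R / 2) powr a * V * R ^ DIM('a) * q ^ j)" by (simp only: summand)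
  qed
  also have "\<dots> < \<infinity>"
  proof -
    have "summable (\<lambda>j. (R / 2) powr a * V * R ^ DIM('a) * q ^ j)"
      using q by (intro summable_mult summable_geometric) simp
    moreover have "0 \<le> (R / 2) powr a * V * R ^ DIM('a) * q ^ j" for j
      using q V0 assms(2) by simp
    ultimately have "(\<Sum>j. ennreal ((R / 2) powr a * V * R ^ DIM('a) * q ^ j)) \<noteq> top"
      by (rule ennreal_suminf_neq_top)
    then show ?thesis by (simp only: less_top infinity_ennreal_def)
  qed
  finally show ?thesis .
qed

lemma integrable_norm_powr_ball:
  assumes "a > - real DIM('a)" "R > 0"
  shows "integrable lborel (\<lambda>x :: 'a::euclidean_space. indicator (ball 0 R) x * norm x powr a)"
proof (rule integrableI_nonneg)
  have [measurable]: "ball (0::'a) R \<in> sets borel" by auto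
  show "(\<lambda>x :: 'a. indicator (ball 0 R) x * norm x powr a) \<in> borel_measurable lborel"
    by measurable
qed (use nn_integral_norm_powr_ball[OF assms] in auto)

lemma borel_measurable_continuous_off_0:
  fixes f :: "'a::euclidean_space \<Rightarrow> real"
  assumes "continuous_on (- {0}) f"
  shows "f \<in> borel_measurable borel"
proof -
  have "(\<lambda>x. indicator (- {0}) x *\<^sub>R f x) \<in> borel_measurable borel"
    by (rule borel_measurable_continuous_on_indicator[OF _ assms]) auto
  then have "(\<lambda>x. indicator (- {0}) x *\<^sub>R f x + indicator {0} x * f 0) \<in> borel_measurable borel"
    by measurable
  moreover have "(\<lambda>x. indicator (- {0}) x *\<^sub>R f x + indicator {0} x * f 0) = f"
    by (auto simp: indicator_def fun_eq_iff)
  ultimately show ?thesis by simp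
qed

lemma symbol_borel_measurable: "symbol (Suc k) m C f \<Longrightarrow> f \<in> borel_measurable borel"
  by (intro borel_measurable_continuous_off_0)
    (auto intro!: continuous_at_imp_continuous_on differentiable_imp_continuous_within)

lemma symbol_integrable:
  fixes f :: "'a::euclidean_space \<Rightarrow> real"
  assumes "symbol (Suc k) m C f" "m > - real DIM('a)" "\<And>y. norm y \<ge> R \<Longrightarrow> f y = 0" "R > 0"
  shows "integrable lborel f"
    and "\<bar>\<integral>x. f x \<partial>lborel\<bar> \<le> C * (\<integral>x. indicator (ball 0 R) x * norm x powr m \<partial>(lborel :: 'a measure))"
proof -
  let ?g = "\<lambda>x :: 'a. C * (indicator (ball 0 R) x * norm x powr m)"
  have g: "integrable lborel ?g"
    by (intro integrable_mult_right integrable_norm_powr_ball assms(2,4))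
  have le: "AE x in lborel. norm (f x) \<le> ?g x"
    using AE_lborel_singleton[of "0::'a"]
  proof eventually_elim
    case (elim x)
    then show ?case using symbol_bound[OF assms(1), of x] assms(3)[of x]
      by (cases "norm x < R") auto
  qed
  show f: "integrable lborel f"
    by (rule Bochner_Integration.integrable_bound[OF g])
      (use symbol_borel_measurable[OF assms(1)] le in \<open>auto elim!: eventually_mono intro: order_trans\<close>)
  have "norm (\<integral>x. f x \<partial>lborel) \<le> (\<integral>x. norm (f x) \<partial>lborel)" by (rule integral_norm_bound)
  also have "\<dots> \<le> (\<integral>x. ?g x \<partial>lborel)"
    using f g le by (intro integral_mono_AE) auto
  finally show "\<bar>\<integral>x. f x \<partial>lborel\<bar> \<le> C * (\<integral>x. indicator (ball 0 R) x * norm x powr m \<partial>(lborel :: 'a measure))"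
    by simp
qed

text \<open>The error of the punctured trapezoidal rule of mesh size \<open>1\<close>, in coordinates that put the
  singularity at the origin. The general mesh size is reduced to this by scaling.\<close>
definition punctured_error :: "real^'n \<Rightarrow> (real^'n \<Rightarrow> real) \<Rightarrow> real"
  where "punctured_error \<alpha> f = (\<integral>x. f x \<partial>lborel) - (\<Sum>\<^sub>\<infinity>z\<in>- {0}. f (lattice_pt z - \<alpha>))"

lemma punctured_sum_eq:
  assumes "\<And>y. norm y \<ge> R \<Longrightarrow> f y = 0"
  shows "(\<Sum>\<^sub>\<infinity>z\<in>- {0}. f (lattice_pt z - \<alpha>))
    = (\<Sum>z\<in>{z. norm (lattice_pt z - \<alpha>) < R} - {0}. f (lattice_pt z - \<alpha>))"
proof -
  have "finite ({z. norm (lattice_pt z - \<alpha>) < R} - {0})"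
    using finite_lattice_norm_less[of "- \<alpha>" R] by simp
  moreover have "(\<Sum>\<^sub>\<infinity>z\<in>- {0}. f (lattice_pt z - \<alpha>))
    = (\<Sum>\<^sub>\<infinity>z\<in>{z. norm (lattice_pt z - \<alpha>) < R} - {0}. f (lattice_pt z - \<alpha>))"
    using assms by (intro infsum_cong_neutral) auto
  ultimately show ?thesis by simp
qed

lemma punctured_error_add:
  assumes "integrable lborel f" "integrable lborel g"
    and "\<And>y. norm y \<ge> R \<Longrightarrow> f y = 0" "\<And>y. norm y \<ge> R \<Longrightarrow> g y = 0"
  shows "punctured_error \<alpha> (\<lambda>x. f x + g x) = punctured_error \<alpha> f + punctured_error \<alpha> g"
  using assms punctured_sum_eq[of R f \<alpha>] punctured_sum_eq[of R g \<alpha>] punctured_sum_eq[of R "\<lambda>x. f x + g x" \<alpha>]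
  by (simp add: punctured_error_def sum.distrib)

lemma punctured_error_cmult: "punctured_error \<alpha> (\<lambda>x. c * f x) = c * punctured_error \<alpha> f"
  by (simp add: punctured_error_def infsum_cmult_right' right_diff_distrib)

lemma punctured_error_sum:
  assumes "finite I" "\<And>i. i \<in> I \<Longrightarrow> integrable lborel (f i)" "\<And>i y. i \<in> I \<Longrightarrow> norm y \<ge> R \<Longrightarrow> f i y = 0"
  shows "punctured_error \<alpha> (\<lambda>x. \<Sum>i\<in>I. f i x) = (\<Sum>i\<in>I. punctured_error \<alpha> (f i))"
  using assms
proof (induction I rule: finite_induct)
  case empty
  then show ?case by (simp add: punctured_error_def)
next
  case (insert i I)
  then show ?case
    by (simp add: punctured_error_add[where R = R] sum.neutral Bochner_Integration.integrable_sum)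
qed

lemma infnorm_less_imp_norm_less:
  fixes y :: "real^'n"
  assumes "infnorm y < 1"
  shows "norm y < real CARD('n) + 1"
proof -
  have "norm y \<le> (\<Sum>i\<in>UNIV. \<bar>y $ i\<bar>)" by (rule norm_le_l1_cart)
  also have "\<dots> \<le> (\<Sum>i\<in>(UNIV::'n set). 1)"
    using assms component_le_infnorm_cart[of y] by (intro sum_mono) (meson less_imp_le order_trans)
  finally show ?thesis by simp
qed

text \<open>The function is split by a cutoff of unit size. The part near the origin is estimated term by
  term, since the nodes \<open>z - \<alpha>\<close> with \<open>z \<noteq> 0\<close> keep distance \<open>1 / 2\<close> from the singularity; the other
  part is smooth, and the omitted node \<open>- \<alpha>\<close> does not contribute to its lattice sum.\<close>
theorem symbol_quadrature_error:
  fixes \<alpha> :: "real^'n" and \<psi> :: "real^'n \<Rightarrow> real"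
  assumes \<alpha>: "infnorm \<alpha> \<le> 1 / 2" and m: "m > - real CARD('n)"
    and \<psi>: "\<psi> \<in> Cc_infinity UNIV" "\<And>x. infnorm x \<le> 3 / 4 \<Longrightarrow> \<psi> x = 1" "\<And>x. infnorm x \<ge> 1 \<Longrightarrow> \<psi> x = 0"
  shows "\<exists>k K. K \<ge> 0 \<and> (\<forall>f C R. symbol (Suc k) m C f \<longrightarrow> (\<forall>y. norm y \<ge> R \<longrightarrow> f y = 0) \<longrightarrow>
    \<bar>punctured_error \<alpha> f\<bar> \<le> K * C)"
proof -
  define N where "N = real CARD('n) + 1"
  \<comment> \<open>enough derivatives for the lattice sums of the bounds on them to converge\<close>
  define k where "k = nat \<lceil>m + 2 * real CARD('n)\<rceil>"
  define s where "s = m - real (Suc k)"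
  have s: "s \<le> - 2 * real CARD('n)" unfolding s_def k_def by linarith
  have N0: "N > 0" by (simp add: N_def)
  obtain W where W: "W \<ge> 0" "\<And>(x::real^'n) F. finite F \<Longrightarrow>
      (\<Sum>z\<in>F. if norm (x + lattice_pt z) < 1 / 2 then 0 else norm (x + lattice_pt z) powr s) \<le> W"
    using lattice_decay_sum[OF s, of "1 / 2"] by auto
  obtain A where A: "symbol (Suc k) 0 A \<psi>" using symbol_Cc_infinity[OF \<psi>(1), of 0] by blast
  have A0: "A \<ge> 0" using symbol_nonneg[OF A] .
  define J where "J = (\<integral>x. indicator (ball 0 N) x * norm x powr m \<partial>(lborel :: (real^'n) measure))"
  have J0: "J \<ge> 0" unfolding J_def by (intro integral_nonneg_AE) auto
  define K where "K = 2 ^ Suc k * A * J + 2 ^ Suc k * A * N ^ Suc k * W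
    + 2 * real CARD('n) * (2 ^ Suc k * (1 + A) * W)"
  have "\<bar>punctured_error \<alpha> f\<bar> \<le> K * C"
    if f: "symbol (Suc k) m C f" and R: "\<And>y. norm y \<ge> R \<Longrightarrow> f y = 0" for f C R
  proof -
    define g where "g = (\<lambda>x. f x * \<psi> x)"
    define h where "h = (\<lambda>x. f x * (1 + - 1 * \<psi> x))"
    define R' where "R' = max R N"
    have R': "R' > 0" using N0 by (simp add: R'_def)
    have m': "m > - real DIM(real^'n)" using m by simp
    have C0: "C \<ge> 0" using symbol_nonneg[OF f] .
    have gs: "symbol (Suc k) m (2 ^ Suc k * C * A) g"
      using symbol_mult[OF f A] by (simp add: g_def)
    have "symbol (Suc k) 0 (1 + A) (\<lambda>x. 1 + - 1 * \<psi> x)"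
      using symbol_add[OF symbol_const[of _ 1] symbol_cmult[OF A, of "- 1" A]] by simp
    from symbol_mult[OF f this] have hs: "symbol (Suc k) m (2 ^ Suc k * C * (1 + A)) h"
      by (simp add: h_def)
    have g_out: "g y = 0" if "norm y \<ge> N" for y
      using \<psi>(3)[of y] infnorm_less_imp_norm_less[of y] that by (force simp: g_def N_def)
    have h_out: "h y = 0" if "norm y \<ge> R'" for y
      using R[of y] that by (simp add: h_def R'_def)
    have h_in: "h y = 0" if "infnorm y \<le> 3 / 4" for y
      using \<psi>(2)[OF that] by (simp add: h_def)
    have h_in': "h y = 0" if "norm y < 1 / 2" for y
      using infnorm_le_norm[of y] that by (intro h_in) simp
    have gi: "integrable lborel g"
      by (rule symbol_integrable(1)[OF gs m' _ N0]) (use g_out in simp)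
    have hi: "integrable lborel h"
      by (rule symbol_integrable(1)[OF hs m' _ R']) (use h_out in simp)
    have "f = (\<lambda>x. g x + h x)" by (auto simp: g_def h_def algebra_simps)
    moreover have "punctured_error \<alpha> (\<lambda>x. g x + h x) = punctured_error \<alpha> g + punctured_error \<alpha> h"
      by (rule punctured_error_add[OF gi hi, of R']) (use g_out h_out in \<open>simp_all add: R'_def\<close>)
    ultimately have "punctured_error \<alpha> f = punctured_error \<alpha> g + punctured_error \<alpha> h"
      by simp
    moreover have "\<bar>\<integral>x. g x \<partial>lborel\<bar> \<le> 2 ^ Suc k * C * A * J"
      unfolding J_def by (rule symbol_integrable(2)[OF gs m' _ N0]) (use g_out in simp)
    moreover have "\<bar>\<Sum>\<^sub>\<infinity>z\<in>- {0}. g (lattice_pt z - \<alpha>)\<bar> \<le> 2 ^ Suc k * C * A * N ^ Suc k * W"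
    proof -
      let ?F = "{z. norm (lattice_pt z - \<alpha>) < N} - {0}"
      let ?w = "\<lambda>z. if norm (- \<alpha> + lattice_pt z) < 1 / 2 then 0 else norm (- \<alpha> + lattice_pt z) powr s"
      have F: "finite ?F" using finite_lattice_norm_less[of "- \<alpha>" N] by simp
      have summand: "\<bar>g (lattice_pt z - \<alpha>)\<bar> \<le> 2 ^ Suc k * C * A * N ^ Suc k * ?w z" if z: "z \<in> ?F" for z
      proof -
        obtain i where "z $ i \<noteq> 0" using z by (auto simp: vec_eq_iff)
        then have "\<bar>real_of_int (z $ i)\<bar> \<ge> 1" by linarith
        moreover have "\<bar>\<alpha> $ i\<bar> \<le> 1 / 2" using component_le_infnorm_cart[of \<alpha> i] \<alpha> by linarith
        ultimately have "\<bar>(lattice_pt z - \<alpha>) $ i\<bar> \<ge> 1 / 2"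
          unfolding vector_minus_component lattice_pt_nth by linarith
        then have half: "norm (lattice_pt z - \<alpha>) \<ge> 1 / 2"
          using component_le_norm_cart[of "lattice_pt z - \<alpha>" i] by linarith
        then have nz: "lattice_pt z - \<alpha> \<noteq> 0" by auto
        let ?r = "norm (lattice_pt z - \<alpha>)"
        have r: "0 < ?r" "?r \<le> N" using nz z by auto
        have "?r powr m = ?r ^ Suc k * ?r powr s"
          using r(1) by (simp add: s_def powr_realpow[symmetric] powr_add[symmetric] del: power_Suc)
        also have "\<dots> \<le> N ^ Suc k * ?r powr s"
          using r by (intro mult_right_mono power_mono) auto
        finally have "2 ^ Suc k * C * A * ?r powr m \<le> 2 ^ Suc k * C * A * (N ^ Suc k * ?r powr s)"
          using C0 A0 by (intro mult_left_mono) auto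
        with symbol_bound[OF gs nz]
        have "\<bar>g (lattice_pt z - \<alpha>)\<bar> \<le> 2 ^ Suc k * C * A * (N ^ Suc k * ?r powr s)" by linarith
        then show ?thesis using half by (simp add: mult.assoc add.commute[of "- \<alpha>"])
      qed
      have "(\<Sum>\<^sub>\<infinity>z\<in>- {0}. g (lattice_pt z - \<alpha>)) = (\<Sum>z\<in>?F. g (lattice_pt z - \<alpha>))"
        by (rule punctured_sum_eq) (use g_out in simp)
      also have "\<bar>\<dots>\<bar> \<le> (\<Sum>z\<in>?F. \<bar>g (lattice_pt z - \<alpha>)\<bar>)" by (rule sum_abs)
      also have "\<dots> \<le> (\<Sum>z\<in>?F. 2 ^ Suc k * C * A * N ^ Suc k * ?w z)"
        by (intro sum_mono summand)
      also have "\<dots> \<le> 2 ^ Suc k * C * A * N ^ Suc k * W"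
        unfolding sum_distrib_left[symmetric]
        by (rule mult_left_mono[OF W(2)[OF F]]) (use C0 A0 N0 in auto)
      finally show ?thesis .
    qed
    moreover have "\<bar>punctured_error \<alpha> h\<bar> \<le> 2 * real CARD('n) * (2 ^ Suc k * C * (1 + A) * W)"
    proof -
      have "periodization h (- \<alpha>) = (\<Sum>\<^sub>\<infinity>z\<in>- {0}. h (lattice_pt z - \<alpha>))"
        unfolding periodization_def using h_in[of "- \<alpha>"] \<alpha>
        by (intro infsum_cong_neutral) (auto simp: infnorm_neg)
      moreover have "\<bar>(\<integral>x. h x \<partial>lborel) - periodization h (- \<alpha>)\<bar>
          \<le> 2 * real CARD('n) * (2 ^ Suc k * C * (1 + A) * W)"
      proof (rule smooth_quadrature_error[where \<delta> = "1 / 2" and R = R', OF _ hs])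
        show "(\<Sum>z\<in>F. if norm (x + lattice_pt z) < 1 / 2 then 0
            else norm (x + lattice_pt z) powr (m - real (Suc k))) \<le> W"
          if "finite F" for x :: "real^'n" and F using W(2)[OF that] by (simp only: s_def)
        show "\<bar>(- \<alpha>) $ i\<bar> \<le> 1" for i using component_le_infnorm_cart[of \<alpha> i] \<alpha> by simp
      qed (use h_in' h_out hi in auto)
      ultimately show ?thesis by (simp add: punctured_error_def)
    qed
    ultimately have "\<bar>punctured_error \<alpha> f\<bar> \<le> 2 ^ Suc k * C * A * J + 2 ^ Suc k * C * A * N ^ Suc k * W
        + 2 * real CARD('n) * (2 ^ Suc k * C * (1 + A) * W)"
      unfolding punctured_error_def[of \<alpha> g] by linarith
    then show ?thesis by (simp add: K_def algebra_simps)
  qed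
  moreover have "K \<ge> 0" using A0 J0 W(1) N0 unfolding K_def by (intro add_nonneg_nonneg mult_nonneg_nonneg) auto
  ultimately show ?thesis by blast
qed

section \<open>Taylor expansion with symbol bounds on the remainder\<close>

text \<open>The coefficient functions of Hadamard's lemma. The weight \<open>t ^ j\<close> closes the family under
  differentiation.\<close>
definition radial_mean :: "nat \<Rightarrow> ('a::euclidean_space \<Rightarrow> real) \<Rightarrow> 'a \<Rightarrow> real"
  where "radial_mean j f x = integral (cbox 0 1) (\<lambda>t. t ^ j * f (t *\<^sub>R x))"

lemma radial_mean_continuous:
  assumes "continuous_on UNIV f"
  shows "continuous_on UNIV (radial_mean j f)"
  unfolding radial_mean_def
proof (rule integral_continuous_on_param)
  show "continuous_on (UNIV \<times> cbox 0 1) (\<lambda>(x, t). t ^ j * f (t *\<^sub>R x))"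
    unfolding split_beta
    by (intro continuous_intros continuous_on_compose2[OF assms]) auto
qed

lemma continuous_dilated_integrand:
  fixes f :: "'a::euclidean_space \<Rightarrow> real"
  assumes "continuous_on UNIV f"
  shows "continuous_on A (\<lambda>t. t ^ j * f (t *\<^sub>R x))"
  by (intro continuous_intros continuous_on_compose2[OF assms]) auto

lemma radial_mean_bound:
  fixes f :: "'a::euclidean_space \<Rightarrow> real"
  assumes "continuous_on UNIV f" "\<And>x. \<bar>f x\<bar> \<le> B"
  shows "\<bar>radial_mean j f x\<bar> \<le> B"
proof -
  have "B \<ge> 0" using assms(2) abs_ge_zero order_trans by blast
  have "(\<lambda>t. t ^ j * f (t *\<^sub>R x)) integrable_on cbox 0 (1::real)"
    by (intro integrable_continuous continuous_dilated_integrand assms(1))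
  then have int: "((\<lambda>t. t ^ j * f (t *\<^sub>R x)) has_integral radial_mean j f x) (cbox 0 1)"
    unfolding radial_mean_def by (rule integrable_integral)
  have "norm (radial_mean j f x) \<le> B * measure lborel (cbox 0 (1::real))"
  proof (rule has_integral_bound[OF \<open>B \<ge> 0\<close> int])
    fix t :: real assume "t \<in> cbox 0 1"
    then have "\<bar>t ^ j\<bar> * \<bar>f (t *\<^sub>R x)\<bar> \<le> 1 * B"
      by (intro mult_mono assms(2)) (auto simp: power_le_one)
    then show "norm (t ^ j * f (t *\<^sub>R x)) \<le> B" by (simp add: abs_mult)
  qed
  then show ?thesis by simp
qed

text \<open>Differentiation under the integral sign.\<close>
lemma radial_mean_deriv:
  fixes f :: "'a::euclidean_space \<Rightarrow> real"
  assumes f: "\<And>x. f differentiable (at x)" "\<And>b. b \<in> Basis \<Longrightarrow> continuous_on UNIV (dir_deriv b f)"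
  shows "radial_mean j f differentiable (at x)"
    and "b \<in> Basis \<Longrightarrow> dir_deriv b (radial_mean j f) x = radial_mean (Suc j) (dir_deriv b f) x"
proof -
  define G :: "'a \<Rightarrow> real \<Rightarrow> 'a \<Rightarrow>\<^sub>L real" where
    "G x t = (\<Sum>b\<in>Basis. (t ^ Suc j * dir_deriv b f (t *\<^sub>R x)) *\<^sub>R blinfun_inner_left b)" for x t
  have G: "blinfun_apply (G x t) u = t ^ j * frechet_derivative f (at (t *\<^sub>R x)) (t *\<^sub>R u)" for x t u
    by (subst frechet_derivative_Basis_sum[OF f(1)])
      (simp add: G_def blinfun.sum_left blinfun.scaleR_left sum_distrib_left algebra_simps)
  have fc: "continuous_on UNIV f"
    using f(1) by (auto intro!: continuous_at_imp_continuous_on differentiable_imp_continuous_within)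
  have Gc: "continuous_on (UNIV \<times> cbox 0 1) (\<lambda>(x, t). G x t)"
    unfolding G_def split_beta
    by (intro continuous_intros continuous_on_compose2[OF f(2)]) auto
  have d: "(radial_mean j f has_derivative integral (cbox 0 1) (G x)) (at x within UNIV)"
    unfolding radial_mean_def[abs_def]
  proof (rule leibniz_rule[OF _ _ Gc])
    fix x :: 'a and t :: real
    have "((\<lambda>x. t *\<^sub>R x) has_derivative (\<lambda>u. t *\<^sub>R u)) (at x)" by (auto intro!: derivative_eq_intros)
    from diff_chain_at[OF this, where g = f]
    have "((\<lambda>x. f (t *\<^sub>R x)) has_derivative (\<lambda>u. frechet_derivative f (at (t *\<^sub>R x)) (t *\<^sub>R u))) (at x)"
      using f(1)[of "t *\<^sub>R x"] by (simp add: o_def frechet_derivative_works)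
    from has_derivative_mult_right[OF this, of "t ^ j"]
    show "((\<lambda>x. t ^ j * f (t *\<^sub>R x)) has_derivative blinfun_apply (G x t)) (at x within UNIV)"
      unfolding G .
    show "(\<lambda>t. t ^ j * f (t *\<^sub>R x)) integrable_on cbox 0 1" for x
      by (intro integrable_continuous continuous_dilated_integrand fc)
  qed auto
  then show "radial_mean j f differentiable (at x)" by (auto simp: differentiable_def)
  have "continuous_on (cbox 0 1) (G x)"
  proof -
    have "continuous_on (cbox 0 1) (\<lambda>t. (\<lambda>(x, t). G x t) (x, t))"
      by (rule continuous_on_compose2[OF Gc], intro continuous_on_Pair continuous_on_const continuous_on_id) auto
    then show ?thesis by simp
  qed
  then have int: "G x integrable_on cbox 0 1" by (rule integrable_continuous)
  show "dir_deriv b (radial_mean j f) x = radial_mean (Suc j) (dir_deriv b f) x" if b: "b \<in> Basis"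
  proof -
    have "dir_deriv b (radial_mean j f) x = blinfun_apply (integral (cbox 0 1) (G x)) b"
      using d by (intro dir_deriv_eq) simp
    also have "\<dots> = integral (cbox 0 1) (\<lambda>t. blinfun_apply (G x t) b)"
      using integral_linear[OF int blinfun.bounded_linear_left[of b]] by (simp add: o_def)
    also have "\<dots> = radial_mean (Suc j) (dir_deriv b f) x"
      unfolding radial_mean_def G
      using linear_frechet_derivative[OF f(1)] by (simp add: linear_cmul ac_simps)
    finally show ?thesis .
  qed
qed

lemma bounded_derivs_radial_mean:
  fixes f :: "'a::euclidean_space \<Rightarrow> real"
  assumes "bounded_derivs k B f"
  shows "bounded_derivs k B (radial_mean j f)"
  using assms
proof (induction k arbitrary: f j)
  case 0
  then show ?case using radial_mean_bound[of f B j] radial_mean_continuous[of f j] by auto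
next
  case (Suc k)
  have f: "f differentiable (at x)" for x using Suc.prems by simp
  have fb: "continuous_on UNIV (dir_deriv b f)" if "b \<in> Basis" for b
    using Suc.prems that bounded_derivs_continuous by (metis bounded_derivs.simps(2))
  have "bounded_derivs k B (dir_deriv b (radial_mean j f))" if b: "b \<in> Basis" for b
  proof -
    have "dir_deriv b (radial_mean j f) = radial_mean (Suc j) (dir_deriv b f)"
      by (rule ext, rule radial_mean_deriv(2)) (use f fb b in auto)
    then show ?thesis using Suc.IH Suc.prems b by simp
  qed
  moreover have "\<bar>radial_mean j f x\<bar> \<le> B" for x
    using radial_mean_bound[OF bounded_derivs_continuous[OF Suc.prems] bounded_derivs_bound[OF Suc.prems]] .
  moreover have "radial_mean j f differentiable (at x)" for x
    by (rule radial_mean_deriv(1)) (use f fb in auto)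
  ultimately show ?case by auto
qed

text \<open>Hadamard's lemma, from the fundamental theorem of calculus on the segment from \<open>0\<close> to \<open>x\<close>.\<close>
lemma hadamard:
  fixes f :: "'a::euclidean_space \<Rightarrow> real"
  assumes f: "\<And>x. f differentiable (at x)" "\<And>b. b \<in> Basis \<Longrightarrow> continuous_on UNIV (dir_deriv b f)"
  shows "f x = f 0 + (\<Sum>b\<in>Basis. (x \<bullet> b) * radial_mean 0 (dir_deriv b f) x)"
proof -
  have "((\<lambda>t. f (t *\<^sub>R x)) has_vector_derivative (\<Sum>b\<in>Basis. (x \<bullet> b) * dir_deriv b f (t *\<^sub>R x)))
      (at t within {0..1})" for t
  proof -
    have "((\<lambda>t. t *\<^sub>R x) has_derivative (\<lambda>h. h *\<^sub>R x)) (at t)" by (auto intro!: derivative_eq_intros)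
    from diff_chain_at[OF this, where g = f]
    have "((\<lambda>t. f (t *\<^sub>R x)) has_derivative (\<lambda>h. frechet_derivative f (at (t *\<^sub>R x)) (h *\<^sub>R x))) (at t)"
      using f(1)[of "t *\<^sub>R x"] by (simp add: o_def frechet_derivative_works)
    moreover have "frechet_derivative f (at (t *\<^sub>R x)) (h *\<^sub>R x)
        = h *\<^sub>R (\<Sum>b\<in>Basis. (x \<bullet> b) * dir_deriv b f (t *\<^sub>R x))" for h
      unfolding frechet_derivative_Basis_sum[OF f(1), of "t *\<^sub>R x" x, symmetric]
      by (rule linear_cmul[OF linear_frechet_derivative[OF f(1)]])
    ultimately show ?thesis
      by (auto simp: has_vector_derivative_def intro: has_derivative_at_withinI)
  qed
  from fundamental_theorem_of_calculus[OF _ this]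
  have "((\<lambda>t. \<Sum>b\<in>Basis. (x \<bullet> b) * dir_deriv b f (t *\<^sub>R x)) has_integral f x - f 0) (cbox 0 1)"
    by simp
  moreover have "((\<lambda>t. \<Sum>b\<in>Basis. (x \<bullet> b) * dir_deriv b f (t *\<^sub>R x)) has_integral
      (\<Sum>b\<in>Basis. (x \<bullet> b) * radial_mean 0 (dir_deriv b f) x)) (cbox 0 1)"
  proof (intro has_integral_sum has_integral_mult_right finite_Basis)
    fix b :: 'a assume "b \<in> Basis"
    then have "(\<lambda>t. t ^ 0 * dir_deriv b f (t *\<^sub>R x)) integrable_on cbox 0 1"
      by (intro integrable_continuous continuous_dilated_integrand f(2))
    then show "((\<lambda>t. dir_deriv b f (t *\<^sub>R x)) has_integral radial_mean 0 (dir_deriv b f) x) (cbox 0 1)"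
      unfolding radial_mean_def using integrable_integral by fastforce
  qed
  ultimately have "f x - f 0 = (\<Sum>b\<in>Basis. (x \<bullet> b) * radial_mean 0 (dir_deriv b f) x)"
    by (rule has_integral_unique)
  then show ?thesis by simp
qed

lemma bounded_derivs_translate:
  fixes f :: "'a::euclidean_space \<Rightarrow> real"
  assumes "bounded_derivs k B f"
  shows "bounded_derivs k B (\<lambda>x. f (c + x))"
  using assms
proof (induction k arbitrary: f)
  case 0
  then show ?case by (auto intro!: continuous_on_compose2[of UNIV f] continuous_intros)
next
  case (Suc k)
  have d: "((\<lambda>x. f (c + x)) has_derivative (\<lambda>u. dir_deriv u f (c + x))) (at x)" for x
  proof -
    have "((\<lambda>x. c + x) has_derivative (\<lambda>u. u)) (at x)" by (auto intro!: derivative_eq_intros)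
    from diff_chain_at[OF this, where g = f] show ?thesis
      using Suc.prems by (simp add: o_def frechet_derivative_works)
  qed
  have "bounded_derivs k B (dir_deriv b (\<lambda>x. f (c + x)))" if "b \<in> Basis" for b
  proof -
    have "dir_deriv b (\<lambda>x. f (c + x)) = (\<lambda>x. dir_deriv b f (c + x))"
      by (intro ext dir_deriv_eq d)
    then show ?thesis using Suc.IH[of "dir_deriv b f"] Suc.prems that by simp
  qed
  then show ?case using Suc.prems d by (auto simp: differentiable_def)
qed

lemma finite_multi_indices_less: "finite {\<beta> :: nat^'n. mi_order \<beta> < q}"
proof -
  have "{\<beta> :: nat^'n. mi_order \<beta> < q} = (\<Union>j<q. {\<beta>. mi_order \<beta> = j})" by auto
  then show ?thesis using card_multi_indices_eq[where ?'n = 'n] by simp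
qed

lemma monomial_0 [simp]: "monomial 0 x = 1"
  by (simp add: monomial_def)

lemma mi_order_0 [simp]: "mi_order 0 = 0"
  by (simp add: mi_order_def)

lemma mi_order_add_axis:
  fixes \<beta> :: "nat^'n"
  shows "mi_order (\<beta> + axis i 1) = Suc (mi_order \<beta>)"
proof -
  have "(\<Sum>k\<in>UNIV. (axis i 1 :: nat^'n) $ k) = 1"
    by (simp add: axis_def sum.delta)
  then show ?thesis by (simp add: mi_order_def sum.distrib)
qed

lemma monomial_add_axis:
  fixes \<beta> :: "nat^'n"
  shows "monomial (\<beta> + axis i 1) x = x $ i * monomial \<beta> x"
proof -
  have "(\<Prod>k\<in>UNIV. (x $ k) ^ ((axis i 1 :: nat^'n) $ k)) = x $ i"
    by (simp add: axis_def prod.delta if_distrib[of "\<lambda>e. _ ^ e"] cong: if_cong)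
  then show ?thesis by (simp add: monomial_def power_add prod.distrib mult.commute)
qed

lemma symbol_coordinate: "\<exists>C. symbol k 1 C (\<lambda>x :: real^'n. x $ i)"
  by (rule symbol_homogeneous) (auto intro!: Ck_on_bounded_linear bounded_linear_vec_nth)

text \<open>Hadamard's lemma is applied recursively to the coefficient functions. The constants are
  uniform in the parameter \<open>h\<close> of the family.\<close>
lemma taylor_family:
  fixes F :: "'i \<Rightarrow> real^'n \<Rightarrow> real"
  assumes "\<And>k. \<exists>B. \<forall>h. bounded_derivs k B (F h)"
  shows "\<exists>a r. (\<forall>h x. F h x = (\<Sum>\<beta> | mi_order \<beta> < q. a \<beta> h * monomial \<beta> x) + r h x) \<and>
    (\<forall>\<beta>. \<exists>A. \<forall>h. \<bar>a \<beta> h\<bar> \<le> A) \<and> (q > 0 \<longrightarrow> (\<forall>h. r h 0 = 0)) \<and>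
    (\<forall>\<eta>\<in>Cc_infinity UNIV. \<forall>k. \<exists>C. \<forall>h. symbol k (real q) C (\<lambda>x. \<eta> x * r h x))"
  using assms
proof (induction q arbitrary: F)
  case 0
  have "\<forall>\<eta>\<in>Cc_infinity UNIV. \<forall>k. \<exists>C. \<forall>h. symbol k 0 C (\<lambda>x. \<eta> x * F h x)"
  proof (intro ballI allI)
    fix \<eta> :: "real^'n \<Rightarrow> real" and k
    assume \<eta>: "\<eta> \<in> Cc_infinity UNIV"
    obtain B where "\<forall>h. bounded_derivs k B (F h)" using 0 by blast
    moreover obtain C where "\<forall>f. bounded_derivs k B f \<longrightarrow> symbol k 0 C (\<lambda>x. \<eta> x * f x)"
      using symbol_cutoff_mult[OF \<eta>, of 0 k B] by auto
    ultimately show "\<exists>C. \<forall>h. symbol k 0 C (\<lambda>x. \<eta> x * F h x)" by blast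
  qed
  then show ?case by (intro exI[of _ "\<lambda>_ _. 0"] exI[of _ F]) auto
next
  case (Suc q)
  define G where "G i h = radial_mean 0 (dir_deriv (axis i 1) (F h))" for i h
  have G: "\<exists>B. \<forall>h. bounded_derivs k B (G i h)" for i k
  proof -
    obtain B where "\<And>h. bounded_derivs (Suc k) B (F h)" using Suc.prems by blast
    then have "bounded_derivs k B (G i h)" for h
      unfolding G_def by (intro bounded_derivs_radial_mean) (simp add: axis_in_Basis_iff)
    then show ?thesis by blast
  qed
  have F: "F h x = F h 0 + (\<Sum>i\<in>UNIV. x $ i * G i h x)" for h x
  proof -
    obtain B where "\<And>h. bounded_derivs (Suc (Suc 0)) B (F h)" using Suc.prems by blast
    then have d: "F h differentiable (at x)" and
      c: "b \<in> Basis \<Longrightarrow> continuous_on UNIV (dir_deriv b (F h))" for x b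
      using bounded_derivs_continuous[of "Suc 0"] by (simp, metis bounded_derivs.simps(2))
    have "inj (\<lambda>i. axis i 1 :: real^'n)" by (auto simp: inj_def axis_eq_axis)
    moreover have "(Basis :: (real^'n) set) = range (\<lambda>i. axis i 1)" by (auto simp: Basis_vec_def)
    ultimately have "(\<Sum>b\<in>Basis. g b) = (\<Sum>i\<in>UNIV. g (axis i 1))" for g :: "real^'n \<Rightarrow> real"
      using sum.reindex[of "\<lambda>i. axis i 1 :: real^'n" UNIV g] by (simp add: o_def)
    moreover have "F h x = F h 0 + (\<Sum>b\<in>Basis. (x \<bullet> b) * radial_mean 0 (dir_deriv b (F h)) x)"
      by (rule hadamard) (use d c in auto)
    ultimately show ?thesis by (simp add: inner_axis G_def)
  qed
  define P where "P i a r \<longleftrightarrow> (\<forall>h x. G i h x = (\<Sum>\<beta> | mi_order \<beta> < q. a \<beta> h * monomial \<beta> x) + r h x) \<and>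
    (\<forall>\<beta>. \<exists>A. \<forall>h. \<bar>a \<beta> h\<bar> \<le> A) \<and> (q > 0 \<longrightarrow> (\<forall>h. r h 0 = 0)) \<and>
    (\<forall>\<eta>\<in>Cc_infinity UNIV. \<forall>k. \<exists>C. \<forall>h. symbol k (real q) C (\<lambda>x. \<eta> x * r h x))" for i a r
  have "\<exists>a r. P i a r" for i
    unfolding P_def by (rule Suc.IH[OF G])
  then obtain a r where P: "\<And>i. P i (a i) (r i)" by metis
  have ar: "\<And>i h x. G i h x = (\<Sum>\<beta> | mi_order \<beta> < q. a i \<beta> h * monomial \<beta> x) + r i h x"
    and a: "\<And>i \<beta>. \<exists>A. \<forall>h. \<bar>a i \<beta> h\<bar> \<le> A"
    and r: "\<And>i \<eta> k. \<eta> \<in> Cc_infinity UNIV \<Longrightarrow> \<exists>C. \<forall>h. symbol k (real q) C (\<lambda>x. \<eta> x * r i h x)"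
    using P unfolding P_def by blast+
  let ?S = "\<lambda>q. {\<beta> :: nat^'n. mi_order \<beta> < q}"
  define a' where "a' \<beta>' h = (if \<beta>' = 0 then F h 0 else 0)
      + (\<Sum>i\<in>UNIV. \<Sum>\<beta>\<in>?S q. if \<beta> + axis i 1 = \<beta>' then a i \<beta> h else 0)" for \<beta>' h
  define r' where "r' h x = (\<Sum>i\<in>UNIV. x $ i * r i h x)" for h x
  have fin: "finite (?S q)" for q by (rule finite_multi_indices_less)
  have t1: "F h x = (\<Sum>\<beta>\<in>?S (Suc q). a' \<beta> h * monomial \<beta> x) + r' h x" for h x
  proof -
    have "(\<Sum>\<beta>'\<in>?S (Suc q). a' \<beta>' h * monomial \<beta>' x) =
        (\<Sum>\<beta>'\<in>?S (Suc q). (if \<beta>' = 0 then F h 0 else 0) * monomial \<beta>' x)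
        + (\<Sum>\<beta>'\<in>?S (Suc q). \<Sum>i\<in>UNIV. \<Sum>\<beta>\<in>?S q. (if \<beta> + axis i 1 = \<beta>' then a i \<beta> h else 0) * monomial \<beta>' x)"
      by (simp add: a'_def distrib_right sum.distrib sum_distrib_right)
    also have "(\<Sum>\<beta>'\<in>?S (Suc q). (if \<beta>' = 0 then F h 0 else 0) * monomial \<beta>' x) = F h 0"
      using sum.delta[OF fin, of 0 "\<lambda>_. F h 0" "Suc q"]
      by (simp add: if_distrib[of "\<lambda>t. t * _"] sum.delta[OF fin] cong: if_cong)
    also have "(\<Sum>\<beta>'\<in>?S (Suc q). \<Sum>i\<in>UNIV. \<Sum>\<beta>\<in>?S q. (if \<beta> + axis i 1 = \<beta>' then a i \<beta> h else 0) * monomial \<beta>' x)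
        = (\<Sum>i\<in>UNIV. \<Sum>\<beta>\<in>?S q. \<Sum>\<beta>'\<in>?S (Suc q). (if \<beta> + axis i 1 = \<beta>' then a i \<beta> h else 0) * monomial \<beta>' x)"
      by (rule trans[OF sum.swap]) (intro sum.cong refl sum.swap)
    also have "\<dots> = (\<Sum>i\<in>UNIV. \<Sum>\<beta>\<in>?S q. a i \<beta> h * monomial (\<beta> + axis i 1) x)"
      by (intro sum.cong refl)
        (simp add: if_distrib[of "\<lambda>t. t * _"] sum.delta'[OF fin] mi_order_add_axis[unfolded One_nat_def] cong: if_cong)
    also have "\<dots> = (\<Sum>i\<in>UNIV. x $ i * (\<Sum>\<beta>\<in>?S q. a i \<beta> h * monomial \<beta> x))"
      by (simp only: monomial_add_axis sum_distrib_left ac_simps)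
    finally show ?thesis
      using F[of h x] by (simp add: ar r'_def distrib_left sum.distrib)
  qed
  have t2: "\<exists>A. \<forall>h. \<bar>a' \<beta>' h\<bar> \<le> A" for \<beta>'
  proof -
    obtain B where B: "\<And>h. bounded_derivs 0 B (F h)" using Suc.prems by blast
    obtain A where A: "\<And>i \<beta> h. \<bar>a i \<beta> h\<bar> \<le> A i \<beta>" using a by metis
    have "\<bar>a' \<beta>' h\<bar> \<le> B + (\<Sum>i\<in>UNIV. \<Sum>\<beta>\<in>?S q. A i \<beta>)" for h
      unfolding a'_def
    proof (intro order_trans[OF abs_triangle_ineq] add_mono order_trans[OF sum_abs] sum_mono)
      have "\<bar>F h 0\<bar> \<le> B" using B by simp
      then show "\<bar>if \<beta>' = 0 then F h 0 else 0\<bar> \<le> B" by auto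
      show "\<bar>if \<beta> + axis i 1 = \<beta>' then a i \<beta> h else 0\<bar> \<le> A i \<beta>" for i \<beta>
        using A[where i = i and \<beta> = \<beta> and h = h] by auto
    qed
    then show ?thesis by blast
  qed
  have t3: "r' h 0 = 0" for h by (simp add: r'_def)
  have t4: "\<exists>C. \<forall>h. symbol k (real (Suc q)) C (\<lambda>x. \<eta> x * r' h x)"
    if \<eta>: "\<eta> \<in> Cc_infinity UNIV" for \<eta> k
  proof -
    obtain C where C: "\<And>i h. symbol k (real q) (C i) (\<lambda>x. \<eta> x * r i h x)" using r[OF \<eta>] by metis
    have "\<exists>D. \<forall>i. symbol k 1 (D i) (\<lambda>x :: real^'n. x $ i)"
      by (intro choice allI symbol_coordinate)
    then obtain D where D: "\<And>i. symbol k 1 (D i) (\<lambda>x :: real^'n. x $ i)" by blast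
    have "symbol k (1 + real q) (\<Sum>i\<in>UNIV. 2 ^ k * D i * C i) (\<lambda>x. \<Sum>i\<in>UNIV. x $ i * (\<eta> x * r i h x))" for h
      by (intro symbol_sum symbol_mult C D) simp
    moreover have "(\<Sum>i\<in>UNIV. x $ i * (\<eta> x * r i h x)) = \<eta> x * r' h x" for x h
      by (simp add: r'_def sum_distrib_left ac_simps)
    ultimately have "symbol k (real (Suc q)) (\<Sum>i\<in>UNIV. 2 ^ k * D i * C i) (\<lambda>x. \<eta> x * r' h x)" for h
      by simp
    then show ?thesis by blast
  qed
  show ?case
    by (intro exI[of _ a'] exI[of _ r'] conjI allI impI ballI) (rule t1 t2 t3 | (rule t4, assumption))+
qed

section \<open>Cutoff functions and the correction weights\<close>

text \<open>Extension by zero: \<open>U\<close> and the complement of the support cover the space.\<close>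
lemma Cc_infinity_subset_UNIV:
  fixes v :: "'a::euclidean_space \<Rightarrow> real"
  assumes "v \<in> Cc_infinity U" "open U"
  shows "v \<in> Cc_infinity UNIV"
proof -
  let ?K = "closure {x. v x \<noteq> 0}"
  have v: "smooth_on U v" "compact ?K" "?K \<subseteq> U" using assms by (auto simp: Cc_infinity_def)
  have "Ck_on k UNIV v" for k
  proof (rule Ck_on_local)
    fix x
    have "Ck_on k (- ?K) v \<longleftrightarrow> Ck_on k (- ?K) (\<lambda>y. 0 :: real)"
      by (rule Ck_on_cong) (use closure_subset[of "{x. v x \<noteq> 0}"] in auto)
    then have "Ck_on k (- ?K) v" by (simp add: Ck_on_const)
    moreover have "Ck_on k U v" using v by (simp add: smooth_on_def)
    moreover have "x \<in> U \<or> x \<in> - ?K" using v(3) by auto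
    ultimately show "\<exists>U. open U \<and> x \<in> U \<and> Ck_on k U v"
      using assms(2) by (metis closed_closure open_Compl)
  qed
  then show ?thesis using v(2) by (simp add: Cc_infinity_def smooth_on_def)
qed

lemma Ck_on_scale:
  fixes f :: "'a::euclidean_space \<Rightarrow> real"
  assumes "Ck_on k UNIV f"
  shows "Ck_on k UNIV (\<lambda>x. f (t *\<^sub>R x))"
proof (rule Ck_on_compose[OF open_UNIV assms])
  show "Ck_on k UNIV (\<lambda>x. (t *\<^sub>R x) \<bullet> b)" for b :: 'a
    by (intro Ck_on_bounded_linear bounded_linear_inner_left_comp bounded_linear_scaleR_right)
qed auto

lemma Ck_on_monomial:
  fixes \<beta> :: "nat^'n"
  shows "Ck_on k UNIV (monomial \<beta>)"
proof -
  have "Ck_on k UNIV (\<lambda>x :: real^'n. \<Prod>i\<in>UNIV. \<Prod>j<\<beta> $ i. x $ i)"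
    by (intro Ck_on_prod Ck_on_bounded_linear bounded_linear_vec_nth) auto
  then show ?thesis by (simp add: monomial_def[abs_def])
qed

lemma monomial_scaleR: "monomial \<beta> (t *\<^sub>R x) = t ^ mi_order \<beta> * monomial \<beta> x"
  by (simp add: monomial_def mi_order_def power_mult_distrib prod.distrib power_sum)

lemma sing_fun_scaleR:
  assumes "t > 0"
  shows "sing_fun \<gamma> l (t *\<^sub>R x) = t powr \<gamma> * sing_fun \<gamma> l x"
proof -
  have "(t *\<^sub>R x) /\<^sub>R norm (t *\<^sub>R x) = x /\<^sub>R norm x" using assms by simp
  then show ?thesis using assms unfolding sing_fun_def by (simp only:) (simp add: powr_mult)
qed

lemma symbol_sing_fun_monomial:
  fixes l :: "real^'n \<Rightarrow> real"
  assumes "smooth_on_submanifold (sphere 0 1) l"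
  shows "\<exists>C. symbol k (\<gamma> + real (mi_order \<beta>)) C (\<lambda>x. sing_fun \<gamma> l x * monomial \<beta> x)"
proof (rule symbol_homogeneous)
  show "Ck_on k (- {0}) (\<lambda>x. sing_fun \<gamma> l x * monomial \<beta> x)"
    by (intro Ck_on_mult Ck_on_sing_fun assms Ck_on_subset[OF Ck_on_monomial]) auto
  show "sing_fun \<gamma> l (t *\<^sub>R x) * monomial \<beta> (t *\<^sub>R x)
      = t powr (\<gamma> + real (mi_order \<beta>)) * (sing_fun \<gamma> l x * monomial \<beta> x)"
    if "t > 0" "x \<noteq> 0" for t x
    using that by (simp add: sing_fun_scaleR monomial_scaleR powr_add powr_realpow)
qed

lemma symbol_sing_fun:
  fixes l :: "real^'n \<Rightarrow> real"
  assumes "smooth_on_submanifold (sphere 0 1) l"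
  shows "\<exists>C. symbol k \<gamma> C (sing_fun \<gamma> l)"
  using symbol_sing_fun_monomial[OF assms, of k \<gamma> 0] by simp

text \<open>The affine substitution \<open>x \<mapsto> h *\<^sub>R \<alpha> + h *\<^sub>R x\<close> maps the shifted unit lattice to the grid.\<close>
lemma trapezoid_error_eq_punctured_error:
  fixes f :: "real^'n \<Rightarrow> real"
  assumes "h > 0" and f: "f \<in> borel_measurable borel"
  shows "(\<integral>x. f (x - h *\<^sub>R \<alpha>) \<partial>lborel) - punctured_trapezoid h (\<lambda>x. f (x - h *\<^sub>R \<alpha>))
    = h ^ CARD('n) * punctured_error \<alpha> (\<lambda>x. f (h *\<^sub>R x))"
proof -
  have "(\<lambda>x. f (x - h *\<^sub>R \<alpha>)) \<in> borel_measurable borel"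
    using f by (rule measurable_compose[rotated]) simp
  from lborel_integral_affine[OF this, of h "h *\<^sub>R \<alpha>"]
  have 1: "(\<integral>x. f (x - h *\<^sub>R \<alpha>) \<partial>lborel) = h ^ CARD('n) * (\<integral>x. f (h *\<^sub>R x) \<partial>lborel)"
    using \<open>h > 0\<close> by simp
  have set: "{h *\<^sub>R lattice_pt z |z. z \<noteq> 0} = (\<lambda>z. h *\<^sub>R lattice_pt z) ` (- {0})" by auto
  have inj: "inj_on (\<lambda>z. h *\<^sub>R lattice_pt z :: real^'n) (- {0})"
    using \<open>h > 0\<close> inj_lattice_pt by (auto simp: inj_on_def)
  have "(\<Sum>\<^sub>\<infinity>y\<in>{h *\<^sub>R lattice_pt z |z. z \<noteq> 0}. f (y - h *\<^sub>R \<alpha>))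
      = (\<Sum>\<^sub>\<infinity>z\<in>- {0}. f (h *\<^sub>R (lattice_pt z - \<alpha>)))"
    unfolding set infsum_reindex[OF inj] by (simp add: o_def scaleR_diff_right)
  then show ?thesis
    using 1 by (simp add: punctured_trapezoid_def punctured_error_def right_diff_distrib)
qed

lemma convergent_of_rate:
  fixes A :: "real \<Rightarrow> real"
  assumes "\<And>\<epsilon> \<epsilon>'. 0 < \<epsilon>' \<Longrightarrow> \<epsilon>' \<le> \<epsilon> \<Longrightarrow> \<bar>A \<epsilon> - A \<epsilon>'\<bar> \<le> K * \<epsilon> powr N" "N > 0"
  shows "\<exists>l. \<forall>\<epsilon>>0. \<bar>A \<epsilon> - l\<bar> \<le> K * \<epsilon> powr N"
proof -
  define e where "e m = inverse (real (Suc m))" for m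
  have e0: "e m > 0" for m by (simp add: e_def)
  have elim: "e \<longlonglongrightarrow> 0" unfolding e_def by (rule LIMSEQ_inverse_real_of_nat)
  have "(\<lambda>m. K * e m powr N) \<longlonglongrightarrow> K * 0"
  proof (intro tendsto_mult tendsto_const)
    show "(\<lambda>m. e m powr N) \<longlonglongrightarrow> 0"
      using tendsto_powr'[OF elim tendsto_const[of N]] assms(2) e0 by (simp add: less_imp_le)
  qed
  then have lim: "(\<lambda>m. K * e m powr N) \<longlonglongrightarrow> 0" by simp
  have "Cauchy (\<lambda>m. A (e m))"
  proof (rule CauchyI')
    fix r :: real assume "r > 0"
    then have "eventually (\<lambda>m. K * e m powr N < r) sequentially" using lim order_tendstoD(2) by blast
    then obtain M where M: "\<And>m. m \<ge> M \<Longrightarrow> K * e m powr N < r" by (auto simp: eventually_sequentially)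
    have "dist (A (e m)) (A (e n)) < r" if "m \<ge> M" "n > m" for m n
    proof -
      have "e n \<le> e m" using that by (simp add: e_def field_simps)
      from assms(1)[OF e0 this] M[OF that(1)] show ?thesis by (simp add: dist_real_def)
    qed
    then show "\<exists>M. \<forall>m\<ge>M. \<forall>n>m. dist (A (e m)) (A (e n)) < r" by blast
  qed
  then obtain l where l: "(\<lambda>m. A (e m)) \<longlonglongrightarrow> l" using Cauchy_convergent convergent_def by blast
  have "\<bar>A \<epsilon> - l\<bar> \<le> K * \<epsilon> powr N" if "\<epsilon> > 0" for \<epsilon>
  proof (rule tendsto_upperbound)
    show "(\<lambda>m. \<bar>A \<epsilon> - A (e m)\<bar>) \<longlonglongrightarrow> \<bar>A \<epsilon> - l\<bar>" by (intro tendsto_intros l)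
    have "eventually (\<lambda>m. e m < \<epsilon>) sequentially" using elim that order_tendstoD(2) by blast
    then show "eventually (\<lambda>m. \<bar>A \<epsilon> - A (e m)\<bar> \<le> K * \<epsilon> powr N) sequentially"
      by eventually_elim (use assms(1)[OF e0] in \<open>simp add: less_imp_le\<close>)
  qed auto
  then show ?thesis by blast
qed

text \<open>The offset of the singularity from the grid, in units of the mesh size, and the reference cutoff.\<close>
locale lattice_cutoff =
  fixes \<alpha> :: "real^'n" and \<psi> :: "real^'n \<Rightarrow> real"
  assumes \<alpha>: "infnorm \<alpha> \<le> 1 / 2"
    and \<psi>: "\<psi> \<in> Cc_infinity UNIV" "\<And>x. infnorm x \<le> 3 / 4 \<Longrightarrow> \<psi> x = 1" "\<And>x. infnorm x \<ge> 1 \<Longrightarrow> \<psi> x = 0"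
begin

lemma \<psi>_eq_0: "norm x \<ge> real CARD('n) + 1 \<Longrightarrow> \<psi> x = 0"
  using \<psi>(3)[of x] infnorm_less_imp_norm_less[of x] by force

lemma \<psi>_eq_1: "norm x \<le> 3 / 4 \<Longrightarrow> \<psi> x = 1"
  using \<psi>(2)[of x] infnorm_le_norm[of x] by force

lemma \<psi>_scale_eq_0: "t > 0 \<Longrightarrow> norm x \<ge> (real CARD('n) + 1) / t \<Longrightarrow> \<psi> (t *\<^sub>R x) = 0"
  by (rule \<psi>_eq_0) (simp add: field_simps)

lemma \<psi>_scale_eq_1: "t > 0 \<Longrightarrow> norm x \<le> 3 / 4 / t \<Longrightarrow> \<psi> (t *\<^sub>R x) = 1"
  by (rule \<psi>_eq_1) (simp add: field_simps)

lemma \<psi>_scale_Cc_infinity: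
  assumes "t > 0"
  shows "(\<lambda>x. \<psi> (t *\<^sub>R x)) \<in> Cc_infinity UNIV"
proof (rule Cc_infinityI)
  show "Ck_on k UNIV (\<lambda>x. \<psi> (t *\<^sub>R x))" for k
    by (intro Ck_on_scale Cc_infinity_Ck_on \<psi>(1))
  show "\<psi> (t *\<^sub>R x) = 0" if "norm x > (real CARD('n) + 1) / t" for x
    by (rule \<psi>_scale_eq_0[OF assms less_imp_le[OF that]])
qed

text \<open>For \<open>\<epsilon>' \<le> \<epsilon>\<close> the difference of the two integrands lives where \<open>norm x\<close> exceeds a multiple of
  \<open>1 / \<epsilon>\<close>. It may thus be regarded as a symbol of order \<open>d + N\<close> with a constant proportional to
  \<open>\<epsilon> powr N\<close>, and the quadrature error is bounded by a multiple of that constant. Hence the error is Cauchy as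
  \<open>\<epsilon> \<rightarrow> 0\<close>.\<close>
lemma dilated_cutoff_error_converges:
  assumes F: "\<And>k. \<exists>C. symbol k d C F" and d: "d > - real CARD('n)" and N: "N > 0"
  shows "\<exists>E K. \<forall>\<epsilon>>0. \<bar>punctured_error \<alpha> (\<lambda>x. F x * \<psi> (\<epsilon> *\<^sub>R x)) - E\<bar> \<le> K * \<epsilon> powr N"
proof -
  define A where "A \<epsilon> = punctured_error \<alpha> (\<lambda>x. F x * \<psi> (\<epsilon> *\<^sub>R x))" for \<epsilon>
  have dN: "d + N > - real CARD('n)" using d N by simp
  obtain k K where K: "K \<ge> 0" "\<And>f C R. symbol (Suc k) (d + N) C f \<Longrightarrow> (\<forall>y. norm y \<ge> R \<longrightarrow> f y = 0) \<Longrightarrow>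
      \<bar>punctured_error \<alpha> f\<bar> \<le> K * C"
    using symbol_quadrature_error[OF \<alpha> dN \<psi>] by blast
  obtain C where C: "symbol (Suc k) d C F" using F by blast
  obtain B where B: "symbol (Suc k) 0 B \<psi>" using symbol_Cc_infinity[OF \<psi>(1), of 0] by blast
  have \<psi>s: "symbol (Suc k) 0 B (\<lambda>x. \<psi> (t *\<^sub>R x))" if "t > 0" for t
    using symbol_dilation[OF B that] that by simp
  let ?n = "real CARD('n) + 1"
  have int: "integrable lborel (\<lambda>x. F x * \<psi> (t *\<^sub>R x))" if "t > 0" for t
  proof (rule symbol_integrable(1))
    show "symbol (Suc k) d (2 ^ Suc k * C * B) (\<lambda>x. F x * \<psi> (t *\<^sub>R x))"
      using symbol_mult[OF C \<psi>s[OF that]] by simp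
    show "F y * \<psi> (t *\<^sub>R y) = 0" if "norm y \<ge> ?n / t" for y
      using \<psi>_scale_eq_0[OF \<open>t > 0\<close> that] by simp
  qed (use d that in auto)
  have "\<bar>A \<epsilon> - A \<epsilon>'\<bar> \<le> K * (2 ^ Suc k * C * (B + B)) * (3 / 4) powr (- N) * \<epsilon> powr N"
    if \<epsilon>: "0 < \<epsilon>'" "\<epsilon>' \<le> \<epsilon>" for \<epsilon> \<epsilon>'
  proof -
    have pos: "\<epsilon> > 0" using \<epsilon> by simp
    define f where "f x = F x * (\<psi> (\<epsilon> *\<^sub>R x) + - 1 * \<psi> (\<epsilon>' *\<^sub>R x))" for x
    have "symbol (Suc k) 0 (B + B) (\<lambda>x. \<psi> (\<epsilon> *\<^sub>R x) + - 1 * \<psi> (\<epsilon>' *\<^sub>R x))"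
      by (intro symbol_add \<psi>s pos symbol_cmult[OF \<psi>s[OF \<epsilon>(1)]]) simp
    from symbol_mult[OF C this] have f: "symbol (Suc k) d (2 ^ Suc k * C * (B + B)) f"
      by (simp add: f_def[abs_def])
    have "f x = 0" if x: "norm x < 3 / 4 / \<epsilon>" for x
    proof -
      have "3 / 4 / \<epsilon> \<le> 3 / 4 / \<epsilon>'" using \<epsilon> pos by (intro divide_left_mono) auto
      then show ?thesis
        using \<psi>_scale_eq_1[OF pos, of x] \<psi>_scale_eq_1[OF \<epsilon>(1), of x] x by (simp add: f_def)
    qed
    then have f': "symbol (Suc k) (d + N) (2 ^ Suc k * C * (B + B) * (3 / 4 / \<epsilon>) powr (- N)) f"
      using pos N by (intro symbol_raise_order f) auto
    have out: "\<psi> (\<epsilon> *\<^sub>R y) = 0" "\<psi> (\<epsilon>' *\<^sub>R y) = 0" if "norm y \<ge> ?n / \<epsilon>'" for y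
    proof -
      have "?n / \<epsilon> \<le> ?n / \<epsilon>'" using \<epsilon> pos by (intro divide_left_mono) auto
      then show "\<psi> (\<epsilon> *\<^sub>R y) = 0" "\<psi> (\<epsilon>' *\<^sub>R y) = 0"
        using that \<psi>_scale_eq_0[OF pos, of y] \<psi>_scale_eq_0[OF \<epsilon>(1), of y] by auto
    qed
    have "f = (\<lambda>x. F x * \<psi> (\<epsilon> *\<^sub>R x) + - 1 * (F x * \<psi> (\<epsilon>' *\<^sub>R x)))"
      by (auto simp: f_def algebra_simps)
    moreover have "punctured_error \<alpha> (\<lambda>x. F x * \<psi> (\<epsilon> *\<^sub>R x) + - 1 * (F x * \<psi> (\<epsilon>' *\<^sub>R x)))
        = A \<epsilon> + punctured_error \<alpha> (\<lambda>x. - 1 * (F x * \<psi> (\<epsilon>' *\<^sub>R x)))"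
      unfolding A_def
      by (rule punctured_error_add[where R = "?n / \<epsilon>'"])
        (use int pos \<epsilon> out in \<open>auto intro: integrable_mult_right\<close>)
    ultimately have "A \<epsilon> - A \<epsilon>' = punctured_error \<alpha> f"
      by (simp add: A_def punctured_error_cmult[of _ "- 1", simplified])
    also have "\<bar>\<dots>\<bar> \<le> K * (2 ^ Suc k * C * (B + B) * (3 / 4 / \<epsilon>) powr (- N))"
    proof (rule K(2)[OF f'])
      show "\<forall>y. norm y \<ge> ?n / \<epsilon>' \<longrightarrow> f y = 0" using out by (simp add: f_def)
    qed
    also have "(3 / 4 / \<epsilon>) powr (- N) = (3 / 4) powr (- N) * \<epsilon> powr N"
      using pos by (simp add: powr_divide powr_minus powr_mult field_simps)
    finally show ?thesis by (simp add: mult.assoc)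
  qed
  from convergent_of_rate[of A, OF this N] show ?thesis unfolding A_def by blast
qed

text \<open>By homogeneity of \<open>sing_fun \<gamma> l\<close> times a monomial, the powers of \<open>h\<close> cancel, and the mesh size
  survives only in the width of the cutoff.\<close>
lemma scaled_error_eq:
  assumes l: "smooth_on_submanifold (sphere 0 1) l" and "h > 0" "\<Lambda> > 0"
  shows "scaled_error \<gamma> l \<alpha> \<psi> \<Lambda> \<beta> h
    = punctured_error \<alpha> (\<lambda>x. sing_fun \<gamma> l x * monomial \<beta> x * \<psi> ((h / \<Lambda>) *\<^sub>R x))"
    and "h ^ CARD('n) * punctured_error \<alpha> (\<lambda>x. sing_fun \<gamma> l (h *\<^sub>R x) * cutoff_monomial \<psi> \<Lambda> \<beta> (h *\<^sub>R x))
    = h powr (\<gamma> + real CARD('n) + real (mi_order \<beta>)) * scaled_error \<gamma> l \<alpha> \<psi> \<Lambda> \<beta> h"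
proof -
  let ?d = "\<gamma> + real (mi_order \<beta>)" and ?e = "\<gamma> + real CARD('n) + real (mi_order \<beta>)"
  let ?P = "\<lambda>x. sing_fun \<gamma> l x * cutoff_monomial \<psi> \<Lambda> \<beta> x"
  let ?Q = "punctured_error \<alpha> (\<lambda>x. sing_fun \<gamma> l x * monomial \<beta> x * \<psi> ((h / \<Lambda>) *\<^sub>R x))"
  have "sing_fun \<gamma> l \<in> borel_measurable borel"
    using symbol_sing_fun[OF l, of "Suc 0"] symbol_borel_measurable by blast
  moreover have "continuous_on UNIV (cutoff_monomial \<psi> \<Lambda> \<beta>)"
    unfolding cutoff_monomial_def[abs_def]
    using Ck_on_monomial[of 0 \<beta>] Ck_on_scale[OF Cc_infinity_Ck_on[OF \<psi>(1)], of 0 "inverse \<Lambda>"]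
    by (auto intro!: continuous_intros)
  then have "cutoff_monomial \<psi> \<Lambda> \<beta> \<in> borel_measurable borel"
    by (rule borel_measurable_continuous_onI)
  ultimately have m: "?P \<in> borel_measurable borel" by simp
  have "?P (h *\<^sub>R x) = h powr ?d * (sing_fun \<gamma> l x * monomial \<beta> x * \<psi> ((h / \<Lambda>) *\<^sub>R x))" for x
    using \<open>h > 0\<close>
    by (simp add: cutoff_monomial_def sing_fun_scaleR monomial_scaleR powr_add powr_realpow divide_inverse mult.commute)
  then have Q: "punctured_error \<alpha> (\<lambda>x. ?P (h *\<^sub>R x)) = h powr ?d * ?Q"
    by (simp only: punctured_error_cmult)
  have pw: "h ^ CARD('n) * h powr ?d = h powr ?e"
    using \<open>h > 0\<close> by (simp add: powr_realpow[symmetric] powr_add[symmetric] algebra_simps)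
  have "scaled_error \<gamma> l \<alpha> \<psi> \<Lambda> \<beta> h = h ^ CARD('n) * punctured_error \<alpha> (\<lambda>x. ?P (h *\<^sub>R x)) / h powr ?e"
    unfolding scaled_error_def Let_def using trapezoid_error_eq_punctured_error[OF \<open>h > 0\<close> m] by simp
  also have "\<dots> = ?Q" using \<open>h > 0\<close> unfolding Q pw[symmetric] by simp
  finally show 1: "scaled_error \<gamma> l \<alpha> \<psi> \<Lambda> \<beta> h = ?Q" .
  show "h ^ CARD('n) * punctured_error \<alpha> (\<lambda>x. ?P (h *\<^sub>R x)) = h powr ?e * scaled_error \<gamma> l \<alpha> \<psi> \<Lambda> \<beta> h"
    unfolding 1 Q pw[symmetric] by simp
qed

lemma scaled_error_converges:
  assumes l: "smooth_on_submanifold (sphere 0 1) l" and "\<gamma> > - real CARD('n)" "\<Lambda> > 0" "N > 0"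
  shows "\<exists>E K. \<forall>h>0. \<bar>scaled_error \<gamma> l \<alpha> \<psi> \<Lambda> \<beta> h - E\<bar> \<le> K * h powr N"
proof -
  have "\<gamma> + real (mi_order \<beta>) > - real CARD('n)" using assms(2) by simp
  from dilated_cutoff_error_converges[OF symbol_sing_fun_monomial[OF l] this \<open>N > 0\<close>]
  obtain E K where EK: "\<And>\<epsilon>. \<epsilon> > 0 \<Longrightarrow>
      \<bar>punctured_error \<alpha> (\<lambda>x. sing_fun \<gamma> l x * monomial \<beta> x * \<psi> (\<epsilon> *\<^sub>R x)) - E\<bar> \<le> K * \<epsilon> powr N" by blast
  have "\<bar>scaled_error \<gamma> l \<alpha> \<psi> \<Lambda> \<beta> h - E\<bar> \<le> K * \<Lambda> powr (- N) * h powr N" if "h > 0" for h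
    using EK[of "h / \<Lambda>"] that \<open>\<Lambda> > 0\<close> unfolding scaled_error_eq(1)[OF l that \<open>\<Lambda> > 0\<close>]
    by (simp add: powr_divide powr_minus powr_mult field_simps)
  then show ?thesis by blast
qed

end

text \<open>The matrix does not depend on \<open>h\<close>, so the solution is a fixed linear, hence continuous, function
  of the right-hand side, and the limit may be taken in the system itself.\<close>
lemma correction_weight_system:
  fixes c :: "'m::finite \<Rightarrow> int^'n"
  assumes inv: "invertible (node_matrix \<alpha> \<nu> c)"
    and lim: "\<And>j. (scaled_error \<gamma> l \<alpha> \<psi> \<Lambda> (\<nu> j) \<longlongrightarrow> E j) (at_right 0)"
  shows "(\<Sum>i\<in>UNIV. monomial (\<nu> j) (lattice_pt (c i) - \<alpha>) * correction_weight \<gamma> l \<alpha> \<psi> \<Lambda> \<nu> c i) = E j"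
proof -
  let ?K = "node_matrix \<alpha> \<nu> c"
  obtain M where M: "?K ** M = mat 1" "M ** ?K = mat 1"
    using inv unfolding invertible_def by blast
  have w: "weights_at \<gamma> l \<alpha> \<psi> \<Lambda> \<nu> c h = M *v (\<chi> j. scaled_error \<gamma> l \<alpha> \<psi> \<Lambda> (\<nu> j) h)" for h
    unfolding weights_at_def
  proof (rule the_equality)
    show "?K *v (M *v (\<chi> j. scaled_error \<gamma> l \<alpha> \<psi> \<Lambda> (\<nu> j) h)) = (\<chi> j. scaled_error \<gamma> l \<alpha> \<psi> \<Lambda> (\<nu> j) h)"
      by (simp add: matrix_vector_mul_assoc M)
    show "w = M *v (\<chi> j. scaled_error \<gamma> l \<alpha> \<psi> \<Lambda> (\<nu> j) h)"
      if "?K *v w = (\<chi> j. scaled_error \<gamma> l \<alpha> \<psi> \<Lambda> (\<nu> j) h)" for w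
      unfolding that[symmetric] by (simp add: matrix_vector_mul_assoc M)
  qed
  have "((\<lambda>h. weights_at \<gamma> l \<alpha> \<psi> \<Lambda> \<nu> c h $ i) \<longlongrightarrow> (M *v (\<chi> j. E j)) $ i) (at_right 0)" for i
    unfolding w matrix_vector_mult_def by (simp add: tendsto_sum tendsto_mult_left lim)
  then have "correction_weight \<gamma> l \<alpha> \<psi> \<Lambda> \<nu> c i = (M *v (\<chi> j. E j)) $ i" for i
    unfolding correction_weight_def by (intro tendsto_Lim) auto
  then have "(\<chi> i. correction_weight \<gamma> l \<alpha> \<psi> \<Lambda> \<nu> c i) = M *v (\<chi> j. E j)"
    by (simp add: vec_eq_iff)
  then have "?K *v (\<chi> i. correction_weight \<gamma> l \<alpha> \<psi> \<Lambda> \<nu> c i) = (\<chi> j. E j)"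
    by (simp add: matrix_vector_mul_assoc M)
  then have "(?K *v (\<chi> i. correction_weight \<gamma> l \<alpha> \<psi> \<Lambda> \<nu> c i)) $ j = E j" by simp
  then show ?thesis by (simp add: matrix_vector_mult_def node_matrix_def)
qed

section \<open>Convergence of the corrected rule\<close>

context lattice_cutoff
begin

lemma norm_shift_le: "norm \<alpha> \<le> real CARD('n) + 1"
  using infnorm_less_imp_norm_less[of \<alpha>] \<alpha> by simp

text \<open>Taylor's formula for \<open>v\<close> at the moving point \<open>h *\<^sub>R \<alpha>\<close>. The polynomial has to be multiplied by the
  cutoff to make the scaled errors of the monomials appear. This changes it only away from the
  origin, and there the change, localised to the support of the remainder, is a symbol of any order.\<close>
lemma cutoff_taylor:
  fixes v :: "real^'n \<Rightarrow> real"
  assumes v: "v \<in> Cc_infinity UNIV" and \<Lambda>: "\<Lambda> > 0"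
  shows "\<exists>a g R. (\<forall>h y. v (h *\<^sub>R \<alpha> + y)
      = (\<Sum>\<beta> | mi_order \<beta> < Suc p. a \<beta> h * cutoff_monomial \<psi> \<Lambda> \<beta> y) + g h y) \<and>
    (\<forall>\<beta>. \<exists>A. \<forall>h. \<bar>a \<beta> h\<bar> \<le> A) \<and>
    (\<forall>k. \<exists>C. \<forall>h. 0 < h \<longrightarrow> h \<le> 1 \<longrightarrow> symbol k (real p + 1) C (g h)) \<and>
    (\<forall>h. g h 0 = 0) \<and> (\<forall>h y. 0 < h \<longrightarrow> h \<le> 1 \<longrightarrow> norm y \<ge> R \<longrightarrow> g h y = 0)"
proof -
  let ?S = "{\<beta> :: nat^'n. mi_order \<beta> < Suc p}" and ?n = "real CARD('n) + 1"
  have fin: "finite ?S" by (rule finite_multi_indices_less)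
  have "\<exists>B. \<forall>h. bounded_derivs k B (\<lambda>y. v (h *\<^sub>R \<alpha> + y))" for k
    using Cc_infinity_bounded_derivs[OF v, of k] bounded_derivs_translate by blast
  from taylor_family[of "\<lambda>h y. v (h *\<^sub>R \<alpha> + y)" "Suc p", OF this]
  obtain a r where T: "(\<forall>h y. v (h *\<^sub>R \<alpha> + y) = (\<Sum>\<beta>\<in>?S. a \<beta> h * monomial \<beta> y) + r h y) \<and>
    (\<forall>\<beta>. \<exists>A. \<forall>h. \<bar>a \<beta> h\<bar> \<le> A) \<and> (Suc p > 0 \<longrightarrow> (\<forall>h. r h 0 = 0)) \<and>
    (\<forall>\<eta>\<in>Cc_infinity UNIV. \<forall>k. \<exists>C. \<forall>h. symbol k (real (Suc p)) C (\<lambda>x. \<eta> x * r h x))"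
    by (elim exE) (rule that)
  have v_eq: "v (h *\<^sub>R \<alpha> + y) = (\<Sum>\<beta>\<in>?S. a \<beta> h * monomial \<beta> y) + r h y"
    and a: "\<exists>A. \<forall>h. \<bar>a \<beta> h\<bar> \<le> A" and r0: "r h 0 = 0" for h y \<beta>
    using T by simp_all
  have r: "\<exists>C. \<forall>h. symbol k (real (Suc p)) C (\<lambda>x. \<eta> x * r h x)" if "\<eta> \<in> Cc_infinity UNIV" for \<eta> k
    using T that by blast
  define g where "g h y = v (h *\<^sub>R \<alpha> + y) - (\<Sum>\<beta>\<in>?S. a \<beta> h * cutoff_monomial \<psi> \<Lambda> \<beta> y)" for h y
  have g_eq: "g h y = r h y + (\<Sum>\<beta>\<in>?S. a \<beta> h * (monomial \<beta> y * (1 - \<psi> (y /\<^sub>R \<Lambda>))))" for h y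
    unfolding g_def v_eq by (simp add: cutoff_monomial_def algebra_simps sum_subtractf)
  obtain Rv where Rv: "\<And>y. norm y \<ge> Rv \<Longrightarrow> v y = 0" using Cc_infinity_bounded(2)[OF v] by blast
  define R where "R = max 1 (max (Rv + ?n) (?n * \<Lambda>))"
  have R1: "R \<ge> 1" by (simp add: R_def)
  have g_out: "g h y = 0" if "0 < h" "h \<le> 1" "norm y \<ge> R" for h y
  proof -
    have "norm (h *\<^sub>R \<alpha>) \<le> 1 * ?n"
      unfolding norm_scaleR using that norm_shift_le by (intro mult_mono) auto
    moreover have "norm y \<le> norm (h *\<^sub>R \<alpha> + y) + norm (h *\<^sub>R \<alpha>)"
      using norm_triangle_ineq4[of "h *\<^sub>R \<alpha> + y" "h *\<^sub>R \<alpha>"] by simp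
    ultimately have "v (h *\<^sub>R \<alpha> + y) = 0" using that by (intro Rv) (simp add: R_def)
    moreover have "\<psi> (y /\<^sub>R \<Lambda>) = 0"
      using \<psi>_scale_eq_0[of "inverse \<Lambda>" y] that \<Lambda> by (simp add: R_def divide_inverse)
    ultimately show ?thesis by (simp add: g_def cutoff_monomial_def)
  qed
  \<comment> \<open>\<open>\<eta>\<close> is \<open>1\<close> on the support of \<open>g h\<close>. Multiplying by it changes nothing, but makes the
    remainder and the truncated polynomial symbols separately.\<close>
  define \<eta> where "\<eta> y = \<psi> ((3 / 4 / R) *\<^sub>R y)" for y
  have \<eta>: "\<eta> \<in> Cc_infinity UNIV"
    unfolding \<eta>_def[abs_def] using R1 by (intro \<psi>_scale_Cc_infinity) simp
  have \<eta>1: "\<eta> y = 1" if "norm y \<le> R" for y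
    unfolding \<eta>_def by (rule \<psi>_scale_eq_1) (use R1 that in auto)
  define \<kappa> where "\<kappa> \<beta> y = \<eta> y * (monomial \<beta> y * (1 - \<psi> (y /\<^sub>R \<Lambda>)))" for \<beta> y
  have \<kappa>: "\<exists>C. symbol k (real p + 1) C (\<kappa> \<beta>)" for k \<beta>
  proof (rule symbol_Cc_infinity)
    obtain R\<eta> where "\<And>y. norm y \<ge> R\<eta> \<Longrightarrow> \<eta> y = 0" using Cc_infinity_bounded(2)[OF \<eta>] by blast
    then have out: "\<kappa> \<beta> y = 0" if "norm y > R\<eta>" for y using that by (simp add: \<kappa>_def)
    have "Ck_on j UNIV (\<lambda>y. \<eta> y * (monomial \<beta> y * (1 + (- 1) * \<psi> (y /\<^sub>R \<Lambda>))))" for j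
      by (intro Ck_on_mult Ck_on_add open_UNIV Ck_on_const Ck_on_monomial Ck_on_scale Cc_infinity_Ck_on \<psi>(1) \<eta>)
    then have "Ck_on j UNIV (\<kappa> \<beta>)" for j by (simp add: \<kappa>_def[abs_def])
    then show "\<kappa> \<beta> \<in> Cc_infinity UNIV" using out by (rule Cc_infinityI)
    have "\<kappa> \<beta> y = 0" if "norm y < 3 / 4 * \<Lambda>" for y
    proof -
      have "\<psi> (inverse \<Lambda> *\<^sub>R y) = 1" using \<Lambda> that by (intro \<psi>_scale_eq_1) (auto simp: field_simps)
      then show ?thesis by (simp add: \<kappa>_def)
    qed
    moreover have "3 / 4 * \<Lambda> > 0" using \<Lambda> by simp
    ultimately show "real p + 1 \<le> 0 \<or> (\<exists>\<delta>>0. \<forall>y. norm y < \<delta> \<longrightarrow> \<kappa> \<beta> y = 0)"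
      by blast
  qed
  have "\<exists>C. \<forall>h. 0 < h \<longrightarrow> h \<le> 1 \<longrightarrow> symbol k (real p + 1) C (g h)" for k
  proof -
    obtain C where C: "\<And>h. symbol k (real p + 1) C (\<lambda>y. \<eta> y * r h y)"
      using r[OF \<eta>, of k] by (auto simp: add.commute)
    obtain D where D: "\<And>\<beta>. symbol k (real p + 1) (D \<beta>) (\<kappa> \<beta>)" using \<kappa> by metis
    obtain A where A: "\<And>\<beta> h. \<bar>a \<beta> h\<bar> \<le> A \<beta>" using a by metis
    have "symbol k (real p + 1) (C + (\<Sum>\<beta>\<in>?S. A \<beta> * D \<beta>)) (g h)" if h: "0 < h" "h \<le> 1" for h
    proof -
      have "symbol k (real p + 1) (C + (\<Sum>\<beta>\<in>?S. A \<beta> * D \<beta>)) (\<lambda>y. \<eta> y * r h y + (\<Sum>\<beta>\<in>?S. a \<beta> h * \<kappa> \<beta> y))"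
        by (intro symbol_add C symbol_sum fin symbol_cmult[OF D] mult_right_mono A symbol_nonneg[OF D])
      moreover have "\<eta> y * r h y + (\<Sum>\<beta>\<in>?S. a \<beta> h * \<kappa> \<beta> y) = \<eta> y * g h y" for y
        by (simp add: g_eq \<kappa>_def distrib_left sum_distrib_left mult.left_commute)
      moreover have "\<eta> y * g h y = g h y" for y
        using \<eta>1[of y] g_out[OF h, of y] by (cases "norm y \<le> R") auto
      ultimately show ?thesis by simp
    qed
    then show ?thesis by blast
  qed
  moreover have "g h 0 = 0" for h
    using \<psi>_eq_1[of 0] by (simp add: g_eq r0)
  moreover have "v (h *\<^sub>R \<alpha> + y) = (\<Sum>\<beta>\<in>?S. a \<beta> h * cutoff_monomial \<psi> \<Lambda> \<beta> y) + g h y" for h y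
    by (simp add: g_def)
  ultimately show ?thesis using a g_out by blast
qed

text \<open>Each Taylor monomial contributes \<open>a \<beta> h * h powr (\<gamma> + n + \<bar>\<beta>\<bar>) * scaled_error \<dots> \<beta> h\<close> to the error
  of the uncorrected rule. By the linear system for the weights, the correction subtracts the same
  expression with the scaled error replaced by its limit, up to the Taylor remainder at the nodes.\<close>
lemma corrected_trapezoid_error_bound:
  fixes v l :: "real^'n \<Rightarrow> real" and \<nu> :: "'m::finite \<Rightarrow> nat^'n" and c :: "'m \<Rightarrow> int^'n"
  assumes v: "v \<in> Cc_infinity UNIV" and l: "smooth_on_submanifold (sphere 0 1) l"
    and \<gamma>: "\<gamma> > - real CARD('n)" and \<Lambda>: "\<Lambda> > 0"
    and \<nu>: "enumerates_multi_indices \<nu> p" and inv: "invertible (node_matrix \<alpha> \<nu> c)"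
  shows "\<exists>h\<^sub>1 C. 0 < h\<^sub>1 \<and> (\<forall>h. 0 < h \<longrightarrow> h < h\<^sub>1 \<longrightarrow>
    \<bar>integral\<^sup>L lborel (singular_integrand \<gamma> l \<alpha> v h) - corrected_trapezoid \<gamma> l \<alpha> \<psi> \<Lambda> \<nu> c v h\<bar>
      \<le> C * h powr (\<gamma> + real CARD('n) + real p + 1))"
proof -
  let ?S = "{\<beta> :: nat^'n. mi_order \<beta> < Suc p}" and ?n = "real CARD('n)"
  let ?s = "sing_fun \<gamma> l" and ?P = "cutoff_monomial \<psi> \<Lambda>" and ?q = "real p + 1"
  let ?\<omega> = "correction_weight \<gamma> l \<alpha> \<psi> \<Lambda> \<nu> c"
  have fin: "finite ?S" by (rule finite_multi_indices_less)
  obtain a g R where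
    v_eq: "\<And>h y. v (h *\<^sub>R \<alpha> + y) = (\<Sum>\<beta>\<in>?S. a \<beta> h * ?P \<beta> y) + g h y"
    and a: "\<And>\<beta>. \<exists>A. \<forall>h. \<bar>a \<beta> h\<bar> \<le> A"
    and g: "\<And>k. \<exists>C. \<forall>h. 0 < h \<longrightarrow> h \<le> 1 \<longrightarrow> symbol k ?q C (g h)"
    and g0: "\<And>h. g h 0 = 0" and g_out: "\<And>h y. 0 < h \<Longrightarrow> h \<le> 1 \<Longrightarrow> norm y \<ge> R \<Longrightarrow> g h y = 0"
    using cutoff_taylor[OF v \<Lambda>, of p] by (elim exE conjE) blast
  obtain A where A: "\<And>\<beta> h. \<bar>a \<beta> h\<bar> \<le> A \<beta>" using a by metis
  have A0: "A \<beta> \<ge> 0" for \<beta> using A[of \<beta> 0] by linarith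
  have "\<exists>E K. \<forall>h>0. \<bar>scaled_error \<gamma> l \<alpha> \<psi> \<Lambda> \<beta> h - E\<bar> \<le> K * h powr ?q" for \<beta>
    by (rule scaled_error_converges[OF l \<gamma> \<Lambda>]) simp
  then obtain E K where E: "\<And>\<beta> h. h > 0 \<Longrightarrow> \<bar>scaled_error \<gamma> l \<alpha> \<psi> \<Lambda> \<beta> h - E \<beta>\<bar> \<le> K \<beta> * h powr ?q"
    by metis
  have K0: "K \<beta> \<ge> 0" for \<beta> using E[of 1 \<beta>] by simp
  have "(scaled_error \<gamma> l \<alpha> \<psi> \<Lambda> \<beta> \<longlongrightarrow> E \<beta>) (at_right 0)" for \<beta>
  proof -
    have "((\<lambda>h. h powr ?q) \<longlongrightarrow> 0 powr ?q) (at_right 0)"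
      using eventually_at_right_less[of "0::real"]
      by (intro tendsto_powr') (auto elim: eventually_mono intro!: tendsto_intros)
    then have "((\<lambda>h. K \<beta> * h powr ?q) \<longlongrightarrow> 0) (at_right 0)"
      using tendsto_mult_left[of "\<lambda>h. h powr ?q" 0 _ "K \<beta>"] by simp
    moreover have "eventually (\<lambda>h. norm (scaled_error \<gamma> l \<alpha> \<psi> \<Lambda> \<beta> h - E \<beta>) \<le> K \<beta> * h powr ?q) (at_right 0)"
      using eventually_at_right_less[of 0] by eventually_elim (use E in simp)
    ultimately have "((\<lambda>h. scaled_error \<gamma> l \<alpha> \<psi> \<Lambda> \<beta> h - E \<beta>) \<longlongrightarrow> 0) (at_right 0)"
      by (rule Lim_null_comparison[rotated])
    then show ?thesis by (simp add: LIM_zero_iff)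
  qed
  then have "(\<Sum>i\<in>UNIV. monomial (\<nu> j) (lattice_pt (c i) - \<alpha>) * ?\<omega> i) = E (\<nu> j)" for j
    by (rule correction_weight_system[OF inv])
  moreover have "\<exists>j. \<beta> = \<nu> j" if "\<beta> \<in> ?S" for \<beta>
    using \<nu> that unfolding enumerates_multi_indices_def bij_betw_def by (auto simp: less_Suc_eq_le image_iff set_eq_iff)
  ultimately have weights: "(\<Sum>i\<in>UNIV. monomial \<beta> (lattice_pt (c i) - \<alpha>) * ?\<omega> i) = E \<beta>" if "\<beta> \<in> ?S" for \<beta>
    using that by metis
  \<comment> \<open>The remainder has order \<open>real p + 1\<close>, so that its product with \<open>sing_fun \<gamma> l\<close> has order
    \<open>\<gamma> + (real p + 1)\<close> and scaling to mesh size \<open>1\<close> yields the factor \<open>h powr (\<gamma> + (real p + 1))\<close>.\<close>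
  have m: "\<gamma> + ?q > - ?n" using \<gamma> by simp
  obtain k Kg where Kg: "Kg \<ge> 0" "\<And>f C R. symbol (Suc k) (\<gamma> + ?q) C f \<Longrightarrow> (\<forall>y. norm y \<ge> R \<longrightarrow> f y = 0) \<Longrightarrow>
      \<bar>punctured_error \<alpha> f\<bar> \<le> Kg * C"
    using symbol_quadrature_error[OF \<alpha> m \<psi>] by blast
  obtain Cs where Cs: "symbol (Suc k) \<gamma> Cs ?s" using symbol_sing_fun[OF l] by blast
  obtain Cg where Cg: "\<And>h. 0 < h \<Longrightarrow> h \<le> 1 \<Longrightarrow> symbol (Suc k) ?q Cg (g h)" using g by blast
  define G where "G h x = ?s x * g h x" for h x
  have G: "symbol (Suc k) (\<gamma> + ?q) (2 ^ Suc k * Cs * Cg) (G h)" if "0 < h" "h \<le> 1" for h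
    using symbol_mult[OF Cs Cg[OF that]] by (simp add: G_def[abs_def])
  have Gh: "symbol (Suc k) (\<gamma> + ?q) (2 ^ Suc k * Cs * Cg * h powr (\<gamma> + ?q)) (\<lambda>x. G h (h *\<^sub>R x))"
    if "0 < h" "h \<le> 1" for h
    using symbol_dilation[OF G[OF that] that(1)] .
  have G_out: "G h (h *\<^sub>R x) = 0" if "0 < h" "h \<le> 1" "norm x \<ge> R / h" for h x
  proof -
    have "norm (h *\<^sub>R x) \<ge> R" using that by (simp add: field_simps)
    then show ?thesis using g_out[OF that(1,2)] by (simp add: G_def)
  qed
  have G_err: "\<bar>punctured_error \<alpha> (\<lambda>x. G h (h *\<^sub>R x))\<bar> \<le> Kg * (2 ^ Suc k * Cs * Cg) * h powr (\<gamma> + ?q)"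
    if "0 < h" "h \<le> 1" for h
    using Kg(2)[OF Gh[OF that], of "R / h"] G_out[OF that] by (simp add: mult.assoc)
  have P_out: "?P \<beta> (h *\<^sub>R x) = 0" if "0 < h" "norm x \<ge> (?n + 1) * \<Lambda> / h" for \<beta> h x
  proof -
    have "\<psi> ((h / \<Lambda>) *\<^sub>R x) = 0" using that \<Lambda> by (intro \<psi>_scale_eq_0) auto
    then show ?thesis by (simp add: cutoff_monomial_def divide_inverse mult.commute)
  qed
  have trap: "integral\<^sup>L lborel (singular_integrand \<gamma> l \<alpha> v h)
      - punctured_trapezoid h (singular_integrand \<gamma> l \<alpha> v h)
    = (\<Sum>\<beta>\<in>?S. a \<beta> h * (h powr (\<gamma> + ?n + real (mi_order \<beta>)) * scaled_error \<gamma> l \<alpha> \<psi> \<Lambda> \<beta> h))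
      + h ^ CARD('n) * punctured_error \<alpha> (\<lambda>x. G h (h *\<^sub>R x))" if h: "0 < h" "h \<le> 1" for h
  proof -
    let ?f = "\<lambda>x. ?s x * v (h *\<^sub>R \<alpha> + x)"
    have "?s \<in> borel_measurable borel" using symbol_borel_measurable[OF Cs] .
    moreover have "continuous_on UNIV (\<lambda>x. v (h *\<^sub>R \<alpha> + x))"
      using Cc_infinity_Ck_on[OF v, of 0] by (auto intro!: continuous_on_compose2[of UNIV v] continuous_intros)
    then have "(\<lambda>x. v (h *\<^sub>R \<alpha> + x)) \<in> borel_measurable borel" by (rule borel_measurable_continuous_onI)
    ultimately have m: "?f \<in> borel_measurable borel" by simp
    have eq: "singular_integrand \<gamma> l \<alpha> v h = (\<lambda>x. ?f (x - h *\<^sub>R \<alpha>))"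
      by (auto simp: singular_integrand_def)
    have "integral\<^sup>L lborel (singular_integrand \<gamma> l \<alpha> v h)
        - punctured_trapezoid h (singular_integrand \<gamma> l \<alpha> v h)
      = h ^ CARD('n) * punctured_error \<alpha> (\<lambda>x. ?f (h *\<^sub>R x))"
      unfolding eq by (rule trapezoid_error_eq_punctured_error[OF h(1) m])
    also have "(\<lambda>x. ?f (h *\<^sub>R x)) = (\<lambda>x. (\<Sum>\<beta>\<in>?S. a \<beta> h * (?s (h *\<^sub>R x) * ?P \<beta> (h *\<^sub>R x))) + G h (h *\<^sub>R x))"
      unfolding v_eq G_def by (simp add: distrib_left sum_distrib_left mult.left_commute)
    also have "punctured_error \<alpha> \<dots> = (\<Sum>\<beta>\<in>?S. punctured_error \<alpha> (\<lambda>x. a \<beta> h * (?s (h *\<^sub>R x) * ?P \<beta> (h *\<^sub>R x))))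
        + punctured_error \<alpha> (\<lambda>x. G h (h *\<^sub>R x))"
    proof -
      define R' where "R' = max 1 (max ((?n + 1) * \<Lambda> / h) (R / h))"
      have R': "R' > 0" by (simp add: R'_def)
      have \<gamma>': "\<gamma> > - real DIM(real^'n)" "\<gamma> + ?q > - real DIM(real^'n)" using \<gamma> by simp_all
      have out: "a \<beta> h * (?s (h *\<^sub>R x) * ?P \<beta> (h *\<^sub>R x)) = 0" if "norm x \<ge> R'" for \<beta> x
        using P_out[OF h(1), of x] that by (simp add: R'_def)
      have Gout: "G h (h *\<^sub>R x) = 0" if "norm x \<ge> R'" for x
        using G_out[OF h, of x] that by (simp add: R'_def)
      have intG: "integrable lborel (\<lambda>x. G h (h *\<^sub>R x))"
        by (rule symbol_integrable(1)[OF Gh[OF h] \<gamma>'(2) Gout R'])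
      have intP: "integrable lborel (\<lambda>x. a \<beta> h * (?s (h *\<^sub>R x) * ?P \<beta> (h *\<^sub>R x)))" for \<beta>
      proof (intro integrable_mult_right)
        obtain Ck where "symbol (Suc 0) \<gamma> Ck ?s" using symbol_sing_fun[OF l] by blast
        moreover obtain Cp where "symbol (Suc 0) 0 Cp (?P \<beta>)"
        proof -
          have "?P \<beta> \<in> Cc_infinity UNIV"
          proof (rule Cc_infinityI)
            show "Ck_on k UNIV (?P \<beta>)" for k
              unfolding cutoff_monomial_def[abs_def]
              by (intro Ck_on_mult open_UNIV Ck_on_monomial Ck_on_scale Cc_infinity_Ck_on \<psi>(1))
            show "?P \<beta> y = 0" if "norm y > (?n + 1) * \<Lambda>" for y using P_out[of 1 y \<beta>] that by simp
          qed
          then show ?thesis using symbol_Cc_infinity[of "?P \<beta>" 0 "Suc 0"] that by blast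
        qed
        ultimately have "symbol (Suc 0) (\<gamma> + 0) (2 ^ Suc 0 * Ck * Cp) (\<lambda>x. ?s x * ?P \<beta> x)"
          by (rule symbol_mult)
        then have "symbol (Suc 0) \<gamma> (2 ^ Suc 0 * Ck * Cp) (\<lambda>x. ?s x * ?P \<beta> x)"
          by (simp only: add_0_right)
        from symbol_dilation[OF this h(1)]
        show "integrable lborel (\<lambda>x. ?s (h *\<^sub>R x) * ?P \<beta> (h *\<^sub>R x))"
          by (rule symbol_integrable(1)[OF _ \<gamma>'(1) _ R']) (use P_out[OF h(1)] in \<open>simp add: R'_def\<close>)
      qed
      have "punctured_error \<alpha> (\<lambda>x. (\<Sum>\<beta>\<in>?S. a \<beta> h * (?s (h *\<^sub>R x) * ?P \<beta> (h *\<^sub>R x))) + G h (h *\<^sub>R x))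
        = punctured_error \<alpha> (\<lambda>x. \<Sum>\<beta>\<in>?S. a \<beta> h * (?s (h *\<^sub>R x) * ?P \<beta> (h *\<^sub>R x)))
          + punctured_error \<alpha> (\<lambda>x. G h (h *\<^sub>R x))"
        by (rule punctured_error_add[of _ _ R', OF Bochner_Integration.integrable_sum[OF intP] intG])
          (use out Gout in \<open>simp_all add: sum.neutral\<close>)
      also have "punctured_error \<alpha> (\<lambda>x. \<Sum>\<beta>\<in>?S. a \<beta> h * (?s (h *\<^sub>R x) * ?P \<beta> (h *\<^sub>R x)))
        = (\<Sum>\<beta>\<in>?S. punctured_error \<alpha> (\<lambda>x. a \<beta> h * (?s (h *\<^sub>R x) * ?P \<beta> (h *\<^sub>R x))))"
        by (rule punctured_error_sum[OF fin intP out])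
      finally show ?thesis .
    qed
    also have "h ^ CARD('n) * \<dots>
        = (\<Sum>\<beta>\<in>?S. a \<beta> h * (h ^ CARD('n) * punctured_error \<alpha> (\<lambda>x. ?s (h *\<^sub>R x) * ?P \<beta> (h *\<^sub>R x))))
          + h ^ CARD('n) * punctured_error \<alpha> (\<lambda>x. G h (h *\<^sub>R x))"
      by (simp add: punctured_error_cmult distrib_left sum_distrib_left mult.left_commute)
    finally show ?thesis unfolding scaled_error_eq(2)[OF l h(1) \<Lambda>] .
  qed
  \<comment> \<open>For \<open>h < h\<^sub>1\<close> all correction nodes lie where the cutoff is \<open>1\<close>, so that the cutoff monomials are
    genuine monomials there.\<close>
  obtain Cv where Cv: "\<And>h. 0 < h \<Longrightarrow> h \<le> 1 \<Longrightarrow> symbol 0 ?q Cv (g h)" using g by blast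
  define N where "N = 1 + (\<Sum>i\<in>UNIV. norm (lattice_pt (c i) - \<alpha>))"
  have N: "norm (lattice_pt (c i) - \<alpha>) \<le> N" "N > 0" for i
    using member_le_sum[of i UNIV "\<lambda>i. norm (lattice_pt (c i) - \<alpha>)"]
      sum_nonneg[of UNIV "\<lambda>i. norm (lattice_pt (c i) - \<alpha>)"] unfolding N_def
    by simp_all
  define h\<^sub>1 where "h\<^sub>1 = min 1 (3 / 4 * \<Lambda> / N)"
  have node: "v (h *\<^sub>R lattice_pt (c i))
      = (\<Sum>\<beta>\<in>?S. a \<beta> h * (h ^ mi_order \<beta> * monomial \<beta> (lattice_pt (c i) - \<alpha>)))
        + g h (h *\<^sub>R (lattice_pt (c i) - \<alpha>))" if h: "0 < h" "h < h\<^sub>1" for h i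
  proof -
    let ?y = "lattice_pt (c i) - \<alpha>"
    have "\<psi> ((h / \<Lambda>) *\<^sub>R ?y) = 1"
    proof (rule \<psi>_scale_eq_1)
      have "h \<le> 3 / 4 * \<Lambda> / N" using h by (simp add: h\<^sub>1_def)
      then have "N \<le> 3 / 4 / (h / \<Lambda>)" using h \<Lambda> N(2) by (simp add: field_simps)
      then show "norm ?y \<le> 3 / 4 / (h / \<Lambda>)" using N(1)[of i] by linarith
    qed (use h \<Lambda> in simp)
    then have "?P \<beta> (h *\<^sub>R ?y) = h ^ mi_order \<beta> * monomial \<beta> ?y" for \<beta>
      by (simp add: cutoff_monomial_def monomial_scaleR divide_inverse mult.commute)
    moreover have "v (h *\<^sub>R lattice_pt (c i)) = v (h *\<^sub>R \<alpha> + h *\<^sub>R ?y)"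
      by (simp add: scaleR_diff_right)
    ultimately show ?thesis using v_eq[of h "h *\<^sub>R ?y"] by simp
  qed
  have g_node: "\<bar>g h (h *\<^sub>R (lattice_pt (c i) - \<alpha>))\<bar> \<le> Cv * N powr ?q * h powr ?q" if h: "0 < h" "h \<le> 1" for h i
  \<comment> \<open>For \<open>\<alpha> = 0\<close> the singular point may itself be a correction node, where symbol bounds say nothing.\<close>
  proof (cases "lattice_pt (c i) - \<alpha> = 0")
    case True
    then show ?thesis using g0 symbol_nonneg[OF Cv[OF h]] by simp
  next
    case False
    have "\<bar>g h (h *\<^sub>R (lattice_pt (c i) - \<alpha>))\<bar> \<le> Cv * norm (h *\<^sub>R (lattice_pt (c i) - \<alpha>)) powr ?q"
      using False h by (intro symbol_bound[OF Cv[OF h]]) auto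
    also have "\<dots> \<le> Cv * (N * h) powr ?q"
      using N(1)[of i] N(2) h symbol_nonneg[OF Cv[OF h]]
      by (intro mult_left_mono powr_mono2) (auto simp: mult.commute[of N])
    finally show ?thesis by (simp add: powr_mult mult.assoc)
  qed
  define C where "C = (\<Sum>\<beta>\<in>?S. A \<beta> * K \<beta>) + Kg * (2 ^ Suc k * Cs * Cg) + (\<Sum>i\<in>UNIV. \<bar>?\<omega> i\<bar> * (Cv * N powr ?q))"
  have "\<bar>integral\<^sup>L lborel (singular_integrand \<gamma> l \<alpha> v h) - corrected_trapezoid \<gamma> l \<alpha> \<psi> \<Lambda> \<nu> c v h\<bar>
      \<le> C * h powr (\<gamma> + ?n + real p + 1)" if h: "0 < h" "h < h\<^sub>1" for h
  proof -
    have h1: "h \<le> 1" using h by (simp add: h\<^sub>1_def)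
    let ?e = "\<gamma> + ?n" and ?y = "\<lambda>i. lattice_pt (c i) - \<alpha>"
    have pw: "h powr (?e + real j) = h powr ?e * h ^ j" for j
      using h(1) by (simp add: powr_add powr_realpow)
    have "(\<Sum>i\<in>UNIV. ?\<omega> i * v (h *\<^sub>R lattice_pt (c i)))
        = (\<Sum>i\<in>UNIV. \<Sum>\<beta>\<in>?S. a \<beta> h * (h ^ mi_order \<beta> * (monomial \<beta> (?y i) * ?\<omega> i)))
          + (\<Sum>i\<in>UNIV. ?\<omega> i * g h (h *\<^sub>R ?y i))"
      by (simp add: node[OF h] distrib_left sum.distrib sum_distrib_left ac_simps)
    also have "(\<Sum>i\<in>UNIV. \<Sum>\<beta>\<in>?S. a \<beta> h * (h ^ mi_order \<beta> * (monomial \<beta> (?y i) * ?\<omega> i)))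
        = (\<Sum>\<beta>\<in>?S. a \<beta> h * (h ^ mi_order \<beta> * (\<Sum>i\<in>UNIV. monomial \<beta> (?y i) * ?\<omega> i)))"
      unfolding sum_distrib_left by (rule sum.swap)
    also have "\<dots> = (\<Sum>\<beta>\<in>?S. a \<beta> h * (h ^ mi_order \<beta> * E \<beta>))"
      using weights by (intro sum.cong) auto
    finally have corr: "h powr ?e * (\<Sum>i\<in>UNIV. ?\<omega> i * v (h *\<^sub>R lattice_pt (c i)))
        = (\<Sum>\<beta>\<in>?S. a \<beta> h * (h powr (?e + real (mi_order \<beta>)) * E \<beta>))
          + h powr ?e * (\<Sum>i\<in>UNIV. ?\<omega> i * g h (h *\<^sub>R ?y i))"
      unfolding pw by (simp add: distrib_left sum_distrib_left mult.assoc mult.left_commute)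
    have "integral\<^sup>L lborel (singular_integrand \<gamma> l \<alpha> v h) - corrected_trapezoid \<gamma> l \<alpha> \<psi> \<Lambda> \<nu> c v h
      = (\<Sum>\<beta>\<in>?S. a \<beta> h * (h powr (?e + real (mi_order \<beta>)) * (scaled_error \<gamma> l \<alpha> \<psi> \<Lambda> \<beta> h - E \<beta>)))
        + h ^ CARD('n) * punctured_error \<alpha> (\<lambda>x. G h (h *\<^sub>R x))
        - h powr ?e * (\<Sum>i\<in>UNIV. ?\<omega> i * g h (h *\<^sub>R ?y i))"
      using trap[OF h(1) h1] corr unfolding corrected_trapezoid_def
      by (simp add: right_diff_distrib sum_subtractf)
    moreover have "\<bar>\<Sum>\<beta>\<in>?S. a \<beta> h * (h powr (?e + real (mi_order \<beta>)) * (scaled_error \<gamma> l \<alpha> \<psi> \<Lambda> \<beta> h - E \<beta>))\<bar>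
        \<le> (\<Sum>\<beta>\<in>?S. A \<beta> * K \<beta>) * (h powr ?e * h powr ?q)"
    proof -
      have "\<bar>a \<beta> h * (h powr (?e + real (mi_order \<beta>)) * (scaled_error \<gamma> l \<alpha> \<psi> \<Lambda> \<beta> h - E \<beta>))\<bar>
          \<le> A \<beta> * (h powr ?e * (K \<beta> * h powr ?q))" for \<beta>
      proof -
        have "h powr (?e + real (mi_order \<beta>)) \<le> h powr ?e"
          using h(1) h1 by (intro powr_mono') auto
        then show ?thesis
          unfolding abs_mult using A A0 E[OF h(1)] K0 by (intro mult_mono) auto
      qed
      then have "\<bar>\<Sum>\<beta>\<in>?S. a \<beta> h * (h powr (?e + real (mi_order \<beta>)) * (scaled_error \<gamma> l \<alpha> \<psi> \<Lambda> \<beta> h - E \<beta>))\<bar>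
          \<le> (\<Sum>\<beta>\<in>?S. A \<beta> * (h powr ?e * (K \<beta> * h powr ?q)))"
        by (intro order_trans[OF sum_abs] sum_mono)
      also have "\<dots> = (\<Sum>\<beta>\<in>?S. A \<beta> * K \<beta>) * (h powr ?e * h powr ?q)"
        unfolding sum_distrib_right by (simp only: mult.assoc mult.left_commute)
      finally show ?thesis .
    qed
    moreover have "\<bar>h ^ CARD('n) * punctured_error \<alpha> (\<lambda>x. G h (h *\<^sub>R x))\<bar>
        \<le> Kg * (2 ^ Suc k * Cs * Cg) * (h powr ?e * h powr ?q)"
    proof -
      have "\<bar>h ^ CARD('n) * punctured_error \<alpha> (\<lambda>x. G h (h *\<^sub>R x))\<bar>
          \<le> h ^ CARD('n) * (Kg * (2 ^ Suc k * Cs * Cg) * h powr (\<gamma> + ?q))"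
        unfolding abs_mult using h(1) by (intro mult_mono G_err[OF h(1) h1]) auto
      also have "\<dots> = Kg * (2 ^ Suc k * Cs * Cg) * (h ^ CARD('n) * h powr (\<gamma> + ?q))"
        by (rule mult.left_commute)
      also have "h ^ CARD('n) * h powr (\<gamma> + ?q) = h powr ?e * h powr ?q"
        using h(1) by (simp add: powr_realpow[symmetric] powr_add[symmetric] algebra_simps)
      finally show ?thesis .
    qed
    moreover have "\<bar>h powr ?e * (\<Sum>i\<in>UNIV. ?\<omega> i * g h (h *\<^sub>R ?y i))\<bar>
        \<le> (\<Sum>i\<in>UNIV. \<bar>?\<omega> i\<bar> * (Cv * N powr ?q)) * (h powr ?e * h powr ?q)"
    proof -
      have "\<bar>\<Sum>i\<in>UNIV. ?\<omega> i * g h (h *\<^sub>R ?y i)\<bar> \<le> (\<Sum>i\<in>UNIV. \<bar>?\<omega> i\<bar> * (Cv * N powr ?q * h powr ?q))"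
        by (rule order_trans[OF sum_abs], rule sum_mono, unfold abs_mult)
          (intro mult_left_mono g_node h(1) h1 abs_ge_zero)
      then have "h powr ?e * \<bar>\<Sum>i\<in>UNIV. ?\<omega> i * g h (h *\<^sub>R ?y i)\<bar>
          \<le> h powr ?e * (\<Sum>i\<in>UNIV. \<bar>?\<omega> i\<bar> * (Cv * N powr ?q * h powr ?q))"
        by (intro mult_left_mono) auto
      also have "\<dots> = (\<Sum>i\<in>UNIV. \<bar>?\<omega> i\<bar> * (Cv * N powr ?q)) * (h powr ?e * h powr ?q)"
        unfolding sum_distrib_left sum_distrib_right by (simp only: mult.assoc mult.left_commute)
      finally show ?thesis by (simp only: abs_mult abs_of_nonneg[OF powr_ge_zero])
    qed
    ultimately have "\<bar>integral\<^sup>L lborel (singular_integrand \<gamma> l \<alpha> v h) - corrected_trapezoid \<gamma> l \<alpha> \<psi> \<Lambda> \<nu> c v h\<bar>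
        \<le> C * (h powr ?e * h powr ?q)"
      unfolding C_def distrib_right by linarith
    moreover have "h powr ?e * h powr ?q = h powr (?e + real p + 1)"
      by (simp add: powr_add[symmetric] algebra_simps)
    ultimately show ?thesis by simp
  qed
  moreover have "h\<^sub>1 > 0" using \<Lambda> N(2) by (simp add: h\<^sub>1_def)
  ultimately show ?thesis by blast
qed

end

theorem theorem4p1:
  fixes p :: nat
    and L L' h\<^sub>0 \<gamma> \<Lambda> :: real
    and \<alpha> :: "real^'n"
    and v l\<^sub>0 \<psi> :: "real^'n \<Rightarrow> real"
    and \<nu> :: "'m::finite \<Rightarrow> nat^'n"
    and c :: "'m \<Rightarrow> int^'n"
  assumes "0 < L + 3 / 2 * h\<^sub>0 * sqrt (real CARD('n))"
    and "L + 3 / 2 * h\<^sub>0 * sqrt (real CARD('n)) < L'"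
    and "0 < h\<^sub>0" and "h\<^sub>0 \<le> 1"
    and "infnorm \<alpha> \<le> 1 / 2"
    and "v \<in> Cc_infinity (ball 0 L)"
    and "smooth_on_submanifold (sphere 0 1) l\<^sub>0"
    and "\<gamma> > - real CARD('n)"
    and "\<psi> \<in> Cc_infinity UNIV"
    and "\<And>x. infnorm x \<le> 3 / 4 \<Longrightarrow> \<psi> x = 1"
    and "\<And>x. infnorm x \<ge> 1 \<Longrightarrow> \<psi> x = 0"
    and "enumerates_multi_indices \<nu> p"
    and "invertible (node_matrix \<alpha> \<nu> c)"
    and "\<Lambda> > 0"
    and "\<Lambda> \<ge> 4 / 3 * h\<^sub>0 * Max (range (\<lambda>i. norm (lattice_pt (c i))))"
  shows "(\<lambda>h. integral\<^sup>L lborel (singular_integrand \<gamma> l\<^sub>0 \<alpha> v h)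
              - corrected_trapezoid \<gamma> l\<^sub>0 \<alpha> \<psi> \<Lambda> \<nu> c v h)
         \<in> O[at_right 0](\<lambda>h. h powr (\<gamma> + real CARD('n) + real p + 1))"
proof -
  interpret lattice_cutoff \<alpha> \<psi>
    by unfold_locales (use assms(5,9-11) in auto)
  have v: "v \<in> Cc_infinity UNIV" using Cc_infinity_subset_UNIV[OF assms(6)] by simp
  obtain h\<^sub>1 C where h\<^sub>1: "h\<^sub>1 > 0" and
    C: "\<And>h. 0 < h \<Longrightarrow> h < h\<^sub>1 \<Longrightarrow>
      \<bar>integral\<^sup>L lborel (singular_integrand \<gamma> l\<^sub>0 \<alpha> v h) - corrected_trapezoid \<gamma> l\<^sub>0 \<alpha> \<psi> \<Lambda> \<nu> c v h\<bar>
        \<le> C * h powr (\<gamma> + real CARD('n) + real p + 1)"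
    using corrected_trapezoid_error_bound[OF v assms(7,8,14,12,13)] by blast
  have "eventually (\<lambda>h. 0 < h \<and> h < h\<^sub>1) (at_right 0)"
    using h\<^sub>1 by (auto simp: eventually_at_right_field intro!: exI[of _ h\<^sub>1])
  then show ?thesis
    by (intro bigoI[of _ C]) (auto elim!: eventually_mono simp: C)
qed

end
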